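(* Let $\{c_i^n\}_{i=1}^m,\Phi^n,\mathbf u^n,p^n,r^n$ be given, with $\sigma_i^n=\log c_i^n$. Suppose $c_i^n>0$ and $\int_\Omega c_i^n\,dx=\int_\Omega c_i^0\,dx$ for $i=1,\dots,m$. Then the solution $(\{c_i^{n+1}\},\mathbf u^{n+1},p^{n+1},r^{n+1})$ of the discrete problem Scheme1 (defined in the context, with arbitrary time step $\Delta t>0$) satisfies the following properties: (i) Positivity preserving: $c_i^{n+1}>0$, $i=1,\dots,m$. (ii) Mass conserving: $\int_\Omega c_i^{n+1}\,dx=\int_\Omega c_i^n\,dx$, $i=1,\dots,m$. (iii) Energy dissipation: $\mathcal E^{n+1}-\mathcal E^n\le 0$, where $$\mathcal E^{n+1}:=\|\mathbf u^{n+1}\|^2+\Delta t^2\|\nabla p^{n+1}\|^2+|r^{n+1}|^2 .$$ (iv) The quantities $\|\mathbf u^n\|$, $|r^n|$ and $|\xi^n|$ are bounded for all $n\ge 0$.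
   Context: $\Omega\subset\mathbb R^2$ is a bounded Lipschitz domain with outward unit normal $\mathbf n$; $m\ge1$ is an integer; $z_i\in\mathbb R$, $D_i>0$ ($i=1,\dots,m$), $\epsilon>0$, $\nu>0$ are constants; $\Delta t>0$ is the time step size and $n\ge0$ the time step index. $\|\cdot\|$ is the $L^2(\Omega)$ norm (for scalar or vector functions). Sufficient regularity for the expressions and integrations by parts to make sense is implicit throughout. Define $$E_{npp}[\{c_i\},\Phi]=\int_\Omega\Big[\sum_{i=1}^m c_i(\log c_i-1)+\tfrac12\Big(\sum_{i=1}^m z_ic_i\Big)\Phi\Big]dx ,$$ and let $C_0>0$ be a constant such that $E_{npp}[\{c_i\},\Phi]+C_0\ge 1$. Initial data: velocity $\mathbf u^0$, concentrations $c_i^0>0$, $r^0=\sqrt{E_{npp}[\{c_i^0\},\Phi^0]+C_0}$, with $\Phi^0$ and $p^0$ (zero mean) given by $\epsilon\int_\Omega\nabla\Phi^0\cdot\nabla q\,dx=\int_\Omega(\sum_i z_ic_i^0)q\,dx$ and $\int_\Omega\nabla p^0\cdot\nabla q\,dx=\int_\Omega(-(\sum_i z_ic_i^0)\nabla\Phi^0-\mathbf u^0\cdot\nabla\mathbf u^0)\cdot\nabla q\,dx$ for all $q\in H^1(\Omega)$. The scheme below is applied successively for $n\ge0$ starting from these data. Scheme1 (step from level $n$ to level $n+1$). Notation: $\bar\mu_i^{n+1}=\log c_i^{n+1}+z_i\bar\Phi^{n+1}$, $\bar E_{npp}^{n+1}=E_{npp}[\{c_i^{n+1}\},\bar\Phi^{n+1}]$,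 $\xi^{n+1}=r^{n+1}/\sqrt{\bar E_{npp}^{n+1}+C_0}$, and $\xi^0=1$. The unknowns at level $n+1$ satisfy, for $i=1,\dots,m$: (a) $\dfrac{\sigma_i^{n+1}-\sigma_i^n}{\Delta t}-D_i\Delta\sigma_i^{n+1}=D_i\big[|\nabla\sigma_i^n|^2+z_i(\nabla\sigma_i^n\cdot\nabla\Phi^n+\Delta\Phi^n)\big]-\nabla\cdot(\sigma_i^n\mathbf u^n)$ in $\Omega$, $\partial_{\mathbf n}\sigma_i^{n+1}=0$ on $\partial\Omega$; (b) $\bar c_i^{n+1}=\exp(\sigma_i^{n+1})$, $\ \lambda_i^{n+1}\int_\Omega\bar c_i^{n+1}dx-\int_\Omega c_i^n\,dx=0$ with $\lambda_i^{n+1}\in\mathbb R$, $\ c_i^{n+1}=\lambda_i^{n+1}\bar c_i^{n+1}$; (c) $-\epsilon\Delta\bar\Phi^{n+1}=\sum_{i=1}^m z_ic_i^{n+1}$ in $\Omega$, $\int_\Omega\bar\Phi^{n+1}dx=0$, $\partial_{\mathbf n}\bar\Phi^{n+1}=0$ on $\partial\Omega$; (d) $\dfrac{\tilde{\mathbf u}^{n+1}-\mathbf u^n}{\Delta t}+\xi^{n+1}\Big[(\mathbf u^n\cdot\nabla)\mathbf u^n+\Big(\sum_{i=1}^m z_ic_i^{n+1}\Big)\nabla\bar\Phi^{n+1}\Big]-\nu\Delta\tilde{\mathbf u}^{n+1}+\nabla p^n=0$ in $\Omega$, $\tilde{\mathbf u}^{n+1}=0$ on $\partial\Omega$; (e)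 $\Delta\psi^{n+1}=\frac1{\Delta t}\nabla\cdot\tilde{\mathbf u}^{n+1}$ in $\Omega$, $\partial_{\mathbf n}\psi^{n+1}=0$ on $\partial\Omega$; $\ \mathbf u^{n+1}=\tilde{\mathbf u}^{n+1}-\Delta t\nabla\psi^{n+1}$; $\ p^{n+1}=\psi^{n+1}+p^n$ (the additive constant in the pressure being fixed by zero mean); (f) $\dfrac{r^{n+1}-r^n}{\Delta t}=-\dfrac1{2\sqrt{\bar E_{npp}^{n+1}+C_0}}\Big[\xi^{n+1}\displaystyle\int_\Omega\sum_{i=1}^m D_ic_i^{n+1}|\nabla\bar\mu_i^{n+1}|^2dx-\int_\Omega\Big(\sum_{i=1}^m z_ic_i^{n+1}\Big)\nabla\bar\Phi^{n+1}\cdot\tilde{\mathbf u}^{n+1}dx-\int_\Omega(\mathbf u^n\cdot\nabla)\mathbf u^n\cdot\tilde{\mathbf u}^{n+1}dx\Big]$; (g) $\Phi^{n+1}=\xi^{n+1}\bar\Phi^{n+1}$.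
   Formalization: Part (iii) fails as printed (e.g. radial u^0=(1-|x|^2)x on the unit disc, z=0, c=1, small ν and Δt); it is proved for the corrected energy ½(‖u‖²+Δt²‖∇p‖²)+|r|², with all fields read as classical (C² inside, C¹ up to the boundary). *)

theory Defs
  imports "HOL-Analysis.Analysis"
begin

type_synonym plane = "real^2"
type_synonym scalar_field = "plane \<Rightarrow> real"
type_synonym vector_field = "plane \<Rightarrow> plane"


subsection \<open>Differential operators\<close>

definition grad :: "scalar_field \<Rightarrow> vector_field" where
  "grad f x = (\<Sum>b\<in>Basis. frechet_derivative f (at x) b *\<^sub>R b)"

definition dvg :: "vector_field \<Rightarrow> scalar_field" where
  "dvg F x = (\<Sum>b\<in>Basis. frechet_derivative F (at x) b \<bullet> b)"

definition lap :: "scalar_field \<Rightarrow> scalar_field" where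
  "lap f = dvg (grad f)"

definition vec_lap :: "vector_field \<Rightarrow> vector_field" where
  "vec_lap F x = (\<Sum>b\<in>Basis. lap (\<lambda>y. F y \<bullet> b) x *\<^sub>R b)"

text \<open>The convective derivative \<open>(u \<cdot> \<nabla>) v\<close>.\<close>

definition convect :: "vector_field \<Rightarrow> vector_field \<Rightarrow> vector_field" where
  "convect u v x = frechet_derivative v (at x) (u x)"


subsection \<open>Bounded Lipschitz domains and their normals\<close>

text \<open>Near each boundary point the domain is, in rotated coordinates, the region
  strictly below the graph of a Lipschitz function.\<close>

definition bounded_lipschitz_domain :: "plane set \<Rightarrow> bool" where
  "bounded_lipschitz_domain \<Omega> \<longleftrightarrow>
     open \<Omega> \<and> connected \<Omega> \<and> \<Omega> \<noteq> {} \<and> bounded \<Omega> \<and>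
     (\<forall>x\<in>frontier \<Omega>. \<exists>r>0. \<exists>e1 e2. \<exists>g :: real \<Rightarrow> real. \<exists>L.
        norm e1 = 1 \<and> norm e2 = 1 \<and> e1 \<bullet> e2 = 0 \<and> L-lipschitz_on UNIV g \<and>
        \<Omega> \<inter> ball x r = {y \<in> ball x r. y \<bullet> e2 < g (y \<bullet> e1)})"

text \<open>\<open>\<nu>\<close> is the outward unit normal at the boundary point \<open>x\<close>: near \<open>x\<close>, every closed cone
  around \<open>-\<nu>\<close> of half-angle less than a right angle lies inside \<open>\<Omega>\<close> and the opposite one
  outside. At a given point there is at most one such \<open>\<nu>\<close>; there may be none, for instance at
  a corner. If the boundary is locally the graph of \<open>g\<close>, it exists exactly where \<open>g\<close>
  is differentiable, hence at almost every boundary point of a Lipschitz domain.\<close>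

definition outward_unit_normal :: "plane set \<Rightarrow> plane \<Rightarrow> plane \<Rightarrow> bool" where
  "outward_unit_normal \<Omega> x \<nu> \<longleftrightarrow>
     norm \<nu> = 1 \<and>
     (\<forall>\<delta>>0. \<exists>\<rho>>0. \<forall>y\<in>ball x \<rho>.
        ((y - x) \<bullet> \<nu> < - \<delta> * norm (y - x) \<longrightarrow> y \<in> \<Omega>) \<and>
        ((y - x) \<bullet> \<nu> > \<delta> * norm (y - x) \<longrightarrow> y \<notin> \<Omega>))"

text \<open>The normal derivative uses the boundary value of the gradient, that is, its limit
  from inside \<open>\<Omega>\<close>. The boundary condition is imposed wherever the normal exists.\<close>

definition has_normal_derivative :: "plane set \<Rightarrow> scalar_field \<Rightarrow> plane \<Rightarrow> real \<Rightarrow> bool" where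
  "has_normal_derivative \<Omega> f x d \<longleftrightarrow>
     (\<exists>\<nu>. outward_unit_normal \<Omega> x \<nu> \<and> ((\<lambda>y. grad f y \<bullet> \<nu>) \<longlongrightarrow> d) (at x within \<Omega>))"

definition zero_neumann :: "plane set \<Rightarrow> scalar_field \<Rightarrow> bool" where
  "zero_neumann \<Omega> f \<longleftrightarrow>
     (\<forall>x\<in>frontier \<Omega>. (\<exists>\<nu>. outward_unit_normal \<Omega> x \<nu>) \<longrightarrow> has_normal_derivative \<Omega> f x 0)"

definition zero_dirichlet :: "plane set \<Rightarrow> vector_field \<Rightarrow> bool" where
  "zero_dirichlet \<Omega> v \<longleftrightarrow> (\<forall>x\<in>frontier \<Omega>. v x = 0)"


subsection \<open>Regularity classes\<close>

text \<open>For open \<open>S\<close> this is the space \<open>C\<^sup>k(S)\<close>.\<close>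

primrec Ck_on :: "nat \<Rightarrow> plane set \<Rightarrow> (plane \<Rightarrow> 'b::real_normed_vector) \<Rightarrow> bool" where
  "Ck_on 0 S f \<longleftrightarrow> continuous_on S f"
| "Ck_on (Suc k) S f \<longleftrightarrow>
     (\<forall>x\<in>S. f differentiable (at x)) \<and> (\<forall>v. Ck_on k S (\<lambda>x. frechet_derivative f (at x) v))"

text \<open>The space \<open>C\<^sup>1\<close> up to the boundary: the function is continuous on the closure and its
  first derivatives, taken in the open set, extend continuously to the closure.\<close>

definition C1_bar :: "plane set \<Rightarrow> (plane \<Rightarrow> 'b::real_normed_vector) \<Rightarrow> bool" where
  "C1_bar \<Omega> f \<longleftrightarrow>
     continuous_on (closure \<Omega>) f \<and> (\<forall>x\<in>\<Omega>. f differentiable (at x)) \<and>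
     (\<forall>v. \<exists>g. continuous_on (closure \<Omega>) g \<and> (\<forall>x\<in>\<Omega>. g x = frechet_derivative f (at x) v))"

text \<open>Classical solutions of second order boundary value problems with derivative boundary
  conditions live in \<open>C\<^sup>2(\<Omega>) \<inter> C\<^sup>1(closure \<Omega>)\<close>.\<close>

definition classical :: "plane set \<Rightarrow> (plane \<Rightarrow> 'b::real_normed_vector) \<Rightarrow> bool" where
  "classical \<Omega> f \<longleftrightarrow> Ck_on 2 \<Omega> f \<and> C1_bar \<Omega> f"


subsection \<open>Lebesgue and Sobolev notions\<close>

abbreviation dom_integral :: "plane set \<Rightarrow> (plane \<Rightarrow> 'b::euclidean_space) \<Rightarrow> 'b" where
  "dom_integral \<Omega> f \<equiv> integral\<^sup>L (lebesgue_on \<Omega>) f"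

definition l2_on :: "plane set \<Rightarrow> (plane \<Rightarrow> 'b::euclidean_space) \<Rightarrow> bool" where
  "l2_on \<Omega> f \<longleftrightarrow>
     f \<in> borel_measurable (lebesgue_on \<Omega>) \<and> integrable (lebesgue_on \<Omega>) (\<lambda>x. (norm (f x))\<^sup>2)"

definition l2_norm :: "plane set \<Rightarrow> (plane \<Rightarrow> 'b::euclidean_space) \<Rightarrow> real" where
  "l2_norm \<Omega> f = sqrt (dom_integral \<Omega> (\<lambda>x. (norm (f x))\<^sup>2))"

definition test_function :: "plane set \<Rightarrow> scalar_field \<Rightarrow> bool" where
  "test_function \<Omega> \<phi> \<longleftrightarrow>
     (\<forall>k. Ck_on k UNIV \<phi>) \<and> (\<exists>K. compact K \<and> K \<subseteq> \<Omega> \<and> (\<forall>x. x \<notin> K \<longrightarrow> \<phi> x = 0))"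

text \<open>\<open>q\<close> belongs to \<open>H\<^sup>1(\<Omega>)\<close> and \<open>G\<close> is its weak gradient.\<close>

definition h1_with_gradient :: "plane set \<Rightarrow> scalar_field \<Rightarrow> vector_field \<Rightarrow> bool" where
  "h1_with_gradient \<Omega> q G \<longleftrightarrow>
     l2_on \<Omega> q \<and> l2_on \<Omega> G \<and>
     (\<forall>\<phi>. test_function \<Omega> \<phi> \<longrightarrow>
        dom_integral \<Omega> (\<lambda>x. q x *\<^sub>R grad \<phi> x) = - dom_integral \<Omega> (\<lambda>x. \<phi> x *\<^sub>R G x))"


subsection \<open>Energy\<close>

definition charge :: "nat \<Rightarrow> (nat \<Rightarrow> real) \<Rightarrow> (nat \<Rightarrow> scalar_field) \<Rightarrow> scalar_field" where
  "charge m z c x = (\<Sum>i=1..m. z i * c i x)"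

definition E_npp ::
  "plane set \<Rightarrow> nat \<Rightarrow> (nat \<Rightarrow> real) \<Rightarrow> (nat \<Rightarrow> scalar_field) \<Rightarrow> scalar_field \<Rightarrow> real" where
  "E_npp \<Omega> m z c \<Phi> =
     dom_integral \<Omega> (\<lambda>x. (\<Sum>i=1..m. c i x * (ln (c i x) - 1)) + 1/2 * charge m z c x * \<Phi> x)"

definition neumann_poisson ::
  "plane set \<Rightarrow> real \<Rightarrow> scalar_field \<Rightarrow> scalar_field \<Rightarrow> bool" where
  "neumann_poisson \<Omega> \<epsilon> \<rho> \<Phi> \<longleftrightarrow>
     classical \<Omega> \<Phi> \<and> (\<forall>x\<in>\<Omega>. - \<epsilon> * lap \<Phi> x = \<rho> x) \<and>
     dom_integral \<Omega> \<Phi> = 0 \<and> zero_neumann \<Omega> \<Phi>"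

definition weak_neumann_poisson ::
  "plane set \<Rightarrow> real \<Rightarrow> scalar_field \<Rightarrow> scalar_field \<Rightarrow> bool" where
  "weak_neumann_poisson \<Omega> \<epsilon> \<rho> \<Phi> \<longleftrightarrow>
     classical \<Omega> \<Phi> \<and> dom_integral \<Omega> \<Phi> = 0 \<and>
     (\<forall>q G. h1_with_gradient \<Omega> q G \<longrightarrow>
        \<epsilon> * dom_integral \<Omega> (\<lambda>x. grad \<Phi> x \<bullet> G x) = dom_integral \<Omega> (\<lambda>x. \<rho> x * q x))"

text \<open>The constant \<open>C0\<close> serves all positive concentrations paired with the potential they
  generate. Without that coupling the energy has no lower bound; with it, the electrostatic part
  is nonnegative and \<open>c (ln c - 1) \<ge> -1\<close>, so that \<open>C0 = 1 + m |\<Omega>|\<close> qualifies.\<close>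

definition energy_shift ::
  "plane set \<Rightarrow> nat \<Rightarrow> (nat \<Rightarrow> real) \<Rightarrow> real \<Rightarrow> real \<Rightarrow> bool" where
  "energy_shift \<Omega> m z \<epsilon> C0 \<longleftrightarrow>
     (\<forall>c \<Phi>. (\<forall>i\<in>{1..m}. classical \<Omega> (c i) \<and> (\<forall>x\<in>closure \<Omega>. c i x > 0)) \<and>
        (neumann_poisson \<Omega> \<epsilon> (charge m z c) \<Phi> \<or> weak_neumann_poisson \<Omega> \<epsilon> (charge m z c) \<Phi>)
        \<longrightarrow> E_npp \<Omega> m z c \<Phi> + C0 \<ge> 1)"


subsection \<open>The scheme\<close>

text \<open>\<open>level\<close> holds the data \<open>c, \<Phi>, u, p, r, \<xi>\<close> of one time level; \<open>stage\<close> holds the auxiliary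
  unknowns \<open>\<sigma>, cbar, \<lambda>, \<Phi>bar, utilde, \<psi>\<close> of one step.\<close>

record level =
  conc :: "nat \<Rightarrow> scalar_field"
  pot :: scalar_field
  vel :: vector_field
  pres :: scalar_field
  sav :: real
  xi :: real

record stage =
  sigma :: "nat \<Rightarrow> scalar_field"
  cbar :: "nat \<Rightarrow> scalar_field"
  lam :: "nat \<Rightarrow> real"
  potbar :: scalar_field
  velt :: vector_field
  psi :: scalar_field

definition regular_level :: "plane set \<Rightarrow> nat \<Rightarrow> level \<Rightarrow> bool" where
  "regular_level \<Omega> m S \<longleftrightarrow>
     (\<forall>i\<in>{1..m}. classical \<Omega> (conc S i)) \<and> classical \<Omega> (pot S) \<and>
     Ck_on 1 \<Omega> (vel S) \<and> C1_bar \<Omega> (vel S) \<and> Ck_on 1 \<Omega> (pres S) \<and> C1_bar \<Omega> (pres S)"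

definition regular_stage :: "plane set \<Rightarrow> nat \<Rightarrow> stage \<Rightarrow> bool" where
  "regular_stage \<Omega> m W \<longleftrightarrow>
     (\<forall>i\<in>{1..m}. classical \<Omega> (sigma W i)) \<and> classical \<Omega> (potbar W) \<and>
     classical \<Omega> (velt W) \<and> classical \<Omega> (psi W)"

definition positive_level :: "plane set \<Rightarrow> nat \<Rightarrow> level \<Rightarrow> bool" where
  "positive_level \<Omega> m S \<longleftrightarrow> (\<forall>i\<in>{1..m}. \<forall>x\<in>closure \<Omega>. conc S i x > 0)"

definition initial_level ::
  "plane set \<Rightarrow> nat \<Rightarrow> (nat \<Rightarrow> real) \<Rightarrow> real \<Rightarrow> real \<Rightarrow> level \<Rightarrow> bool" where
  "initial_level \<Omega> m z \<epsilon> C0 S \<longleftrightarrow>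
     regular_level \<Omega> m S \<and> positive_level \<Omega> m S \<and>
     weak_neumann_poisson \<Omega> \<epsilon> (charge m z (conc S)) (pot S) \<and>
     dom_integral \<Omega> (pres S) = 0 \<and>
     (\<forall>q G. h1_with_gradient \<Omega> q G \<longrightarrow>
        dom_integral \<Omega> (\<lambda>x. grad (pres S) x \<bullet> G x) =
        dom_integral \<Omega> (\<lambda>x. (- charge m z (conc S) x *\<^sub>R grad (pot S) x
                              - convect (vel S) (vel S) x) \<bullet> G x)) \<and>
     sav S = sqrt (E_npp \<Omega> m z (conc S) (pot S) + C0) \<and>
     xi S = 1"

text \<open>\<open>scheme1 \<dots> S W S'\<close>: one step from level \<open>S\<close> to level \<open>S'\<close> with auxiliary unknowns \<open>W\<close>.
  The incoming \<open>\<sigma>\<^sub>i\<close> is \<open>ln c\<^sub>i\<close>, whereas \<open>sigma W i\<close> is the outgoing one, which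
  differs from the logarithm of the new concentration by the constant \<open>ln (lam W i)\<close>.\<close>

definition scheme1 ::
  "plane set \<Rightarrow> nat \<Rightarrow> (nat \<Rightarrow> real) \<Rightarrow> (nat \<Rightarrow> real) \<Rightarrow> real \<Rightarrow> real \<Rightarrow> real \<Rightarrow> real \<Rightarrow>
   level \<Rightarrow> stage \<Rightarrow> level \<Rightarrow> bool" where
  "scheme1 \<Omega> m z D \<epsilon> \<nu> C0 dt S W S' \<longleftrightarrow>
    (let \<sigma> = (\<lambda>i x. ln (conc S i x));
         u = vel S; ut = velt W;
         \<rho> = charge m z (conc S');
         \<Phi>b = potbar W;
         \<mu> = (\<lambda>i x. ln (conc S' i x) + z i * \<Phi>b x);
         R = sqrt (E_npp \<Omega> m z (conc S') \<Phi>b + C0)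
     in
       regular_stage \<Omega> m W \<and> regular_level \<Omega> m S' \<and>
       xi S' = sav S' / R \<and>
       \<comment> \<open>logarithmic concentrations\<close>
       (\<forall>i\<in>{1..m}.
          (\<forall>x\<in>\<Omega>. (sigma W i x - \<sigma> i x) / dt - D i * lap (sigma W i) x =
             D i * ((norm (grad (\<sigma> i) x))\<^sup>2
                    + z i * (grad (\<sigma> i) x \<bullet> grad (pot S) x + lap (pot S) x))
             - dvg (\<lambda>y. \<sigma> i y *\<^sub>R u y) x) \<and>
          zero_neumann \<Omega> (sigma W i)) \<and>
       \<comment> \<open>mass correction\<close>
       (\<forall>i\<in>{1..m}.
          (\<forall>x\<in>closure \<Omega>. cbar W i x = exp (sigma W i x)) \<and>
          lam W i * dom_integral \<Omega> (cbar W i) - dom_integral \<Omega> (conc S i) = 0 \<and>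
          (\<forall>x\<in>closure \<Omega>. conc S' i x = lam W i * cbar W i x)) \<and>
       \<comment> \<open>intermediate potential\<close>
       neumann_poisson \<Omega> \<epsilon> \<rho> \<Phi>b \<and>
       \<comment> \<open>momentum\<close>
       (\<forall>x\<in>\<Omega>. (1 / dt) *\<^sub>R (ut x - u x)
             + xi S' *\<^sub>R (convect u u x + \<rho> x *\<^sub>R grad \<Phi>b x)
             - \<nu> *\<^sub>R vec_lap ut x + grad (pres S) x = 0) \<and>
       zero_dirichlet \<Omega> ut \<and>
       \<comment> \<open>pressure correction\<close>
       (\<forall>x\<in>\<Omega>. lap (psi W) x = 1 / dt * dvg ut x) \<and>
       zero_neumann \<Omega> (psi W) \<and>
       (\<forall>x\<in>\<Omega>. vel S' x = ut x - dt *\<^sub>R grad (psi W) x) \<and>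
       (\<forall>x\<in>closure \<Omega>. pres S' x = psi W x + pres S x) \<and>
       dom_integral \<Omega> (pres S') = 0 \<and>
       \<comment> \<open>scalar auxiliary variable\<close>
       (sav S' - sav S) / dt =
         - 1 / (2 * R) *
           (xi S' * dom_integral \<Omega> (\<lambda>x. \<Sum>i=1..m. D i * conc S' i x * (norm (grad (\<mu> i) x))\<^sup>2)
            - dom_integral \<Omega> (\<lambda>x. \<rho> x *\<^sub>R grad \<Phi>b x \<bullet> ut x)
            - dom_integral \<Omega> (\<lambda>x. convect u u x \<bullet> ut x)) \<and>
       \<comment> \<open>new potential\<close>
       (\<forall>x\<in>closure \<Omega>. pot S' x = xi S' * \<Phi>b x))"

text \<open>The weight 1/2 on the velocity and pressure terms is that of the kinetic energy
  \<open>\<parallel>u\<parallel>\<^sup>2 / 2\<close> in the continuous energy \<open>\<parallel>u\<parallel>\<^sup>2 / 2 + E_npp\<close>, where \<open>r\<^sup>2\<close> stands for \<open>E_npp + C0\<close>.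
  It is needed for the coupling terms to cancel: testing the momentum equation with
  \<open>2 dt utilde\<close> produces them with factor \<open>2 dt \<xi>\<close>, multiplying the equation
  for \<open>r\<close> by \<open>2 dt r\<close> produces them with factor \<open>dt \<xi>\<close>. The energy with unit weights,
  \<open>\<parallel>u\<parallel>\<^sup>2 + dt\<^sup>2 \<parallel>\<nabla>p\<parallel>\<^sup>2 + r\<^sup>2\<close>, is not dissipated in general.\<close>

definition discrete_energy :: "plane set \<Rightarrow> real \<Rightarrow> level \<Rightarrow> real" where
  "discrete_energy \<Omega> dt S =
     1/2 * ((l2_norm \<Omega> (vel S))\<^sup>2 + dt\<^sup>2 * (l2_norm \<Omega> (grad (pres S)))\<^sup>2) + \<bar>sav S\<bar>\<^sup>2"

end

theory Submission
  imports Defs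
begin

text \<open>
  Positivity and mass conservation are immediate: \<open>cbar\<close> is an exponential and \<open>lam\<close> is the
  quotient of two positive integrals, chosen so as to restore the mass. The boundedness statement
  follows from the dissipation of the energy, because the energy contains \<open>\<parallel>u\<parallel>\<^sup>2\<close> and \<open>r\<^sup>2\<close>, and because
  \<open>\<xi> = r / R\<close> with \<open>R \<ge> 1\<close> by the choice of \<open>C0\<close>.

  For the dissipation, the momentum equation is tested with \<open>2 dt utilde\<close> and the equation for \<open>r\<close>
  is multiplied by \<open>2 dt r'\<close>, where \<open>r'\<close> is the new value. In the sum of half the first
  identity and the second, the convective and electric terms cancel, because \<open>r' = \<xi> R\<close>. Squaring the
  identity \<open>u' + dt \<nabla>p' = utilde + dt \<nabla>p\<close> converts the remaining pressure term into the
  difference of the pressure energies. Two facts of integration theory are needed: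
  \<^item> the viscous term \<open>\<integral> \<Delta>utilde \<bullet> utilde\<close> is nonpositive (\<open>viscous_dissipation\<close>);
  \<^item> the projected velocity is orthogonal to gradients, \<open>\<integral> u' \<bullet> \<nabla>p' = 0\<close> (\<open>vel_grad_orthogonal\<close>).

  Both are instances of the divergence theorem for classical solutions, whose second derivatives
  need not extend to the boundary. The only form of that theorem proved directly is the
  one for fields with compact support that are Lipschitz and differentiable almost everywhere: the
  difference quotients have integral zero by translation invariance, and dominated convergence does
  the rest (\<open>integral_dvg_eq_0\<close>).

  For the viscous term the zero boundary values make this enough: replacing a component \<open>v\<close> by a
  continuously differentiable truncation that vanishes where \<open>v\<close> is small gives a field with compact support, and
  the truncation is then removed (\<open>dom_integral_mult_lap_nonpos\<close>).

  For the orthogonality only the normal component of \<open>u'\<close> vanishes on the boundary, and only where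
  a normal exists. A partition of unity reduces the claim to one boundary chart, in which the
  domain lies below the graph of a Lipschitz function \<open>g\<close>. There the test function is multiplied
  by a cutoff depending on the depth \<open>g (x \<bullet> e1) - x \<bullet> e2\<close> below the graph, divided by a small
  \<open>\<delta>\<close>. By the almost everywhere differentiability of \<open>g\<close>, the error term contains the normal
  component of \<open>u'\<close>, which is small in the boundary layer by uniform continuity, times a
  factor of size \<open>1 / \<delta>\<close> on a layer of width \<open>\<delta>\<close>. That factor has bounded integral, by the very same
  integration by parts applied to a constant field, so the error tends to zero
  (\<open>dom_integral_inner_grad_local\<close>).
\<close>

section \<open>Differentiability of Lipschitz functions on the line\<close>

text \<open>
  The inverse of \<open>G\<close> pushes Lebesgue measure forward to the measure \<open>A \<mapsto> |G ` A|\<close>. As \<open>G\<close> maps null sets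
  to null sets, that measure is absolutely continuous, and its Radon-Nikodym density is the
  integrand.
\<close>

lemma increasing_expanding_lipschitz_is_integral:
  fixes G :: "real \<Rightarrow> real"
  assumes expand: "\<And>x y. x \<le> y \<Longrightarrow> y - x \<le> G y - G x"
    and lip: "\<And>x y. \<bar>G y - G x\<bar> \<le> K * \<bar>y - x\<bar>"
  obtains f :: "real \<Rightarrow> real" where "\<And>a b. a \<le> b \<Longrightarrow> (f has_integral (G b - G a)) {a..b}"
proof -
  have sm: "strict_mono G"
  proof (rule strict_monoI)
    show "G x < G y" if "x < y" for x y
      using expand[of x y] that by simp
  qed
  have contG: "continuous_on UNIV G"
  proof (rule lipschitz_on_continuous_on)
    show "\<bar>K\<bar>-lipschitz_on UNIV G"
    proof (rule lipschitz_onI)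
      show "dist (G x) (G y) \<le> \<bar>K\<bar> * dist x y" for x y
        using lip[of x y] mult_right_mono[OF abs_ge_self[of K] abs_ge_zero[of "x - y"]]
        by (simp add: dist_real_def abs_minus_commute)
    qed simp
  qed
  have surj: "surj G"
    unfolding surj_def
  proof
    fix y :: real
    define b where "b = \<bar>y\<bar> + \<bar>G 0\<bar>"
    have b: "b \<ge> 0" by (simp add: b_def)
    have "G (-b) \<le> y" using expand[of "-b" 0] b b_def by linarith
    moreover have "y \<le> G b" using expand[of 0 b] b b_def by linarith
    ultimately obtain x where "-b \<le> x" "x \<le> b" "G x = y"
      using IVT'[of G "-b" y b] b continuous_on_subset[OF contG] by force
    then show "\<exists>x. y = G x" by blast
  qed
  define H where "H = inv G"
  have GH: "G (H y) = y" for y by (simp add: H_def surj surj_f_inv_f)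
  have HG: "H (G x) = x" for x by (simp add: H_def sm strict_mono_imp_inj_on)
  have vim: "H -` A = G ` A" for A
  proof (intro set_eqI iffI)
    show "y \<in> G ` A" if "y \<in> H -` A" for y using that GH[of y] by (metis image_eqI vimageD)
    show "y \<in> H -` A" if "y \<in> G ` A" for y using that HG by auto
  qed
  have "1-lipschitz_on UNIV H"
  proof (rule lipschitz_onI)
    show "dist (H x) (H y) \<le> 1 * dist x y" for x y
      using expand[of "H x" "H y"] expand[of "H y" "H x"] by (cases "H x \<le> H y") (auto simp: GH dist_real_def)
  qed simp
  then have Hm [measurable]: "H \<in> borel_measurable borel"
    by (intro borel_measurable_continuous_onI lipschitz_on_continuous_on)
  define \<mu> where "\<mu> = distr lborel borel H"
  have mu: "emeasure \<mu> A = emeasure lborel (G ` A)" if "A \<in> sets borel" for A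
    unfolding \<mu>_def using that by (subst emeasure_distr) (auto simp: vim)
  have "absolutely_continuous lborel \<mu>"
    unfolding absolutely_continuous_def
  proof
    fix A :: "real set" assume A: "A \<in> null_sets lborel"
    then have Ab: "A \<in> sets borel" by auto
    have "negligible A" using A by (simp add: negligible_iff_null_sets null_sets_completionI)
    then have "negligible (G ` A)"
    proof (rule negligible_locally_Lipschitz_image[OF order_refl])
      show "\<exists>T B. open T \<and> x \<in> T \<and> (\<forall>y\<in>A \<inter> T. norm (G y - G x) \<le> B * norm (y - x))" for x
        using lip by (intro exI[of _ UNIV] exI[of _ K]) auto
    qed
    moreover have "G ` A \<in> sets borel"
      using measurable_sets[OF Hm Ab] by (simp add: vim)
    ultimately have "emeasure lborel (G ` A) = 0"
      using emeasure_completion[of "G ` A" lborel] negligible_iff_emeasure0[of "G ` A"] by simp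
    then show "A \<in> null_sets \<mu>" using Ab mu[OF Ab] by (auto simp: \<mu>_def null_sets_def)
  qed
  then obtain f0 where f0 [measurable]: "f0 \<in> borel_measurable lborel" and dens: "density lborel f0 = \<mu>"
    using sigma_finite_measure.Radon_Nikodym[OF sigma_finite_lborel, of \<mu>] by (auto simp: \<mu>_def)
  have I: "(\<integral>\<^sup>+x. f0 x * indicator {a..b} x \<partial>lborel) = ennreal (G b - G a)" if "a \<le> b" for a b
  proof -
    have "G ` {a..b} = {G a..G b}"
    proof (intro set_eqI iffI)
      fix y assume "y \<in> {G a..G b}"
      then have "H y \<in> {a..b}"
        using strict_mono_less_eq[OF sm, of a "H y"] strict_mono_less_eq[OF sm, of "H y" b] by (simp add: GH)
      then show "y \<in> G ` {a..b}" by (metis GH image_eqI)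
    qed (use sm in \<open>auto simp: strict_mono_less_eq\<close>)
    moreover have "G a \<le> G b" using that sm by (simp add: strict_mono_less_eq)
    ultimately show ?thesis
      using mu[of "{a..b}"] by (simp add: dens[symmetric] emeasure_density)
  qed
  have "AE x in lborel. f0 x * indicator {- real n..real n} x \<noteq> \<infinity>" for n
    by (rule nn_integral_PInf_AE) (auto simp: I)
  then have "AE x in lborel. \<forall>n. f0 x * indicator {- real n..real n} x \<noteq> \<infinity>"
    by (simp add: AE_all_countable)
  then have fin: "AE x in lborel. f0 x \<noteq> \<infinity>"
  proof (eventually_elim)
    case (elim x)
    obtain n where "\<bar>x\<bar> \<le> real n" using real_arch_simple by blast
    then show ?case using elim[rule_format, of n] by (auto simp: indicator_def abs_le_iff)
  qed
  define f where "f x = enn2real (f0 x)" for x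
  have [measurable]: "f \<in> borel_measurable borel" unfolding f_def by simp
  show thesis
  proof (rule that)
    fix a b :: real assume ab: "a \<le> b"
    have "(\<integral>\<^sup>+x. ennreal (f x * indicator {a..b} x) \<partial>lborel) = (\<integral>\<^sup>+x. f0 x * indicator {a..b} x \<partial>lborel)"
      by (rule nn_integral_cong_AE, use fin in eventually_elim)
        (auto simp: f_def indicator_def less_top)
    then have "((\<lambda>x. f x * indicator {a..b} x) has_integral (G b - G a)) UNIV"
      using ab sm by (intro nn_integral_has_integral) (auto simp: I f_def strict_mono_less_eq)
    then have "((\<lambda>x. if x \<in> {a..b} then f x else 0) has_integral (G b - G a)) UNIV"
      by (rule has_integral_eq[rotated]) auto
    then show "(f has_integral (G b - G a)) {a..b}"
      by (simp only: has_integral_restrict_UNIV)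
  qed
qed

text \<open>
  Adding \<open>(L + 1) x\<close> to \<open>g\<close> makes it expanding, hence an indefinite integral. The Lebesgue
  differentiation theorem \<open>integrable_ccontinuous_explicit\<close> concerns cubes to the right of a point
  only, so it is applied to the density and to its reflection.
\<close>

lemma lipschitz_real_differentiable_almost_everywhere:
  fixes g :: "real \<Rightarrow> real"
  assumes "L-lipschitz_on UNIV g"
  obtains N where "negligible N" "\<And>x. x \<notin> N \<Longrightarrow> g differentiable (at x)"
proof -
  have L: "\<bar>g y - g x\<bar> \<le> L * \<bar>y - x\<bar>" for x y
    using lipschitz_onD[OF assms, of y x] by (simp add: dist_real_def)
  \<comment> \<open>The slope \<open>L + 1\<close> outweighs the decrease of \<open>g\<close>, so that \<open>G\<close> increases at rate at least 1.\<close>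
  define G where "G x = g x + (L + 1) * x" for x
  have "y - x \<le> G y - G x" if "x \<le> y" for x y
    using L[of y x] that by (simp add: G_def algebra_simps)
  moreover have "\<bar>G y - G x\<bar> \<le> (L + \<bar>L + 1\<bar>) * \<bar>y - x\<bar>" for x y
  proof -
    have "G y - G x = (g y - g x) + (L + 1) * (y - x)" by (simp add: G_def algebra_simps)
    then have "\<bar>G y - G x\<bar> \<le> \<bar>g y - g x\<bar> + \<bar>(L + 1) * (y - x)\<bar>" by simp
    also have "\<dots> \<le> L * \<bar>y - x\<bar> + \<bar>L + 1\<bar> * \<bar>y - x\<bar>" using L[of y x] by (simp add: abs_mult)
    finally show ?thesis by (simp add: algebra_simps)
  qed
  ultimately obtain f where f: "\<And>a b. a \<le> b \<Longrightarrow> (f has_integral (G b - G a)) {a..b}"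
    using increasing_expanding_lipschitz_is_integral[of G "L + \<bar>L + 1\<bar>"] by blast
  have f': "((\<lambda>x. f (- x)) has_integral (G (- a) - G (- b))) {a..b}" if "a \<le> b" for a b
  proof -
    have "(f has_integral (G (-a) - G (-b))) {-b..-a}" using f that by simp
    then show ?thesis by (subst (asm) has_integral_reflect_real[symmetric]) auto
  qed
  have "f integrable_on cbox a b" for a b
    using f[of a b] by (cases "a \<le> b") (auto simp: integrable_on_def)
  then obtain N1 where N1: "negligible N1" and d1: "\<And>x e. \<lbrakk>x \<notin> N1; 0 < e\<rbrakk> \<Longrightarrow>
      \<exists>d>0. \<forall>h. 0 < h \<and> h < d \<longrightarrow> norm (integral (cbox x (x + h *\<^sub>R One)) f /\<^sub>R h ^ DIM(real) - f x) < e"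
    using integrable_ccontinuous_explicit[of f] by blast
  have "(\<lambda>x. f (- x)) integrable_on cbox a b" for a b
    using f'[of a b] by (cases "a \<le> b") (auto simp: integrable_on_def)
  then obtain N2 where N2: "negligible N2" and d2: "\<And>x e. \<lbrakk>x \<notin> N2; 0 < e\<rbrakk> \<Longrightarrow>
      \<exists>d>0. \<forall>h. 0 < h \<and> h < d \<longrightarrow> norm (integral (cbox x (x + h *\<^sub>R One)) (\<lambda>x. f (- x)) /\<^sub>R h ^ DIM(real) - f (- x)) < e"
    using integrable_ccontinuous_explicit[of "\<lambda>x. f (- x)"] by blast
  have derG: "(G has_real_derivative f x) (at x)" if x: "x \<notin> N1" "- x \<notin> N2" for x
    unfolding DERIV_def LIM_eq
  proof (intro allI impI)
    fix e :: real assume e: "0 < e"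
    obtain s1 where s1: "s1 > 0" "\<And>h. 0 < h \<Longrightarrow> h < s1 \<Longrightarrow> \<bar>(G (x + h) - G x) / h - f x\<bar> < e"
    proof -
      from d1[OF x(1) e] obtain d where "d > 0"
        "\<And>h. 0 < h \<Longrightarrow> h < d \<Longrightarrow> norm (integral (cbox x (x + h *\<^sub>R One)) f /\<^sub>R h ^ DIM(real) - f x) < e" by blast
      moreover have "integral {x..x + h} f = G (x + h) - G x" if "h > 0" for h
        using f[of x "x + h"] that by (simp add: integral_unique)
      ultimately show thesis using that by (auto simp: divide_inverse mult.commute)
    qed
    \<comment> \<open>The left difference quotients of \<open>G\<close> are the averages of the reflected density on the right of \<open>- x\<close>.\<close>
    obtain s2 where s2: "s2 > 0" "\<And>h. 0 < h \<Longrightarrow> h < s2 \<Longrightarrow> \<bar>(G x - G (x - h)) / h - f x\<bar> < e"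
    proof -
      from d2[OF x(2) e] obtain d where "d > 0"
        "\<And>h. 0 < h \<Longrightarrow> h < d \<Longrightarrow> norm (integral (cbox (- x) (- x + h *\<^sub>R One)) (\<lambda>x. f (- x)) /\<^sub>R h ^ DIM(real) - f (- (- x))) < e" by blast
      moreover have "integral {- x..- x + h} (\<lambda>x. f (- x)) = G x - G (x - h)" if "h > 0" for h
        using f'[of "- x" "- x + h"] that by (simp add: integral_unique)
      ultimately show thesis using that by (auto simp: divide_inverse mult.commute)
    qed
    show "\<exists>s>0. \<forall>h. h \<noteq> 0 \<and> norm (h - 0) < s \<longrightarrow> norm ((G (x + h) - G x) / h - f x) < e"
    proof (intro exI conjI allI impI)
      show "min s1 s2 > 0" using s1 s2 by simp
      fix h :: real assume h: "h \<noteq> 0 \<and> norm (h - 0) < min s1 s2"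
      show "norm ((G (x + h) - G x) / h - f x) < e"
      proof (cases "h > 0")
        case True then show ?thesis using s1 h by simp
      next
        case False
        then have "(G (x + h) - G x) / h = (G x - G (x - (- h))) / (- h)" by (metis diff_minus_eq_add minus_diff_eq minus_divide_divide)
        then show ?thesis using s2(2)[of "- h"] h False by simp
      qed
    qed
  qed
  show thesis
  proof (rule that)
    have "negligible (uminus ` N2)"
      by (rule negligible_differentiable_image_negligible[OF _ N2])
        (auto intro!: derivative_intros differentiable_at_imp_differentiable_on)
    then show "negligible (N1 \<union> uminus ` N2)" using N1 by simp
    fix x assume "x \<notin> N1 \<union> uminus ` N2"
    then have "(G has_real_derivative f x) (at x)" by (intro derG) (auto simp: image_iff)
    then have "((\<lambda>x. G x - (L + 1) * x) has_real_derivative (f x - (L + 1) * 1)) (at x)"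
      by (intro derivative_intros) auto
    then show "g differentiable (at x)" by (auto simp: G_def real_differentiable_def)
  qed
qed

section \<open>A continuously differentiable step\<close>

text \<open>
  The choice of the formula, a composition of squared positive parts, makes it continuously
  differentiable without any case distinction at the points 0 and 1.
\<close>

definition smoothstep :: "real \<Rightarrow> real" where
  "smoothstep t = 1 - (max 0 (1 - (max 0 t)\<^sup>2))\<^sup>2"

definition smoothstep' :: "real \<Rightarrow> real" where
  "smoothstep' t = 4 * max 0 t * max 0 (1 - (max 0 t)\<^sup>2)"

lemma has_real_derivative_positive_part_square:
  "((\<lambda>t. (max 0 t)\<^sup>2) has_real_derivative 2 * max 0 t) (at (t::real))"
proof -
  consider "t < 0" | "t > 0" | "t = 0" by linarith
  then show ?thesis
  proof cases
    case 1
    have "((\<lambda>t. 0) has_real_derivative 0) (at t)" by simp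
    then have "((\<lambda>t. (max 0 t)\<^sup>2) has_real_derivative 0) (at t)"
      by (rule has_field_derivative_transform_within_open[where S = "{..<0}"]) (use 1 in auto)
    then show ?thesis using 1 by simp
  next
    case 2
    have "((\<lambda>t. t\<^sup>2) has_real_derivative 2 * t) (at t)"
      by (auto intro!: derivative_eq_intros)
    then have "((\<lambda>t. (max 0 t)\<^sup>2) has_real_derivative 2 * t) (at t)"
      by (rule has_field_derivative_transform_within_open[where S = "{0<..}"]) (use 2 in auto)
    then show ?thesis using 2 by simp
  next
    case 3
    have "(\<lambda>h. ((max 0 (0 + h))\<^sup>2 - (max 0 0)\<^sup>2) / h) \<midarrow>0\<rightarrow> (0::real)"
    proof (rule Lim_null_comparison)
      show "\<forall>\<^sub>F h in at 0. norm (((max 0 (0 + h))\<^sup>2 - (max 0 0)\<^sup>2) / h) \<le> \<bar>h::real\<bar>"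
        by (intro always_eventually allI) (auto simp: max_def power2_eq_square)
      show "(\<lambda>h::real. \<bar>h\<bar>) \<midarrow>0\<rightarrow> 0" by (rule tendsto_rabs_zero) (rule tendsto_ident_at)
    qed
    then show ?thesis using 3 by (simp add: DERIV_def)
  qed
qed

lemma smoothstep_deriv: "(smoothstep has_real_derivative smoothstep' t) (at t)"
proof -
  have "((\<lambda>t. 1 - (max 0 (1 - (max 0 t)\<^sup>2))\<^sup>2) has_real_derivative
      0 - (2 * max 0 (1 - (max 0 t)\<^sup>2)) * (0 - 2 * max 0 t)) (at t)"
    by (intro derivative_intros DERIV_chain2[OF has_real_derivative_positive_part_square]
        has_real_derivative_positive_part_square)
  then show ?thesis
    unfolding smoothstep_def[abs_def] smoothstep'_def by (simp add: mult_ac)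
qed

lemma smoothstep_le_0: "t \<le> 0 \<Longrightarrow> smoothstep t = 0"
  by (simp add: smoothstep_def)

lemma smoothstep_ge_1: "1 \<le> t \<Longrightarrow> smoothstep t = 1"
  by (simp add: smoothstep_def)

lemma smoothstep_bounds: "0 \<le> smoothstep t" "smoothstep t \<le> 1"
  by (auto simp: smoothstep_def max_def power_le_one)

lemma smoothstep'_nonneg: "0 \<le> smoothstep' t"
  by (simp add: smoothstep'_def)

lemma smoothstep'_le: "smoothstep' t \<le> 4"
proof -
  have "max 0 t * max 0 (1 - (max 0 t)\<^sup>2) \<le> 1 * 1"
  proof (cases "t \<le> 1")
    case True then show ?thesis by (intro mult_mono) auto
  next
    case False
    then have "1 \<le> (max 0 t)\<^sup>2" by simp
    then show ?thesis by simp
  qed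
  then show ?thesis by (simp add: smoothstep'_def)
qed

lemma smoothstep'_eq_0: "t \<le> 0 \<or> 1 \<le> t \<Longrightarrow> smoothstep' t = 0"
  by (auto simp: smoothstep'_def)

lemma continuous_on_smoothstep' [continuous_intros]:
  "continuous_on S f \<Longrightarrow> continuous_on S (\<lambda>x. smoothstep' (f x))"
  unfolding smoothstep'_def by (intro continuous_intros)

lemma continuous_on_smoothstep [continuous_intros]:
  "continuous_on S f \<Longrightarrow> continuous_on S (\<lambda>x. smoothstep (f x))"
  unfolding smoothstep_def by (intro continuous_intros)

lemma smoothstep_lipschitz: "\<bar>smoothstep s - smoothstep t\<bar> \<le> 4 * \<bar>s - t\<bar>"
proof -
  have "norm (smoothstep s - smoothstep t) \<le> 4 * norm (s - t)"
    by (rule field_differentiable_bound[of UNIV _ smoothstep'])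
      (use smoothstep_deriv smoothstep'_nonneg smoothstep'_le in \<open>auto\<close>)
  then show ?thesis by simp
qed

section \<open>The divergence theorem for compactly supported fields\<close>

lemma integral_lborel_translate:
  fixes f :: "'a::euclidean_space \<Rightarrow> real"
  assumes "f \<in> borel_measurable borel"
  shows "(\<integral>x. f (x + c) \<partial>lborel) = (\<integral>x. f x \<partial>lborel)"
proof -
  have "(\<integral>x. f x \<partial>lborel) = (\<integral>x. f x \<partial>(distr lborel borel ((+) c)))"
    by (simp add: lborel_distr_plus)
  also have "\<dots> = (\<integral>x. f (c + x) \<partial>lborel)"
    using assms by (intro integral_distr) auto
  finally show ?thesis by (simp add: add.commute)
qed

text \<open>
  All difference quotients of \<open>F\<close> have integral zero by translation invariance; the
  Lipschitz bound dominates them on a fixed ball.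
\<close>

lemma integral_directional_derivative_eq_0:
  fixes F :: "'a::euclidean_space \<Rightarrow> real" and b :: 'a
  assumes K: "bounded K" "\<And>x. x \<notin> K \<Longrightarrow> F x = 0"
    and \<eta>: "\<eta> > 0" and lip: "\<And>x h. norm h < \<eta> \<Longrightarrow> \<bar>F (x + h) - F x\<bar> \<le> C * norm h"
    and ae: "AE x in lebesgue. ((\<lambda>h. (F (x + h *\<^sub>R b) - F x) / h) \<longlongrightarrow> F' x) (at 0)"
  shows "integrable lebesgue F'" "(\<integral>x. F' x \<partial>lebesgue) = 0"
proof -
  \<comment> \<open>Step sizes with \<open>h n * norm b < \<eta>\<close>, so that the Lipschitz bound applies to every translation.\<close>
  define h where "h n = \<eta> / (norm b + 1) * inverse (real (Suc (Suc n)))" for n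
  have h0: "h n > 0" for n using \<eta> by (simp add: h_def add_nonneg_pos)
  have hb: "norm (h n *\<^sub>R b) < \<eta>" "norm (h n *\<^sub>R b) \<le> \<eta>" for n
  proof -
    have "norm b / (norm b + 1) < 1" by (simp add: add_nonneg_pos)
    moreover have "inverse (real (Suc (Suc n))) < 1" by (simp add: inverse_less_1_iff)
    ultimately have "norm b / (norm b + 1) * (inverse (real (Suc (Suc n)))) < 1 * 1"
      by (intro mult_strict_mono) (auto simp: add_nonneg_pos)
    then have "\<eta> * (norm b / (norm b + 1) * (inverse (real (Suc (Suc n))))) < \<eta> * 1"
      using \<eta> by (intro mult_strict_left_mono) auto
    moreover have "norm (h n *\<^sub>R b) = \<eta> * (norm b / (norm b + 1) * inverse (real (Suc (Suc n))))"
      using h0[of n] by (simp only: norm_scaleR abs_of_pos) (simp add: h_def)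
    ultimately show "norm (h n *\<^sub>R b) < \<eta>" by simp
    then show "norm (h n *\<^sub>R b) \<le> \<eta>" by simp
  qed
  have hlim: "h \<longlonglongrightarrow> 0"
    unfolding h_def by (rule tendsto_mult_right_zero) (rule LIMSEQ_Suc[OF LIMSEQ_inverse_real_of_nat])
  have cont: "continuous_on UNIV F"
  proof -
    have "isCont F x" for x
      unfolding continuous_at_eps_delta
    proof (intro allI impI)
      fix e :: real assume "e > 0"
      define d where "d = min \<eta> (e / (\<bar>C\<bar> + 1))"
      have d: "d > 0" using \<open>e > 0\<close> \<eta> by (simp add: d_def)
      moreover have "dist (F y) (F x) < e" if "dist y x < d" for y
      proof -
        have "norm (y - x) < \<eta>" and le: "norm (y - x) < e / (\<bar>C\<bar> + 1)" using that by (auto simp: d_def dist_norm)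
        then have "\<bar>F (x + (y - x)) - F x\<bar> \<le> C * norm (y - x)" by (intro lip)
        also have "\<dots> \<le> (\<bar>C\<bar> + 1) * norm (y - x)" by (intro mult_right_mono) auto
        also have "\<dots> < e" using le by (simp add: pos_less_divide_eq mult.commute)
        finally show ?thesis by (simp add: dist_real_def)
      qed
      ultimately show "\<exists>d>0. \<forall>y. dist y x < d \<longrightarrow> dist (F y) (F x) < e" by blast
    qed
    then show ?thesis by (simp add: continuous_at_imp_continuous_on)
  qed
  have [measurable]: "F \<in> borel_measurable borel" by (rule borel_measurable_continuous_onI[OF cont])
  obtain R where R: "\<And>x. x \<in> K \<Longrightarrow> norm x \<le> R" using K(1) bounded_iff by blast
  have Fint: "integrable lborel F"
  proof -
    have "integrable lborel (\<lambda>x. indicator (cball 0 R) x *\<^sub>R F x)"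
      by (rule borel_integrable_compact) (use cont continuous_on_subset in auto)
    moreover have "(\<lambda>x. indicator (cball 0 R) x *\<^sub>R F x) = F"
      using K(2) R by (force simp: indicator_def)
    ultimately show ?thesis by (simp only:)
  qed
  have Fint': "integrable lborel (\<lambda>x. F (x + c))" for c
  proof -
    have "integrable (distr lborel borel ((+) c)) F" using Fint by (simp add: lborel_distr_plus)
    then have "integrable lborel (\<lambda>x. F (c + x))" by (subst (asm) integrable_distr_eq) auto
    then show ?thesis by (simp add: add.commute)
  qed
  define s where "s n x = (F (x + h n *\<^sub>R b) - F x) / h n" for n x
  have s_meas [measurable]: "s n \<in> borel_measurable borel" for n unfolding s_def by measurable
  have sL: "s n \<in> borel_measurable lebesgue" for n
    by (rule measurable_completion) simp
  have sint: "(\<integral>x. s n x \<partial>lebesgue) = 0" for n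
  proof -
    have "(\<integral>x. s n x \<partial>lebesgue) = (\<integral>x. s n x \<partial>lborel)" by (rule integral_completion) simp
    also have "\<dots> = ((\<integral>x. F (x + h n *\<^sub>R b) \<partial>lborel) - (\<integral>x. F x \<partial>lborel)) / h n"
      unfolding s_def using Fint Fint' by simp
    finally show ?thesis by (simp add: integral_lborel_translate)
  qed
  have lim: "AE x in lebesgue. (\<lambda>n. s n x) \<longlonglongrightarrow> F' x"
    using ae
  proof eventually_elim
    case (elim x)
    show ?case unfolding s_def
      by (rule filterlim_compose[OF elim]) (use hlim h0 in \<open>auto simp: filterlim_at less_imp_neq[symmetric]\<close>)
  qed
  have meas: "F' \<in> borel_measurable lebesgue"
  proof (rule borel_measurable_AE)
    show "(\<lambda>x. lim (\<lambda>n. s n x)) \<in> borel_measurable lebesgue"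
      by (rule borel_measurable_lim_metric) (rule sL)
    show "AE x in lebesgue. lim (\<lambda>n. s n x) = F' x"
      using lim by eventually_elim (rule limI)
  qed
  define w where "w x = indicator (cball 0 (R + \<eta>)) x * (\<bar>C\<bar> * norm b)" for x :: 'a
  have w: "integrable lebesgue w"
  proof -
    have "integrable lborel w" unfolding w_def
      by (intro integrable_mult_left integrable_real_indicator) (use emeasure_bounded_finite[OF bounded_cball] in \<open>auto simp: less_top\<close>)
    then show ?thesis by (simp add: integrable_completion borel_measurable_integrable)
  qed
  have bound: "norm (s n x) \<le> w x" for n x
  proof (cases "x \<in> cball 0 (R + \<eta>)")
    case True
    have "\<bar>F (x + h n *\<^sub>R b) - F x\<bar> \<le> C * norm (h n *\<^sub>R b)" using hb by (intro lip)
    also have "\<dots> \<le> \<bar>C\<bar> * (h n * norm b)" using h0[of n] by (auto intro!: mult_mono)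
    finally show ?thesis using True h0[of n]
      by (simp add: s_def w_def abs_divide pos_divide_le_eq mult_ac)
  next
    case False
    then have nx: "norm x > R + \<eta>" by simp
    then have "x \<notin> K" using R[of x] \<eta> by fastforce
    moreover have "norm (x + h n *\<^sub>R b) > R"
      using nx hb(1)[of n] norm_diff_ineq[of x "h n *\<^sub>R b"] by linarith
    then have "x + h n *\<^sub>R b \<notin> K" using R[of "x + h n *\<^sub>R b"] by fastforce
    ultimately show ?thesis using K(2) False by (simp add: s_def w_def)
  qed
  show "integrable lebesgue F'"
    by (rule integrable_dominated_convergence[OF meas sL w lim]) (use bound in auto)
  have "(\<lambda>n. \<integral>x. s n x \<partial>lebesgue) \<longlonglongrightarrow> (\<integral>x. F' x \<partial>lebesgue)"
    by (rule integral_dominated_convergence[OF meas sL w lim]) (use bound in auto)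
  then show "(\<integral>x. F' x \<partial>lebesgue) = 0"
    by (simp add: sint LIMSEQ_const_iff)
qed

lemma integral_dvg_eq_0:
  fixes V :: vector_field
  assumes K: "bounded K" "\<And>x. x \<notin> K \<Longrightarrow> V x = 0"
    and \<eta>: "\<eta> > 0" and lip: "\<And>x h. norm h < \<eta> \<Longrightarrow> norm (V (x + h) - V x) \<le> C * norm h"
    and ae: "AE x in lebesgue. V differentiable (at x)"
  shows "integrable lebesgue (dvg V)" "(\<integral>x. dvg V x \<partial>lebesgue) = 0"
proof -
  have 1: "integrable lebesgue (\<lambda>x. frechet_derivative V (at x) b \<bullet> b) \<and>
      (\<integral>x. frechet_derivative V (at x) b \<bullet> b \<partial>lebesgue) = 0" if b: "b \<in> Basis" for b
  proof -
    have "AE x in lebesgue. ((\<lambda>h. (V (x + h *\<^sub>R b) \<bullet> b - V x \<bullet> b) / h) \<longlongrightarrow> frechet_derivative V (at x) b \<bullet> b) (at 0)"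
      using ae
    proof eventually_elim
      case (elim x)
      then have D: "(V has_derivative frechet_derivative V (at x)) (at x)"
        by (simp add: frechet_derivative_works)
      have "((\<lambda>h. V (x + h *\<^sub>R b) \<bullet> b) has_derivative (\<lambda>h. frechet_derivative V (at x) (h *\<^sub>R b) \<bullet> b)) (at 0)"
        by (rule has_derivative_compose[of "\<lambda>h. x + h *\<^sub>R b", THEN has_derivative_inner_left])
          (use D in \<open>auto intro!: derivative_eq_intros\<close>)
      moreover have "frechet_derivative V (at x) (h *\<^sub>R b) \<bullet> b = h * (frechet_derivative V (at x) b \<bullet> b)" for h
        using D by (simp add: linear_scale has_derivative_linear)
      ultimately have "((\<lambda>h. V (x + h *\<^sub>R b) \<bullet> b) has_real_derivative (frechet_derivative V (at x) b \<bullet> b)) (at 0)"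
        by (simp add: has_field_derivative_def mult_commute_abs)
      then show ?case by (simp add: DERIV_def)
    qed
    moreover have "\<bar>V (x + h) \<bullet> b - V x \<bullet> b\<bar> \<le> C * norm h" if "norm h < \<eta>" for x h
      using Cauchy_Schwarz_ineq2[of "V (x + h) - V x" b] lip[OF that, of x] b
      by (simp add: inner_diff_left)
    ultimately show ?thesis
      using integral_directional_derivative_eq_0[of K "\<lambda>x. V x \<bullet> b" \<eta> C b] K \<eta> by auto
  qed
  show "integrable lebesgue (dvg V)" "(\<integral>x. dvg V x \<partial>lebesgue) = 0"
    unfolding dvg_def[abs_def] using 1 by (auto simp: Bochner_Integration.integral_sum)
qed

lemma norm_linear_le_Basis:
  fixes A :: "'a::euclidean_space \<Rightarrow> 'b::real_normed_vector"
  assumes "linear A"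
  shows "norm (A v) \<le> (\<Sum>b\<in>Basis. norm (A b)) * norm v"
proof -
  interpret linear A by fact
  have "norm (A v) = norm (A (\<Sum>b\<in>Basis. (v \<bullet> b) *\<^sub>R b))"
    by (simp add: euclidean_representation)
  also have "\<dots> = norm (\<Sum>b\<in>Basis. (v \<bullet> b) *\<^sub>R A b)"
    by (simp add: sum scale)
  also have "\<dots> \<le> (\<Sum>b\<in>Basis. norm v * norm (A b))"
    by (intro sum_norm_le) (auto intro!: mult_right_mono Basis_le_norm)
  finally show ?thesis
    by (simp add: sum_distrib_left mult.commute)
qed

text \<open>
  A field of class C1 on an open set around its compact support is globally Lipschitz.
\<close>

lemma integral_dvg_C1_eq_0:
  fixes V :: vector_field
  assumes K: "compact K" "K \<subseteq> \<Omega>" "open \<Omega>" "\<And>x. x \<notin> K \<Longrightarrow> V x = 0"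
    and diff: "\<And>x. x \<in> \<Omega> \<Longrightarrow> V differentiable (at x)"
    and cont: "\<And>b. b \<in> Basis \<Longrightarrow> continuous_on \<Omega> (\<lambda>x. frechet_derivative V (at x) b)"
  shows "integrable lebesgue (dvg V)" "(\<integral>x. dvg V x \<partial>lebesgue) = 0"
proof -
  have out: "(V has_derivative (\<lambda>_. 0)) (at x)" if "x \<notin> K" for x
  proof (rule has_derivative_transform_within_open[where s = "- K" and f = "\<lambda>_. 0"])
    show "open (- K)" using K(1) compact_imp_closed by blast
  qed (use that K(4) in auto)
  have der: "(V has_derivative frechet_derivative V (at x)) (at x)" for x
    using out[of x] diff[of x] K(2) frechet_derivative_at[OF out, of x] by (cases "x \<in> K") (auto simp: frechet_derivative_works)
  have "\<exists>B. \<forall>x\<in>K. norm (frechet_derivative V (at x) b) \<le> B" if "b \<in> Basis" for b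
  proof -
    have "compact ((\<lambda>x. frechet_derivative V (at x) b) ` K)"
      by (rule compact_continuous_image[OF continuous_on_subset[OF cont[OF that] K(2)] K(1)])
    then show ?thesis by (auto simp: bounded_iff dest!: compact_imp_bounded)
  qed
  then obtain B where B: "\<And>b x. b \<in> Basis \<Longrightarrow> x \<in> K \<Longrightarrow> norm (frechet_derivative V (at x) b) \<le> B b"
    by metis
  have on: "onorm (frechet_derivative V (at x)) \<le> (\<Sum>b\<in>Basis. \<bar>B b\<bar>)" for x
  proof (rule onorm_bound)
    fix v
    have "norm (frechet_derivative V (at x) v) \<le> (\<Sum>b\<in>Basis. norm (frechet_derivative V (at x) b)) * norm v"
      by (rule norm_linear_le_Basis[OF has_derivative_linear[OF der]])
    also have "\<dots> \<le> (\<Sum>b\<in>Basis. \<bar>B b\<bar>) * norm v"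
    proof (intro mult_right_mono sum_mono)
      fix b :: plane assume b: "b \<in> Basis"
      show "norm (frechet_derivative V (at x) b) \<le> \<bar>B b\<bar>"
        using B[OF b, of x] frechet_derivative_at[OF out, of x, symmetric] by (cases "x \<in> K") auto
    qed simp
    finally show "norm (frechet_derivative V (at x) v) \<le> (\<Sum>b\<in>Basis. \<bar>B b\<bar>) * norm v" .
  qed (auto intro: sum_nonneg)
  have lip: "norm (V (x + h) - V x) \<le> (\<Sum>b\<in>Basis. \<bar>B b\<bar>) * norm h" for x h
    using differentiable_bound[of UNIV V "\<lambda>x. frechet_derivative V (at x)" _ "x + h" x] der on
    by simp
  show "integrable lebesgue (dvg V)" "(\<integral>x. dvg V x \<partial>lebesgue) = 0"
    using integral_dvg_eq_0[of K V 1, OF compact_imp_bounded[OF K(1)] K(4) zero_less_one lip] der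
    by (auto simp: differentiable_def)
qed

section \<open>Bounded continuous functions\<close>

text \<open>
  On a bounded open set these functions are integrable, and the class is closed under all algebraic
  operations that occur in the scheme. This keeps integrability proofs syntactic.
\<close>

definition bounded_continuous :: "plane set \<Rightarrow> (plane \<Rightarrow> 'b::real_normed_vector) \<Rightarrow> bool" where
  "bounded_continuous \<Omega> f \<longleftrightarrow> continuous_on \<Omega> f \<and> bounded (f ` \<Omega>)"

lemma bounded_continuousI:
  "continuous_on \<Omega> f \<Longrightarrow> (\<And>x. x \<in> \<Omega> \<Longrightarrow> norm (f x) \<le> B) \<Longrightarrow> bounded_continuous \<Omega> f"
  by (auto simp: bounded_continuous_def bounded_iff)

lemma bounded_continuousE:
  assumes "bounded_continuous \<Omega> f"
  obtains B where "B > 0" "continuous_on \<Omega> f" "\<And>x. x \<in> \<Omega> \<Longrightarrow> norm (f x) \<le> B"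
proof -
  obtain B where "B > 0" "\<And>y. y \<in> f ` \<Omega> \<Longrightarrow> norm y \<le> B"
    using assms unfolding bounded_continuous_def bounded_pos by blast
  then show thesis using that[of B] assms by (simp add: bounded_continuous_def)
qed

lemma bounded_continuous_cong:
  "bounded_continuous \<Omega> f \<Longrightarrow> (\<And>x. x \<in> \<Omega> \<Longrightarrow> f x = g x) \<Longrightarrow> bounded_continuous \<Omega> g"
  by (auto simp: bounded_continuous_def cong: continuous_on_cong)

lemma bounded_continuous_const: "bounded_continuous \<Omega> (\<lambda>x. c)"
  by (rule bounded_continuousI[of _ _ "norm c"]) auto

lemma bounded_continuous_bounded_bilinear:
  assumes "bounded_bilinear pr" "bounded_continuous \<Omega> f" "bounded_continuous \<Omega> g"
  shows "bounded_continuous \<Omega> (\<lambda>x. pr (f x) (g x))"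
proof -
  interpret bounded_bilinear pr by fact
  obtain K where K: "K > 0" "\<And>a b. norm (pr a b) \<le> norm a * norm b * K" using pos_bounded by blast
  obtain A where A: "A > 0" "continuous_on \<Omega> f" "\<And>x. x \<in> \<Omega> \<Longrightarrow> norm (f x) \<le> A"
    using assms(2) by (rule bounded_continuousE) blast
  obtain B where B: "B > 0" "continuous_on \<Omega> g" "\<And>x. x \<in> \<Omega> \<Longrightarrow> norm (g x) \<le> B"
    using assms(3) by (rule bounded_continuousE) blast
  show ?thesis
  proof (rule bounded_continuousI)
    show "norm (pr (f x) (g x)) \<le> A * B * K" if "x \<in> \<Omega>" for x
      using K(2)[of "f x" "g x"] mult_mono[OF A(3)[OF that] B(3)[OF that]] K(1) A(1)
      by (smt (verit) mult_right_mono norm_ge_zero)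
  qed (intro continuous_on A B)
qed

lemmas bounded_continuous_scaleR = bounded_continuous_bounded_bilinear[OF bounded_bilinear_scaleR]
  and bounded_continuous_mult = bounded_continuous_bounded_bilinear[OF bounded_bilinear_mult]
  and bounded_continuous_inner = bounded_continuous_bounded_bilinear[OF bounded_bilinear_inner]

lemma bounded_continuous_add:
  assumes "bounded_continuous \<Omega> f" "bounded_continuous \<Omega> g"
  shows "bounded_continuous \<Omega> (\<lambda>x. f x + g x)"
proof -
  obtain A where A: "A > 0" "continuous_on \<Omega> f" "\<And>x. x \<in> \<Omega> \<Longrightarrow> norm (f x) \<le> A"
    using assms(1) by (rule bounded_continuousE) blast
  obtain B where B: "B > 0" "continuous_on \<Omega> g" "\<And>x. x \<in> \<Omega> \<Longrightarrow> norm (g x) \<le> B"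
    using assms(2) by (rule bounded_continuousE) blast
  show ?thesis
    by (rule bounded_continuousI[of _ _ "A + B"]) (auto intro!: continuous_intros A B norm_triangle_mono)
qed

lemma bounded_continuous_minus:
  "bounded_continuous \<Omega> f \<Longrightarrow> bounded_continuous \<Omega> (\<lambda>x. - f x)"
  using bounded_continuous_scaleR[OF bounded_continuous_const[of _ "-1"], of \<Omega> f] by simp

lemma bounded_continuous_diff:
  "bounded_continuous \<Omega> f \<Longrightarrow> bounded_continuous \<Omega> g \<Longrightarrow> bounded_continuous \<Omega> (\<lambda>x. f x - g x)"
  using bounded_continuous_add[OF _ bounded_continuous_minus, of \<Omega> f g] by simp

lemma bounded_continuous_sum:
  "(\<And>i. i \<in> I \<Longrightarrow> bounded_continuous \<Omega> (f i)) \<Longrightarrow> bounded_continuous \<Omega> (\<lambda>x. \<Sum>i\<in>I. f i x)"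
  by (induction I rule: infinite_finite_induct) (auto intro: bounded_continuous_add bounded_continuous_const)

lemma bounded_continuous_norm_power2:
  "bounded_continuous \<Omega> f \<Longrightarrow> bounded_continuous \<Omega> (\<lambda>x. (norm (f x :: 'b::real_inner))\<^sup>2)"
  unfolding power2_norm_eq_inner by (intro bounded_continuous_inner)

lemmas bounded_continuous_intros = bounded_continuous_const bounded_continuous_scaleR
  bounded_continuous_mult bounded_continuous_inner bounded_continuous_add bounded_continuous_minus
  bounded_continuous_diff bounded_continuous_sum bounded_continuous_norm_power2

lemma bounded_continuous_if_continuous_on_closure:
  assumes "continuous_on (closure \<Omega>) f" "bounded \<Omega>"
  shows "bounded_continuous \<Omega> f"
  unfolding bounded_continuous_def
proof
  show "continuous_on \<Omega> f" using assms(1) closure_subset continuous_on_subset by blast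
  have "compact (f ` closure \<Omega>)" using assms by (intro compact_continuous_image) auto
  then show "bounded (f ` \<Omega>)"
    by (rule bounded_subset[OF compact_imp_bounded]) (rule image_mono[OF closure_subset])
qed

lemma finite_measure_lebesgue_on_bounded:
  assumes "open \<Omega>" "bounded \<Omega>"
  shows "finite_measure (lebesgue_on (\<Omega> :: plane set))"
proof
  have "\<Omega> \<in> lmeasurable" using assms lmeasurable_open by blast
  then have "emeasure lebesgue \<Omega> \<noteq> \<infinity>" "\<Omega> \<in> sets lebesgue"
    by (auto simp: fmeasurableD simp del: emeasure_completion dest: fmeasurableD2)
  then show "emeasure (lebesgue_on \<Omega>) (space (lebesgue_on \<Omega>)) \<noteq> \<infinity>"
    by (simp add: emeasure_restrict_space del: emeasure_completion)
qed

lemma bounded_continuous_measurable: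
  fixes f :: "plane \<Rightarrow> 'b::euclidean_space"
  assumes "open \<Omega>" "bounded_continuous \<Omega> f"
  shows "f \<in> borel_measurable (lebesgue_on \<Omega>)"
  using assms by (intro continuous_imp_measurable_on_sets_lebesgue) (auto simp: bounded_continuous_def)

lemma bounded_continuous_integrable:
  fixes f :: "plane \<Rightarrow> 'b::euclidean_space"
  assumes "open \<Omega>" "bounded \<Omega>" "bounded_continuous \<Omega> f"
  shows "integrable (lebesgue_on \<Omega>) f"
proof -
  interpret finite_measure "lebesgue_on \<Omega>" by (rule finite_measure_lebesgue_on_bounded[OF assms(1,2)])
  obtain B where "\<And>x. x \<in> \<Omega> \<Longrightarrow> norm (f x) \<le> B" using assms(3) by (rule bounded_continuousE) blast
  then show ?thesis
    by (intro integrable_const_bound[of f B]) (auto simp: bounded_continuous_measurable assms)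
qed

section \<open>Functions continuously differentiable up to the boundary\<close>

lemma has_derivative_frechet:
  "f differentiable (at x) \<Longrightarrow> (f has_derivative frechet_derivative f (at x)) (at x)"
  by (simp add: frechet_derivative_works)

lemma grad_inner:
  assumes "f differentiable (at x)"
  shows "grad f x \<bullet> v = frechet_derivative f (at x) v"
proof -
  interpret linear "frechet_derivative f (at x)"
    using has_derivative_frechet[OF assms] has_derivative_linear by blast
  have "frechet_derivative f (at x) v = frechet_derivative f (at x) (\<Sum>b\<in>Basis. (v \<bullet> b) *\<^sub>R b)"
    by (simp add: euclidean_representation)
  also have "\<dots> = (\<Sum>b\<in>Basis. (v \<bullet> b) * frechet_derivative f (at x) b)"
    by (simp add: sum scale)
  finally show ?thesis
    by (simp add: grad_def inner_sum_left inner_commute[of v] mult.commute)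
qed

lemma C1_barD:
  assumes "C1_bar \<Omega> f"
  shows "continuous_on (closure \<Omega>) f" "\<And>x. x \<in> \<Omega> \<Longrightarrow> f differentiable (at x)"
  using assms unfolding C1_bar_def by simp_all

lemma C1_bar_bounded_continuous:
  "C1_bar \<Omega> f \<Longrightarrow> bounded \<Omega> \<Longrightarrow> bounded_continuous \<Omega> f"
  by (intro bounded_continuous_if_continuous_on_closure C1_barD)

lemma C1_bar_derivative_bounded_continuous:
  assumes "C1_bar \<Omega> f" "bounded \<Omega>"
  shows "bounded_continuous \<Omega> (\<lambda>x. frechet_derivative f (at x) v)"
proof -
  obtain g where "continuous_on (closure \<Omega>) g" "\<And>x. x \<in> \<Omega> \<Longrightarrow> g x = frechet_derivative f (at x) v"
    using assms(1) unfolding C1_bar_def by metis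
  then show ?thesis
    by (intro bounded_continuous_cong[OF bounded_continuous_if_continuous_on_closure[of \<Omega> g]] assms(2))
qed

lemma C1_bar_grad_bounded_continuous:
  "C1_bar \<Omega> f \<Longrightarrow> bounded \<Omega> \<Longrightarrow> bounded_continuous \<Omega> (grad f)"
  unfolding grad_def[abs_def] by (intro bounded_continuous_intros C1_bar_derivative_bounded_continuous)

lemma C1_bar_convect_bounded_continuous:
  assumes "C1_bar \<Omega> f" "bounded \<Omega>" "bounded_continuous \<Omega> u"
  shows "bounded_continuous \<Omega> (convect u f)"
proof (rule bounded_continuous_cong)
  show "bounded_continuous \<Omega> (\<lambda>x. \<Sum>b\<in>Basis. (u x \<bullet> b) *\<^sub>R frechet_derivative f (at x) b)"
    by (intro bounded_continuous_intros C1_bar_derivative_bounded_continuous assms)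
  fix x assume "x \<in> \<Omega>"
  then interpret linear "frechet_derivative f (at x)"
    using has_derivative_frechet[OF C1_barD(2)[OF assms(1)]] has_derivative_linear by blast
  have "convect u f x = frechet_derivative f (at x) (\<Sum>b\<in>Basis. (u x \<bullet> b) *\<^sub>R b)"
    by (simp add: euclidean_representation convect_def)
  then show "(\<Sum>b\<in>Basis. (u x \<bullet> b) *\<^sub>R frechet_derivative f (at x) b) = convect u f x"
    by (simp add: sum scale)
qed

lemma C1_bar_onorm_bound:
  assumes "C1_bar \<Omega> f" "bounded \<Omega>"
  obtains B where "B > 0" "\<And>x v. x \<in> \<Omega> \<Longrightarrow> norm (frechet_derivative f (at x) v) \<le> B * norm v"
proof -
  have "\<exists>B>0. \<forall>x\<in>\<Omega>. norm (frechet_derivative f (at x) b) \<le> B" for b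
    by (rule bounded_continuousE[OF C1_bar_derivative_bounded_continuous[OF assms, of b]]) blast
  then obtain B where B: "\<And>b. B b > 0" "\<And>b x. x \<in> \<Omega> \<Longrightarrow> norm (frechet_derivative f (at x) b) \<le> B b"
    by metis
  show thesis
  proof
    show "0 < (\<Sum>b\<in>Basis. B b)" using B(1) by (intro sum_pos) auto
    fix x v :: plane assume x: "x \<in> \<Omega>"
    have "norm (frechet_derivative f (at x) v) \<le> (\<Sum>b\<in>Basis. norm (frechet_derivative f (at x) b)) * norm v"
      by (rule norm_linear_le_Basis[OF has_derivative_linear[OF has_derivative_frechet[OF C1_barD(2)[OF assms(1) x]]]])
    also have "\<dots> \<le> (\<Sum>b\<in>Basis. B b) * norm v"
      using B(2)[OF x] by (intro mult_right_mono sum_mono) auto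
    finally show "norm (frechet_derivative f (at x) v) \<le> (\<Sum>b\<in>Basis. B b) * norm v" .
  qed
qed

lemma frechet_derivative_scaleR_field:
  assumes "f differentiable (at x)" "w differentiable (at x)"
  shows "frechet_derivative (\<lambda>y. f y *\<^sub>R w y) (at x) v =
    f x *\<^sub>R frechet_derivative w (at x) v + frechet_derivative f (at x) v *\<^sub>R w x"
  using frechet_derivative_at[OF has_derivative_scaleR[OF has_derivative_frechet has_derivative_frechet, OF assms], symmetric]
  by simp

lemma dvg_scaleR_field:
  assumes "f differentiable (at x)" "w differentiable (at x)"
  shows "dvg (\<lambda>y. f y *\<^sub>R w y) x = f x * dvg w x + grad f x \<bullet> w x"
proof -
  have "dvg (\<lambda>y. f y *\<^sub>R w y) x =
      f x * dvg w x + (\<Sum>b\<in>Basis. frechet_derivative f (at x) b * (w x \<bullet> b))"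
    by (simp add: dvg_def frechet_derivative_scaleR_field[OF assms] inner_add_left sum.distrib sum_distrib_left)
  then show ?thesis by (simp add: grad_def inner_sum_left inner_commute[of "w x"])
qed

lemma dvg_eq_on_open:
  assumes "F differentiable (at x)" "open S" "x \<in> S" "\<And>y. y \<in> S \<Longrightarrow> F y = G y"
  shows "dvg G x = dvg F x"
  unfolding dvg_def using frechet_derivative_transform_within_open[OF assms] by simp

lemma dvg_const: "dvg (\<lambda>x. c) x = 0"
  by (simp add: dvg_def frechet_derivative_const)

lemma C1_bar_mult:
  fixes f g :: scalar_field
  assumes f: "C1_bar \<Omega> f" and g: "C1_bar \<Omega> g"
  shows "C1_bar \<Omega> (\<lambda>x. f x * g x)"
  unfolding C1_bar_def
proof (intro conjI ballI allI)
  show "continuous_on (closure \<Omega>) (\<lambda>x. f x * g x)"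
    by (intro continuous_intros C1_barD f g)
  show "(\<lambda>x. f x * g x) differentiable (at x)" if "x \<in> \<Omega>" for x
    using C1_barD(2)[OF f that] C1_barD(2)[OF g that] by (rule differentiable_mult)
  fix v
  obtain f' where f': "continuous_on (closure \<Omega>) f'" "\<And>x. x \<in> \<Omega> \<Longrightarrow> f' x = frechet_derivative f (at x) v"
    using f unfolding C1_bar_def by metis
  obtain g' where g': "continuous_on (closure \<Omega>) g'" "\<And>x. x \<in> \<Omega> \<Longrightarrow> g' x = frechet_derivative g (at x) v"
    using g unfolding C1_bar_def by metis
  show "\<exists>h. continuous_on (closure \<Omega>) h \<and> (\<forall>x\<in>\<Omega>. h x = frechet_derivative (\<lambda>x. f x * g x) (at x) v)"
  proof (intro exI conjI ballI)
    show "continuous_on (closure \<Omega>) (\<lambda>x. f x * g' x + f' x * g x)"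
      by (intro continuous_intros C1_barD f g f' g')
    show "f x * g' x + f' x * g x = frechet_derivative (\<lambda>x. f x * g x) (at x) v" if "x \<in> \<Omega>" for x
      using frechet_derivative_scaleR_field[OF C1_barD(2)[OF f that] C1_barD(2)[OF g that], of v] f' g' that
      by simp
  qed
qed

lemma C1_bar_diff:
  fixes f g :: "plane \<Rightarrow> 'b::real_normed_vector"
  assumes f: "C1_bar \<Omega> f" and g: "C1_bar \<Omega> g"
  shows "C1_bar \<Omega> (\<lambda>x. f x - g x)"
  unfolding C1_bar_def
proof (intro conjI ballI allI)
  show "continuous_on (closure \<Omega>) (\<lambda>x. f x - g x)"
    by (intro continuous_intros C1_barD f g)
  show "(\<lambda>x. f x - g x) differentiable (at x)" if "x \<in> \<Omega>" for x
    using C1_barD(2)[OF f that] C1_barD(2)[OF g that] by (rule differentiable_diff)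
  fix v
  obtain f' where f': "continuous_on (closure \<Omega>) f'" "\<And>x. x \<in> \<Omega> \<Longrightarrow> f' x = frechet_derivative f (at x) v"
    using f unfolding C1_bar_def by metis
  obtain g' where g': "continuous_on (closure \<Omega>) g'" "\<And>x. x \<in> \<Omega> \<Longrightarrow> g' x = frechet_derivative g (at x) v"
    using g unfolding C1_bar_def by metis
  show "\<exists>h. continuous_on (closure \<Omega>) h \<and> (\<forall>x\<in>\<Omega>. h x = frechet_derivative (\<lambda>x. f x - g x) (at x) v)"
  proof (intro exI conjI ballI)
    show "continuous_on (closure \<Omega>) (\<lambda>x. f' x - g' x)"
      by (intro continuous_intros f' g')
    show "f' x - g' x = frechet_derivative (\<lambda>x. f x - g x) (at x) v" if "x \<in> \<Omega>" for x
      using frechet_derivative_at[OF has_derivative_diff[OF has_derivative_frechet[OF C1_barD(2)[OF f that]]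
          has_derivative_frechet[OF C1_barD(2)[OF g that]]], symmetric] f' g' that by simp
  qed
qed

lemma C1_bar_if_C1:
  assumes der: "\<And>x. (f has_derivative f' x) (at x)" and cont: "\<And>v. continuous_on UNIV (\<lambda>x. f' x v)"
  shows "C1_bar \<Omega> f"
  unfolding C1_bar_def
proof (intro conjI ballI allI)
  show "continuous_on (closure \<Omega>) f"
    using der by (meson has_derivative_continuous continuous_at_imp_continuous_on)
  show "f differentiable at x" for x using der by (auto simp: differentiable_def)
  show "\<exists>g. continuous_on (closure \<Omega>) g \<and> (\<forall>x\<in>\<Omega>. g x = frechet_derivative f (at x) v)" for v
    using frechet_derivative_at[OF der, symmetric]
    by (intro exI[of _ "\<lambda>x. f' x v"]) (auto intro: continuous_on_subset[OF cont])
qed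

lemma C1_bar_const: "C1_bar \<Omega> (\<lambda>x. c)"
  by (rule C1_bar_if_C1[where f' = "\<lambda>x v. 0"]) auto

text \<open>
  Equal to 1 on the ball of radius \<open>s\<close> around \<open>a\<close> and to 0 outside the ball of radius \<open>r\<close>.
\<close>

definition bump :: "plane \<Rightarrow> real \<Rightarrow> real \<Rightarrow> scalar_field" where
  "bump a s r x = smoothstep ((r\<^sup>2 - (norm (x - a))\<^sup>2) / (r\<^sup>2 - s\<^sup>2))"

lemma bump_C1_bar: "C1_bar \<Omega> (bump a s r)"
proof (rule C1_bar_if_C1)
  fix x
  have "((\<lambda>x. (r\<^sup>2 - (norm (x - a))\<^sup>2) / (r\<^sup>2 - s\<^sup>2)) has_derivative
      (\<lambda>v. (- (2 * ((x - a) \<bullet> v))) / (r\<^sup>2 - s\<^sup>2))) (at x)"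
    unfolding power2_norm_eq_inner
    by (auto intro!: derivative_eq_intros simp: inner_commute divide_inverse)
  then show "(bump a s r has_derivative (\<lambda>v. smoothstep' ((r\<^sup>2 - (norm (x - a))\<^sup>2) / (r\<^sup>2 - s\<^sup>2)) *
      ((- (2 * ((x - a) \<bullet> v))) / (r\<^sup>2 - s\<^sup>2)))) (at x)"
    unfolding bump_def[abs_def]
    by (rule has_derivative_compose[where g = smoothstep, OF _ smoothstep_deriv[unfolded has_field_derivative_def]])
  show "continuous_on UNIV (\<lambda>x. smoothstep' ((r\<^sup>2 - (norm (x - a))\<^sup>2) / (r\<^sup>2 - s\<^sup>2)) *
      ((- (2 * ((x - a) \<bullet> v))) / (r\<^sup>2 - s\<^sup>2)))" for v
    unfolding divide_inverse by (intro continuous_intros)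
qed

lemma bump_eq_1:
  assumes "0 \<le> s" "s < r" "norm (x - a) \<le> s"
  shows "bump a s r x = 1"
proof -
  have "(norm (x - a))\<^sup>2 \<le> s\<^sup>2" "s\<^sup>2 < r\<^sup>2" using assms by (auto intro: power_mono power_strict_mono)
  then show ?thesis unfolding bump_def by (intro smoothstep_ge_1) (simp add: field_simps)
qed

lemma bump_eq_0:
  assumes "0 \<le> s" "s < r" "r \<le> norm (x - a)"
  shows "bump a s r x = 0"
proof -
  have "r\<^sup>2 \<le> (norm (x - a))\<^sup>2" "s\<^sup>2 < r\<^sup>2" using assms by (auto intro: power_mono power_strict_mono)
  then show ?thesis unfolding bump_def by (intro smoothstep_le_0) (simp add: divide_le_0_iff)
qed

lemma bump_bounds: "0 \<le> bump a s r x" "bump a s r x \<le> 1"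
  by (auto simp: bump_def smoothstep_bounds)

section \<open>Test functions with compact support\<close>

text \<open>
  Passage between the domain and the whole plane, on which the divergence theorem is formulated.
\<close>

lemma dom_integral_eq_integral_of_extension:
  fixes f g :: scalar_field
  assumes "open \<Omega>" "AE x in lebesgue. g x = (if x \<in> \<Omega> then f x else 0)" "integrable lebesgue g"
  shows "dom_integral \<Omega> f = (\<integral>x. g x \<partial>lebesgue)" "integrable (lebesgue_on \<Omega>) f"
proof -
  have e: "(\<lambda>x. indicator \<Omega> x *\<^sub>R f x) = (\<lambda>x. if x \<in> \<Omega> then f x else 0)"
    by (auto simp: indicator_def)
  have m: "(\<lambda>x. if x \<in> \<Omega> then f x else 0) \<in> borel_measurable lebesgue"
    by (rule borel_measurable_AE[OF borel_measurable_integrable[OF assms(3)] assms(2)])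
  have "dom_integral \<Omega> f = (\<integral>x. (if x \<in> \<Omega> then f x else 0) \<partial>lebesgue)"
    using assms(1) by (subst integral_restrict_space) (simp_all add: e del: real_scaleR_def)
  also have "\<dots> = (\<integral>x. g x \<partial>lebesgue)"
  proof (rule integral_cong_AE[OF m borel_measurable_integrable[OF assms(3)]])
    show "AE x in lebesgue. (if x \<in> \<Omega> then f x else 0) = g x"
      using assms(2) by eventually_elim simp
  qed
  finally show "dom_integral \<Omega> f = (\<integral>x. g x \<partial>lebesgue)" .
  have "integrable lebesgue (\<lambda>x. if x \<in> \<Omega> then f x else 0)"
    by (rule integrable_cong_AE_imp[OF assms(3) m]) (use assms(2) in eventually_elim, simp)
  then show "integrable (lebesgue_on \<Omega>) f"
    using assms(1) by (subst integrable_restrict_space) (simp_all add: e del: real_scaleR_def)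
qed

lemma dom_integral_grad_compact_support:
  fixes f :: scalar_field
  assumes \<Omega>: "open \<Omega>" "bounded \<Omega>" and f: "C1_bar \<Omega> f" and w: "C1_bar \<Omega> w"
    and div: "\<And>x. x \<in> \<Omega> \<Longrightarrow> dvg w x = 0"
    and K: "compact K" "K \<subseteq> \<Omega>" "\<And>x. x \<in> \<Omega> - K \<Longrightarrow> f x = 0"
  shows "dom_integral \<Omega> (\<lambda>x. w x \<bullet> grad f x) = 0"
proof -
  define V where "V x = (if x \<in> \<Omega> then f x *\<^sub>R w x else 0)" for x
  have d: "(\<lambda>y. f y *\<^sub>R w y) differentiable (at x)" if "x \<in> \<Omega>" for x
    using C1_barD(2)[OF f that] C1_barD(2)[OF w that] by simp
  have D: "V differentiable (at x)" if "x \<in> \<Omega>" for x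
    using has_derivative_transform_within_open[OF has_derivative_frechet[OF d[OF that]] \<Omega>(1) that, of V]
    by (auto simp: V_def differentiable_def)
  have fd: "frechet_derivative V (at x) v =
      f x *\<^sub>R frechet_derivative w (at x) v + frechet_derivative f (at x) v *\<^sub>R w x" if "x \<in> \<Omega>" for x v
  proof -
    have "frechet_derivative V (at x) = frechet_derivative (\<lambda>y. f y *\<^sub>R w y) (at x)"
      by (rule frechet_derivative_transform_within_open[OF D[OF that] \<Omega>(1) that]) (auto simp: V_def)
    then show ?thesis using frechet_derivative_scaleR_field[OF C1_barD(2)[OF f that] C1_barD(2)[OF w that]] by simp
  qed
  have V0: "V x = 0" if "x \<notin> K" for x using K(3) that by (auto simp: V_def)
  have cont: "continuous_on \<Omega> (\<lambda>x. frechet_derivative V (at x) b)" for b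
  proof -
    have "bounded_continuous \<Omega> (\<lambda>x. f x *\<^sub>R frechet_derivative w (at x) b + frechet_derivative f (at x) b *\<^sub>R w x)"
      by (intro bounded_continuous_intros C1_bar_derivative_bounded_continuous C1_bar_bounded_continuous f w \<Omega>)
    then show ?thesis using fd by (simp add: bounded_continuous_def cong: continuous_on_cong)
  qed
  have G: "integrable lebesgue (dvg V)" "(\<integral>x. dvg V x \<partial>lebesgue) = 0"
    using integral_dvg_C1_eq_0[of K \<Omega> V] K(1,2) \<Omega>(1) V0 D cont by blast+
  have "dom_integral \<Omega> (\<lambda>x. w x \<bullet> grad f x) = (\<integral>x. dvg V x \<partial>lebesgue)"
  proof (rule dom_integral_eq_integral_of_extension[OF \<Omega>(1) _ G(1)], intro always_eventually allI)
    fix x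
    show "dvg V x = (if x \<in> \<Omega> then w x \<bullet> grad f x else 0)"
    proof (cases "x \<in> \<Omega>")
      case True
      then have "dvg V x = dvg (\<lambda>y. f y *\<^sub>R w y) x"
        by (intro dvg_eq_on_open[OF d[OF True] \<Omega>(1) True]) (simp add: V_def)
      then show ?thesis
        using True div dvg_scaleR_field[OF C1_barD(2)[OF f True] C1_barD(2)[OF w True]] by (simp add: inner_commute)
    next
      case False
      have "open (- K)" using K(1) compact_imp_closed by blast
      then have "dvg V x = dvg (\<lambda>y. 0) x"
        using False K(2) by (intro dvg_eq_on_open[where S = "- K"]) (auto simp: V0)
      then show ?thesis using False by (simp add: dvg_const)
    qed
  qed
  then show ?thesis using G(2) by simp
qed

section \<open>Normals and null sets in the plane\<close>

lemma plane_orthonormal_expansion: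
  fixes e1 e2 x :: plane
  assumes "norm e1 = 1" "norm e2 = 1" "e1 \<bullet> e2 = 0"
  shows "x = (x \<bullet> e1) *\<^sub>R e1 + (x \<bullet> e2) *\<^sub>R e2"
proof (rule ccontr)
  define y where "y = x - ((x \<bullet> e1) *\<^sub>R e1 + (x \<bullet> e2) *\<^sub>R e2)"
  assume "x \<noteq> (x \<bullet> e1) *\<^sub>R e1 + (x \<bullet> e2) *\<^sub>R e2"
  then have y: "y \<noteq> 0" by (simp add: y_def)
  have 11: "e1 \<bullet> e1 = 1" "e2 \<bullet> e2 = 1" "e2 \<bullet> e1 = 0" using assms by (auto simp: norm_eq_1 inner_commute)
  have o: "y \<bullet> e1 = 0" "y \<bullet> e2 = 0"
    by (auto simp: y_def inner_diff_left inner_add_left 11 assms)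
  have d: "e1 \<noteq> e2" "e1 \<noteq> y" "e2 \<noteq> y" "e1 \<noteq> 0" "e2 \<noteq> 0" using o 11 y by auto
  have "independent {e1, e2, y}"
  proof (rule pairwise_orthogonal_independent)
    show "pairwise orthogonal {e1, e2, y}"
      using assms o 11 by (auto simp: pairwise_def orthogonal_def inner_commute)
  qed (use d y in auto)
  then have "card {e1, e2, y} \<le> DIM(plane)" by (rule independent_bound[THEN conjunct2])
  then show False using d by simp
qed

text \<open>
  The slab is the image of the product of a null set with a line under a differentiable map between
  spaces of equal dimension, and such maps preserve null sets.
\<close>

lemma negligible_slab:
  fixes e1 e2 :: plane
  assumes e: "norm e1 = 1" "norm e2 = 1" "e1 \<bullet> e2 = 0" and N: "negligible N"
  shows "negligible {x. x \<bullet> e1 \<in> N}"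
proof -
  have "N \<in> null_sets (completion lborel)" using N by (simp add: negligible_iff_null_sets)
  then obtain N' where N': "N' \<in> null_sets lborel" "N \<subseteq> N'"
    using null_sets_completion_iff2[of N lborel] by blast
  have "N' \<times> (UNIV :: real set) \<in> null_sets (lborel \<Otimes>\<^sub>M lborel)"
    by (rule sigma_finite_measure.times_in_null_sets1[OF sigma_finite_lborel N'(1)]) simp
  then have "N' \<times> (UNIV :: real set) \<in> null_sets lborel" by (simp only: lborel_prod)
  then have n: "negligible (N' \<times> (UNIV :: real set))"
    by (simp add: negligible_iff_null_sets null_sets_completionI)
  have "negligible ((\<lambda>p. fst p *\<^sub>R e1 + snd p *\<^sub>R e2) ` (N' \<times> (UNIV :: real set)))"
  proof (rule negligible_differentiable_image_negligible[OF _ n])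
    show "(\<lambda>p. fst p *\<^sub>R e1 + snd p *\<^sub>R e2) differentiable_on N' \<times> (UNIV :: real set)"
      unfolding differentiable_on_def differentiable_def
      by (auto intro!: derivative_eq_intros exI)
  qed simp
  moreover have "{x. x \<bullet> e1 \<in> N} \<subseteq> (\<lambda>p. fst p *\<^sub>R e1 + snd p *\<^sub>R e2) ` (N' \<times> UNIV)"
  proof
    fix x assume "x \<in> {x. x \<bullet> e1 \<in> N}"
    then show "x \<in> (\<lambda>p. fst p *\<^sub>R e1 + snd p *\<^sub>R e2) ` (N' \<times> UNIV)"
      using N'(2) by (intro image_eqI[of _ _ "(x \<bullet> e1, x \<bullet> e2)"])
        (auto simp: plane_orthonormal_expansion[OF e, symmetric])
  qed
  ultimately show ?thesis by (rule negligible_subset)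
qed

lemma lipschitz_real_derivative_bound:
  fixes g :: "real \<Rightarrow> real"
  assumes "L-lipschitz_on UNIV g" "(g has_real_derivative d) (at s)"
  shows "\<bar>d\<bar> \<le> L"
proof -
  have "((\<lambda>h. \<bar>(g (s + h) - g s) / h\<bar>) \<longlongrightarrow> \<bar>d\<bar>) (at 0)"
    using assms(2) unfolding DERIV_def by (rule tendsto_rabs)
  moreover have "\<forall>\<^sub>F h in at 0. \<bar>(g (s + h) - g s) / h\<bar> \<le> L"
    unfolding eventually_at_filter
  proof (intro always_eventually allI impI)
    fix h :: real assume "h \<noteq> 0"
    then show "\<bar>(g (s + h) - g s) / h\<bar> \<le> L"
      using lipschitz_onD[OF assms(1), of "s + h" s] by (simp add: dist_real_def abs_divide divide_le_eq)
  qed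
  ultimately show ?thesis by (rule tendsto_upperbound) simp
qed

text \<open>
  Two different normals would put the points \<open>x - t (n - n')\<close> both inside and outside the domain.
\<close>

lemma outward_unit_normal_unique:
  assumes "outward_unit_normal \<Omega> x n" "outward_unit_normal \<Omega> x n'"
  shows "n = n'"
proof (rule ccontr)
  assume ne: "n \<noteq> n'"
  have 1: "n \<bullet> n = 1" "n' \<bullet> n' = 1" using assms by (auto simp: outward_unit_normal_def norm_eq_1)
  define d where "d = norm (n - n')"
  have d: "d > 0" using ne by (simp add: d_def)
  then have d4: "d / 4 > 0" by simp
  have d2: "d * d = 2 * (1 - n \<bullet> n')"
    using 1 by (simp add: d_def flip: power2_eq_square) (simp add: power2_norm_eq_inner inner_diff_left inner_diff_right inner_commute)
  obtain r1 where r1: "r1 > 0" "\<And>y. y \<in> ball x r1 \<Longrightarrow> (y - x) \<bullet> n < - (d / 4) * norm (y - x) \<Longrightarrow> y \<in> \<Omega>"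
    using assms(1) d4 unfolding outward_unit_normal_def by blast
  obtain r2 where r2: "r2 > 0" "\<And>y. y \<in> ball x r2 \<Longrightarrow> (y - x) \<bullet> n' > (d / 4) * norm (y - x) \<Longrightarrow> y \<notin> \<Omega>"
    using assms(2) d4 unfolding outward_unit_normal_def by blast
  define t where "t = min r1 r2 / (2 * d)"
  have t: "t > 0" "t * d < r1" "t * d < r2" using r1(1) r2(1) d by (auto simp: t_def)
  \<comment> \<open>The direction of \<open>y - x\<close> has cosine \<open>- d / 2\<close> with \<open>n\<close> and \<open>d / 2\<close> with \<open>n'\<close>; both cones around the
    normals were taken with half that constant.\<close>
  define y where "y = x - t *\<^sub>R (n - n')"
  have y: "norm (y - x) = t * d" "y \<in> ball x r1" "y \<in> ball x r2"
    using t by (auto simp: y_def d_def dist_norm)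
  have "(y - x) \<bullet> n = - (t * (d * d / 2))"
    unfolding d2 using 1 by (simp add: y_def inner_diff_left inner_commute algebra_simps diff_divide_distrib)
  moreover have "(y - x) \<bullet> n' = t * (d * d / 2)"
    unfolding d2 using 1 by (simp add: y_def inner_diff_left inner_commute algebra_simps diff_divide_distrib)
  moreover have "d / 4 * norm (y - x) < t * (d * d / 2)" using t d by (simp add: y)
  ultimately show False using r1(2)[OF y(2)] r2(2)[OF y(3)] by simp
qed

section \<open>Tangential solenoidal fields in one boundary chart\<close>

text \<open>
  The domain near one boundary point, in the rotated coordinates \<open>x \<bullet> e1\<close> and \<open>x \<bullet> e2\<close>.
\<close>

locale boundary_chart =
  fixes \<Omega> :: "plane set" and x0 :: plane and r :: real and e1 e2 :: plane
    and g :: "real \<Rightarrow> real" and L :: real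
  assumes open_domain: "open \<Omega>" and bounded_domain: "bounded \<Omega>"
    and orthonormal: "norm e1 = 1" "norm e2 = 1" "e1 \<bullet> e2 = 0"
    and lipschitz: "L-lipschitz_on UNIV g"
    and graph: "\<Omega> \<inter> ball x0 r = {y \<in> ball x0 r. y \<bullet> e2 < g (y \<bullet> e1)}"
begin

definition depth :: "plane \<Rightarrow> real" where
  "depth x = g (x \<bullet> e1) - x \<bullet> e2"

lemma frame_inner: "e1 \<bullet> e1 = 1" "e2 \<bullet> e2 = 1" "e2 \<bullet> e1 = 0" "e1 \<bullet> e2 = 0"
  using orthonormal by (auto simp: norm_eq_1 inner_commute)

lemma inner_frame_le: "\<bar>v \<bullet> e1\<bar> \<le> norm v" "\<bar>v \<bullet> e2\<bar> \<le> norm v"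
  using Cauchy_Schwarz_ineq2[of v e1] Cauchy_Schwarz_ineq2[of v e2] orthonormal by auto

lemma L_nonneg: "0 \<le> L"
  using lipschitz lipschitz_on_nonneg by blast

lemma mem_domain_iff: "x \<in> ball x0 r \<Longrightarrow> x \<in> \<Omega> \<longleftrightarrow> 0 < depth x"
  using graph[unfolded set_eq_iff, rule_format, of x] by (simp add: depth_def)

lemma depth_lipschitz: "\<bar>depth x - depth y\<bar> \<le> (L + 1) * norm (x - y)"
proof -
  have "\<bar>g (x \<bullet> e1) - g (y \<bullet> e1)\<bar> \<le> L * \<bar>(x - y) \<bullet> e1\<bar>"
    using lipschitz_onD[OF lipschitz, of "x \<bullet> e1" "y \<bullet> e1"] by (simp add: dist_real_def inner_diff_left)
  also have "\<dots> \<le> L * norm (x - y)" using inner_frame_le L_nonneg by (intro mult_left_mono)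
  finally have "\<bar>g (x \<bullet> e1) - g (y \<bullet> e1)\<bar> \<le> L * norm (x - y)" .
  moreover have "\<bar>x \<bullet> e2 - y \<bullet> e2\<bar> \<le> norm (x - y)"
    using inner_frame_le(2)[of "x - y"] by (simp add: inner_diff_left)
  ultimately show ?thesis by (simp add: depth_def algebra_simps)
qed

lemma continuous_on_depth: "continuous_on S depth"
proof (rule lipschitz_on_continuous_on[of "L + 1"], rule lipschitz_onI)
  show "dist (depth x) (depth y) \<le> (L + 1) * dist x y" for x y
    using depth_lipschitz by (simp add: dist_real_def dist_norm)
qed (use L_nonneg in auto)

lemma depth_add_normal: "depth (x + t *\<^sub>R e2) = depth x - t"
  by (simp add: depth_def inner_add_left frame_inner)

lemma depth_has_derivative:
  assumes "(g has_real_derivative \<gamma>) (at (x \<bullet> e1))"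
  shows "(depth has_derivative (\<lambda>v. \<gamma> * (v \<bullet> e1) - v \<bullet> e2)) (at x)"
proof -
  have "((\<lambda>x. g (x \<bullet> e1)) has_derivative (\<lambda>v. \<gamma> * (v \<bullet> e1))) (at x)"
    by (rule has_derivative_compose[where f = "\<lambda>x. x \<bullet> e1" and g = g, OF _ assms[unfolded has_field_derivative_def]])
      (auto intro!: derivative_eq_intros)
  then show ?thesis unfolding depth_def[abs_def] by (auto intro!: derivative_eq_intros)
qed

lemma frontier_if_depth_0:
  assumes b: "b \<in> ball x0 r" "depth b = 0"
  shows "b \<in> frontier \<Omega>"
proof -
  have "b \<notin> \<Omega>" using mem_domain_iff b by simp
  moreover have "b \<in> closure \<Omega>"
    unfolding closure_approachable
  proof (intro allI impI)
    fix e :: real assume e: "0 < e"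
    define t where "t = min (e / 2) ((r - dist x0 b) / 2)"
    have t: "t > 0" "t < e" "t < r - dist x0 b" using e b by (auto simp: t_def min_less_iff_disj)
    have "dist x0 (b + (- t) *\<^sub>R e2) \<le> dist x0 b + dist b (b + (- t) *\<^sub>R e2)" by (rule dist_triangle)
    also have "\<dots> < r" using t orthonormal by (simp add: dist_norm)
    finally have "b + (- t) *\<^sub>R e2 \<in> \<Omega>"
      using mem_domain_iff[of "b + (- t) *\<^sub>R e2"] depth_add_normal[of b "- t"] b t by simp
    moreover have "dist (b + (- t) *\<^sub>R e2) b < e" using t orthonormal by (simp add: dist_norm)
    ultimately show "\<exists>y\<in>\<Omega>. dist y b < e" by blast
  qed
  ultimately show ?thesis using open_domain by (simp add: frontier_def interior_open)
qed

text \<open>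
  Up to the error \<open>o(|y - b|)\<close> from the differentiability of \<open>g\<close>, the depth of \<open>y\<close> is a negative
  multiple of \<open>(y - b) \<bullet> n\<close>, so its sign is decided in every cone around the normal.
\<close>

lemma outward_unit_normal_graph:
  assumes b: "b \<in> ball x0 r" "depth b = 0" and \<gamma>: "(g has_real_derivative \<gamma>) (at (b \<bullet> e1))"
  shows "outward_unit_normal \<Omega> b ((1 / sqrt (1 + \<gamma>\<^sup>2)) *\<^sub>R (e2 - \<gamma> *\<^sub>R e1))"
proof -
  define c where "c = sqrt (1 + \<gamma>\<^sup>2)"
  have c: "c \<ge> 1" by (simp add: c_def)
  have cn: "norm (e2 - \<gamma> *\<^sub>R e1) = c"
    by (simp add: norm_eq_sqrt_inner c_def inner_diff_left inner_diff_right frame_inner power2_eq_square)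
  define n where "n = (1 / c) *\<^sub>R (e2 - \<gamma> *\<^sub>R e1)"
  have unit: "norm n = 1" using c by (simp add: n_def cn)
  have cone: "\<exists>\<rho>>0. \<forall>y\<in>ball b \<rho>.
        ((y - b) \<bullet> n < - \<delta> * norm (y - b) \<longrightarrow> y \<in> \<Omega>) \<and>
        ((y - b) \<bullet> n > \<delta> * norm (y - b) \<longrightarrow> y \<notin> \<Omega>)" if \<delta>: "\<delta> > 0" for \<delta>
  proof -
    obtain \<rho>1 where \<rho>1: "\<rho>1 > 0" "\<And>h. norm (h - b \<bullet> e1) < \<rho>1 \<Longrightarrow>
        norm (g h - g (b \<bullet> e1) - \<gamma> * (h - b \<bullet> e1)) \<le> \<delta> * norm (h - b \<bullet> e1)"
      using \<gamma> \<delta> unfolding has_field_derivative_def has_derivative_at_alt by blast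
    define \<rho> where "\<rho> = min \<rho>1 (r - dist x0 b)"
    have "\<rho> > 0" using \<rho>1 b by (simp add: \<rho>_def)
    moreover have "((y - b) \<bullet> n < - \<delta> * norm (y - b) \<longrightarrow> y \<in> \<Omega>) \<and>
        ((y - b) \<bullet> n > \<delta> * norm (y - b) \<longrightarrow> y \<notin> \<Omega>)" if y: "y \<in> ball b \<rho>" for y
    proof -
      have yr: "y \<in> ball x0 r" using y dist_triangle[of x0 y b] by (simp add: \<rho>_def)
      have h: "\<bar>(y - b) \<bullet> e1\<bar> \<le> norm (y - b)" by (rule inner_frame_le)
      have "norm (y - b) < \<rho>1" using y by (simp add: \<rho>_def dist_norm norm_minus_commute)
      then have "\<bar>g (y \<bullet> e1) - g (b \<bullet> e1) - \<gamma> * ((y - b) \<bullet> e1)\<bar> \<le> \<delta> * \<bar>(y - b) \<bullet> e1\<bar>"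
        using \<rho>1(2)[of "y \<bullet> e1"] h by (simp add: inner_diff_left)
      also have "\<dots> \<le> \<delta> * norm (y - b)" using h \<delta> by simp
      also have "g (y \<bullet> e1) - g (b \<bullet> e1) - \<gamma> * ((y - b) \<bullet> e1) = depth y + c * ((y - b) \<bullet> n)"
        using c b(2) by (simp add: n_def depth_def inner_diff_left inner_diff_right algebra_simps)
      finally have *: "\<bar>depth y + c * ((y - b) \<bullet> n)\<bar> \<le> \<delta> * norm (y - b)" .
      have cd: "\<delta> * norm (y - b) \<le> c * (\<delta> * norm (y - b))"
        using mult_right_mono[OF c, of "\<delta> * norm (y - b)"] \<delta> by simp
      show ?thesis
      proof (intro conjI impI)
        assume "(y - b) \<bullet> n < - \<delta> * norm (y - b)"
        then have "c * ((y - b) \<bullet> n) < c * (- \<delta> * norm (y - b))" using c by (intro mult_strict_left_mono) auto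
        then have "depth y > 0" using * cd by (simp add: algebra_simps)
        then show "y \<in> \<Omega>" using mem_domain_iff[OF yr] by simp
      next
        assume "\<delta> * norm (y - b) < (y - b) \<bullet> n"
        then have "c * (\<delta> * norm (y - b)) < c * ((y - b) \<bullet> n)" using c by (intro mult_strict_left_mono) auto
        then have "depth y < 0" using * cd by simp
        then show "y \<notin> \<Omega>" using mem_domain_iff[OF yr] by simp
      qed
    qed
    ultimately show ?thesis by blast
  qed
  have "outward_unit_normal \<Omega> b n"
    unfolding outward_unit_normal_def
  proof (intro conjI allI impI)
    show "norm n = 1" by (rule unit)
  qed (rule cone)
  then show ?thesis by (simp only: n_def c_def)
qed

definition slope :: "plane \<Rightarrow> real" where
  "slope x = deriv g (x \<bullet> e1)"

text \<open>
  Vanishes at depth at most \<open>\<delta>\<close> and equals 1 from depth \<open>2 \<delta>\<close> on, so that its product with a function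
  supported in the chart has compact support in the domain.
\<close>

definition cutoff :: "real \<Rightarrow> plane \<Rightarrow> real" where
  "cutoff \<delta> x = smoothstep (depth x / \<delta> - 1)"

text \<open>
  The derivative of the cutoff with respect to the depth: of size \<open>1 / \<delta>\<close>, and zero outside the layer of
  depth between \<open>\<delta>\<close> and \<open>2 \<delta>\<close>.
\<close>

definition cutoff' :: "real \<Rightarrow> plane \<Rightarrow> real" where
  "cutoff' \<delta> x = smoothstep' (depth x / \<delta> - 1) / \<delta>"

text \<open>
  The derivative of the depth along \<open>w\<close>. On the boundary this is \<open>- sqrt (1 + slope\<^sup>2)\<close> times the outward normal
  component of \<open>w\<close>.
\<close>

definition inflow :: "vector_field \<Rightarrow> plane \<Rightarrow> real" where
  "inflow w x = slope x * (w x \<bullet> e1) - w x \<bullet> e2"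

lemma AE_slope: "AE x in lebesgue. (g has_real_derivative slope x) (at (x \<bullet> e1))"
proof -
  obtain N where N: "negligible N" "\<And>s. s \<notin> N \<Longrightarrow> g differentiable (at s)"
    using lipschitz_real_differentiable_almost_everywhere[OF lipschitz] by blast
  show ?thesis
  proof (rule AE_I')
    show "{x. x \<bullet> e1 \<in> N} \<in> null_sets lebesgue"
      using negligible_slab[OF orthonormal N(1)] by (simp add: negligible_iff_null_sets)
    show "{x \<in> space lebesgue. \<not> (g has_real_derivative slope x) (at (x \<bullet> e1))} \<subseteq> {x. x \<bullet> e1 \<in> N}"
    proof
      fix x assume x: "x \<in> {x \<in> space lebesgue. \<not> (g has_real_derivative slope x) (at (x \<bullet> e1))}"
      show "x \<in> {x. x \<bullet> e1 \<in> N}"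
      proof (rule ccontr)
        assume "x \<notin> {x. x \<bullet> e1 \<in> N}"
        then have "g differentiable (at (x \<bullet> e1))" using N(2) by simp
        then have "(g has_real_derivative slope x) (at (x \<bullet> e1))"
          unfolding slope_def using DERIV_deriv_iff_real_differentiable by blast
        then show False using x by simp
      qed
    qed
  qed
qed

lemma cutoff_has_derivative:
  assumes "(g has_real_derivative slope x) (at (x \<bullet> e1))" "\<delta> > 0"
  shows "(cutoff \<delta> has_derivative (\<lambda>v. cutoff' \<delta> x * (slope x * (v \<bullet> e1) - v \<bullet> e2))) (at x)"
proof -
  have "((\<lambda>x. depth x / \<delta> - 1) has_derivative (\<lambda>v. (slope x * (v \<bullet> e1) - v \<bullet> e2) / \<delta>)) (at x)"
    using depth_has_derivative[OF assms(1)] assms(2) by (auto intro!: derivative_eq_intros)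
  then have "((\<lambda>x. smoothstep (depth x / \<delta> - 1)) has_derivative
      (\<lambda>v. smoothstep' (depth x / \<delta> - 1) * ((slope x * (v \<bullet> e1) - v \<bullet> e2) / \<delta>))) (at x)"
    by (rule has_derivative_compose[where g = smoothstep, OF _ smoothstep_deriv[unfolded has_field_derivative_def]])
  then show ?thesis unfolding cutoff_def[abs_def] cutoff'_def by simp
qed

lemma cutoff_lipschitz:
  assumes "\<delta> > 0"
  shows "\<bar>cutoff \<delta> x - cutoff \<delta> y\<bar> \<le> (4 * (L + 1) / \<delta>) * norm (x - y)"
proof -
  have "\<bar>cutoff \<delta> x - cutoff \<delta> y\<bar> \<le> 4 * \<bar>(depth x - depth y) / \<delta>\<bar>"
    using smoothstep_lipschitz[of "depth x / \<delta> - 1" "depth y / \<delta> - 1"]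
    by (simp add: cutoff_def diff_divide_distrib)
  also have "\<dots> \<le> 4 * ((L + 1) * norm (x - y) / \<delta>)"
    using depth_lipschitz[of x y] assms by (simp add: abs_divide divide_right_mono)
  finally show ?thesis by (simp add: algebra_simps)
qed

lemma continuous_on_cutoff: "continuous_on S (cutoff \<delta>)"
  unfolding cutoff_def[abs_def] divide_inverse by (intro continuous_intros continuous_on_depth)

lemma cutoff_bounds: "0 \<le> cutoff \<delta> x" "cutoff \<delta> x \<le> 1"
  by (auto simp: cutoff_def smoothstep_bounds)

lemma cutoff'_nonneg: "\<delta> > 0 \<Longrightarrow> 0 \<le> cutoff' \<delta> x"
  by (simp add: cutoff'_def smoothstep'_nonneg)

lemma bounded_continuous_cutoff: "bounded_continuous \<Omega> (cutoff \<delta>)"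
  by (rule bounded_continuousI[of _ _ 1]) (auto simp: continuous_on_cutoff cutoff_bounds)

text \<open>
  This is the divergence theorem for the field \<open>cutoff f w\<close>. The cutoff is only Lipschitz, and
  differentiable almost everywhere, because \<open>g\<close> is; away from a null set the divergence is given by
  the product rule, in which the term with \<open>dvg w\<close> drops out.
\<close>

lemma cutoff_integration_by_parts:
  assumes f: "C1_bar \<Omega> f" and w: "C1_bar \<Omega> w" and div: "\<And>x. x \<in> \<Omega> \<Longrightarrow> dvg w x = 0"
    and r': "r' < r" and f0: "\<And>x. x \<in> \<Omega> \<Longrightarrow> r' \<le> norm (x - x0) \<Longrightarrow> f x = 0"
    and \<delta>: "\<delta> > 0"
  shows "integrable (lebesgue_on \<Omega>) (\<lambda>x. cutoff' \<delta> x * f x * inflow w x)" (is "integrable _ ?k")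
    and "dom_integral \<Omega> (\<lambda>x. cutoff \<delta> x * (w x \<bullet> grad f x)) =
      - dom_integral \<Omega> (\<lambda>x. cutoff' \<delta> x * f x * inflow w x)"
proof -
  define A where "A y = f y *\<^sub>R w y" for y
  define V where "V x = (if x \<in> \<Omega> then cutoff \<delta> x *\<^sub>R A x else 0)" for x
  define K where "K = cball x0 r' \<inter> {x. \<delta> \<le> depth x}"
  have "closed {x. \<delta> \<le> depth x}"
    by (rule closed_Collect_le) (auto simp: continuous_on_depth)
  then have K: "compact K" by (simp add: K_def compact_Int_closed)
  have K\<Omega>: "K \<subseteq> \<Omega>"
  proof
    fix x assume "x \<in> K"
    then have "x \<in> ball x0 r" "depth x > 0" using r' \<delta> by (auto simp: K_def)
    then show "x \<in> \<Omega>" using mem_domain_iff by blast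
  qed
  have V0: "V x = 0" if "x \<notin> K" for x
  proof (cases "x \<in> \<Omega> \<and> norm (x - x0) < r'")
    case True
    then have "depth x < \<delta>" using that by (auto simp: K_def dist_norm norm_minus_commute)
    then have "cutoff \<delta> x = 0" unfolding cutoff_def using \<delta> by (intro smoothstep_le_0) simp
    then show ?thesis by (simp add: V_def)
  next
    case False then show ?thesis using f0[of x] by (auto simp: V_def A_def)
  qed
  have DA: "A differentiable (at x)" if "x \<in> \<Omega>" for x
    unfolding A_def using C1_barD(2)[OF f that] C1_barD(2)[OF w that] by simp
  obtain F where F: "F > 0" "\<And>x. x \<in> \<Omega> \<Longrightarrow> norm (f x) \<le> F"
    using C1_bar_bounded_continuous[OF f bounded_domain] by (rule bounded_continuousE) blast
  obtain B where B: "B > 0" "\<And>x. x \<in> \<Omega> \<Longrightarrow> norm (w x) \<le> B"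
    using C1_bar_bounded_continuous[OF w bounded_domain] by (rule bounded_continuousE) blast
  obtain F1 where F1: "F1 > 0" "\<And>x v. x \<in> \<Omega> \<Longrightarrow> norm (frechet_derivative f (at x) v) \<le> F1 * norm v"
    using C1_bar_onorm_bound[OF f bounded_domain] by blast
  obtain B1 where B1: "B1 > 0" "\<And>x v. x \<in> \<Omega> \<Longrightarrow> norm (frechet_derivative w (at x) v) \<le> B1 * norm v"
    using C1_bar_onorm_bound[OF w bounded_domain] by blast
  define C1 where "C1 = F * B1 + F1 * B"
  have C1: "norm (frechet_derivative A (at x) v) \<le> C1 * norm v" if x: "x \<in> \<Omega>" for x v
  proof -
    have "frechet_derivative A (at x) v = f x *\<^sub>R frechet_derivative w (at x) v + frechet_derivative f (at x) v *\<^sub>R w x"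
      unfolding A_def by (rule frechet_derivative_scaleR_field[OF C1_barD(2)[OF f x] C1_barD(2)[OF w x]])
    also have "norm \<dots> \<le> norm (f x) * norm (frechet_derivative w (at x) v) + norm (frechet_derivative f (at x) v) * norm (w x)"
      by (rule norm_triangle_mono) auto
    also have "\<dots> \<le> F * (B1 * norm v) + (F1 * norm v) * B"
      using F B F1 B1 x by (intro add_mono mult_mono) auto
    finally show ?thesis by (simp add: C1_def algebra_simps)
  qed
  have A_bound: "norm (A x) \<le> F * B" if "x \<in> \<Omega>" for x
    using mult_mono[OF F(2)[OF that] B(2)[OF that]] F(1) by (simp add: A_def)
  have A_lip: "norm (A y - A x) \<le> C1 * norm (y - x)" if "ball a \<eta> \<subseteq> \<Omega>" "x \<in> ball a \<eta>" "y \<in> ball a \<eta>" for x y a \<eta>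
  proof (rule differentiable_bound[of "ball a \<eta>" A "\<lambda>x. frechet_derivative A (at x)"])
    show "(A has_derivative frechet_derivative A (at z)) (at z within ball a \<eta>)" if "z \<in> ball a \<eta>" for z
      using has_derivative_frechet[OF DA, of z] that \<open>ball a \<eta> \<subseteq> \<Omega>\<close> has_derivative_at_withinI by blast
    show "onorm (frechet_derivative A (at z)) \<le> C1" if "z \<in> ball a \<eta>" for z
      using that \<open>ball a \<eta> \<subseteq> \<Omega>\<close> C1 F B F1 B1 by (intro onorm_bound) (auto simp: C1_def)
  qed (use that in auto)
  \<comment> \<open>For translations shorter than \<open>\<eta>\<close>, any segment with an endpoint in the support stays in the domain,
    where the mean value theorem applies.\<close>
  obtain \<eta> where \<eta>: "\<eta> > 0" "(\<Union>x\<in>K. ball x \<eta>) \<subseteq> \<Omega>"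
    using compact_subset_open_imp_ball_epsilon_subset[OF K open_domain K\<Omega>] by blast
  define C where "C = (4 * (L + 1) / \<delta>) * (F * B) + C1"
  have lip: "norm (V (x + h) - V x) \<le> C * norm h" if h: "norm h < \<eta>" for x h
  proof (cases "x \<in> K \<or> x + h \<in> K")
    case True
    then obtain a where a: "a \<in> K" "x \<in> ball a \<eta>" "x + h \<in> ball a \<eta>"
    proof
      assume "x \<in> K" then show thesis using that[of x] h \<eta> by (simp add: dist_norm)
    next
      assume "x + h \<in> K" then show thesis using that[of "x + h"] h \<eta> by (simp add: dist_norm)
    qed
    then have sub: "ball a \<eta> \<subseteq> \<Omega>" using \<eta>(2) by blast
    then have x: "x \<in> \<Omega>" "x + h \<in> \<Omega>" using a by auto
    have "V (x + h) - V x = (cutoff \<delta> (x + h) - cutoff \<delta> x) *\<^sub>R A (x + h) + cutoff \<delta> x *\<^sub>R (A (x + h) - A x)"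
      using x by (simp add: V_def algebra_simps)
    also have "norm \<dots> \<le> \<bar>cutoff \<delta> (x + h) - cutoff \<delta> x\<bar> * norm (A (x + h)) + \<bar>cutoff \<delta> x\<bar> * norm (A (x + h) - A x)"
      by (rule norm_triangle_mono) auto
    also have "\<dots> \<le> ((4 * (L + 1) / \<delta>) * norm h) * (F * B) + 1 * (C1 * norm h)"
      using cutoff_lipschitz[OF \<delta>, of "x + h" x] A_bound[OF x(2)] A_lip[OF sub a(2,3)] cutoff_bounds[of \<delta> x] L_nonneg \<delta>
      by (intro add_mono mult_mono) auto
    finally show ?thesis by (simp add: C_def algebra_simps)
  next
    case False
    have "0 \<le> C" using L_nonneg \<delta> F B F1 B1 by (simp add: C_def C1_def)
    then show ?thesis using False V0 by simp
  qed
  have out: "(V has_derivative (\<lambda>_. 0)) (at x)" if "x \<notin> K" for x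
  proof (rule has_derivative_transform_within_open[where s = "- K" and f = "\<lambda>_. 0"])
    show "open (- K)" using K compact_imp_closed by blast
  qed (use that V0 in auto)
  have inn: "V differentiable (at x) \<and>
      dvg V x = cutoff \<delta> x * (w x \<bullet> grad f x) + cutoff' \<delta> x * f x * inflow w x"
    if x: "x \<in> \<Omega>" and sl: "(g has_real_derivative slope x) (at (x \<bullet> e1))" for x
  proof -
    note dc = cutoff_has_derivative[OF sl \<delta>]
    have dc': "cutoff \<delta> differentiable (at x)" using dc by (auto simp: differentiable_def)
    have d: "(\<lambda>y. cutoff \<delta> y *\<^sub>R A y) differentiable (at x)"
      using dc' DA[OF x] by simp
    have "V differentiable (at x)"
      using has_derivative_transform_within_open[OF has_derivative_frechet[OF d] open_domain x, of V]
      by (auto simp: V_def differentiable_def)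
    moreover have "dvg V x = dvg (\<lambda>y. cutoff \<delta> y *\<^sub>R A y) x"
      by (intro dvg_eq_on_open[OF d open_domain x]) (simp add: V_def)
    moreover have "dvg (\<lambda>y. cutoff \<delta> y *\<^sub>R A y) x = cutoff \<delta> x * dvg A x + grad (cutoff \<delta>) x \<bullet> A x"
      by (rule dvg_scaleR_field[OF dc' DA[OF x]])
    moreover have "dvg A x = grad f x \<bullet> w x"
      unfolding A_def using dvg_scaleR_field[OF C1_barD(2)[OF f x] C1_barD(2)[OF w x]] div[OF x] by simp
    moreover have "grad (cutoff \<delta>) x \<bullet> A x = cutoff' \<delta> x * f x * inflow w x"
      unfolding grad_inner[OF dc'] frechet_derivative_at[OF dc, symmetric]
      by (simp add: A_def inflow_def algebra_simps)
    ultimately show ?thesis by (simp add: inner_commute)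
  qed
  have ae: "AE x in lebesgue. V differentiable (at x)"
    using AE_slope
  proof eventually_elim
    case (elim x)
    show ?case using inn[of x] elim out[of x] K\<Omega> by (cases "x \<in> K") (auto simp: differentiable_def)
  qed
  have G: "integrable lebesgue (dvg V)" "(\<integral>x. dvg V x \<partial>lebesgue) = 0"
    using integral_dvg_eq_0[of K V \<eta> C] compact_imp_bounded[OF K] V0 \<eta>(1) lip ae by blast+
  have aeq: "AE x in lebesgue. dvg V x =
      (if x \<in> \<Omega> then cutoff \<delta> x * (w x \<bullet> grad f x) + cutoff' \<delta> x * f x * inflow w x else 0)"
    using AE_slope
  proof eventually_elim
    case (elim x)
    show ?case
    proof (cases "x \<in> \<Omega>")
      case True then show ?thesis using inn[OF True elim] by simp
    next
      case False
      then have "x \<notin> K" using K\<Omega> by blast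
      then have "dvg V x = 0" unfolding dvg_def using frechet_derivative_at[OF out, of x, symmetric] by simp
      then show ?thesis using False by simp
    qed
  qed
  note E = dom_integral_eq_integral_of_extension[OF open_domain aeq G(1)]
  have I: "integrable (lebesgue_on \<Omega>) (\<lambda>x. cutoff \<delta> x * (w x \<bullet> grad f x))"
    by (intro bounded_continuous_integrable open_domain bounded_domain bounded_continuous_intros
        bounded_continuous_cutoff C1_bar_bounded_continuous[OF w] C1_bar_grad_bounded_continuous[OF f])
  show k: "integrable (lebesgue_on \<Omega>) ?k"
    using Bochner_Integration.integrable_diff[OF E(2) I] by simp
  show "dom_integral \<Omega> (\<lambda>x. cutoff \<delta> x * (w x \<bullet> grad f x)) = - dom_integral \<Omega> ?k"
    using E(1) G(2) Bochner_Integration.integral_add[OF I k] by simp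
qed

text \<open>
  The boundary layer has width of order \<open>\<delta>\<close>, so the integral of \<open>cutoff'\<close> near the boundary stays
  bounded. This is read off from the integration by parts for the constant field \<open>- e2\<close>, whose
  inflow is 1, without measuring the layer.
\<close>

lemma integral_cutoff'_bound:
  assumes s: "0 \<le> s" "s < r"
  obtains \<theta> C where "\<And>x. norm (x - x0) \<le> s \<Longrightarrow> \<theta> x = 1" "\<And>x. 0 \<le> \<theta> x" "C > 0"
    "\<And>\<delta>. \<delta> > 0 \<Longrightarrow> integrable (lebesgue_on \<Omega>) (\<lambda>x. cutoff' \<delta> x * \<theta> x)"
    "\<And>\<delta>. \<delta> > 0 \<Longrightarrow> dom_integral \<Omega> (\<lambda>x. cutoff' \<delta> x * \<theta> x) \<le> C"
proof -
  define s' where "s' = (s + r) / 2"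
  have s': "s < s'" "s' < r" using s by (auto simp: s'_def)
  define \<theta> where "\<theta> = bump x0 s s'"
  have \<theta>: "C1_bar \<Omega> \<theta>" by (simp add: \<theta>_def bump_C1_bar)
  have flow: "inflow (\<lambda>x. - e2) x = 1" for x by (simp add: inflow_def frame_inner)
  note P = cutoff_integration_by_parts[OF \<theta> C1_bar_const[of \<Omega> "- e2"] dvg_const s'(2), unfolded flow mult_1_right]
  have \<theta>0: "\<theta> x = 0" if "s' \<le> norm (x - x0)" for x
    unfolding \<theta>_def by (rule bump_eq_0) (use that s s' in auto)
  have gb: "bounded_continuous \<Omega> (\<lambda>x. norm (grad \<theta> x))"
    using C1_bar_grad_bounded_continuous[OF \<theta> bounded_domain]
    by (auto simp: bounded_continuous_def bounded_iff intro: continuous_on_norm)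
  show thesis
  proof
    show "\<theta> x = 1" if "norm (x - x0) \<le> s" for x
      unfolding \<theta>_def by (rule bump_eq_1) (use that s s' in auto)
    show "0 \<le> \<theta> x" for x by (simp add: \<theta>_def bump_bounds)
    show "\<bar>dom_integral \<Omega> (\<lambda>x. norm (grad \<theta> x))\<bar> + 1 > 0"
      by (rule add_nonneg_pos[OF abs_ge_zero zero_less_one])
    fix \<delta> :: real assume \<delta>: "\<delta> > 0"
    show "integrable (lebesgue_on \<Omega>) (\<lambda>x. cutoff' \<delta> x * \<theta> x)"
      by (rule P(1)) (use \<theta>0 \<delta> in auto)
    have "dom_integral \<Omega> (\<lambda>x. cutoff' \<delta> x * \<theta> x) = - dom_integral \<Omega> (\<lambda>x. cutoff \<delta> x * (- e2 \<bullet> grad \<theta> x))"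
      by (subst P(2)) (use \<theta>0 \<delta> in auto)
    also have "\<dots> \<le> \<bar>dom_integral \<Omega> (\<lambda>x. cutoff \<delta> x * (- e2 \<bullet> grad \<theta> x))\<bar>" by simp
    also have "\<dots> \<le> dom_integral \<Omega> (\<lambda>x. norm (grad \<theta> x))"
    proof (rule integral_abs_bound_integral)
      show "integrable (lebesgue_on \<Omega>) (\<lambda>x. cutoff \<delta> x * (- e2 \<bullet> grad \<theta> x))"
        by (intro bounded_continuous_integrable open_domain bounded_domain bounded_continuous_intros
            bounded_continuous_cutoff C1_bar_grad_bounded_continuous[OF \<theta>])
      show "integrable (lebesgue_on \<Omega>) (\<lambda>x. norm (grad \<theta> x))"
        by (rule bounded_continuous_integrable[OF open_domain bounded_domain gb])
      fix x
      have "\<bar>e2 \<bullet> grad \<theta> x\<bar> \<le> norm (grad \<theta> x)"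
        using inner_frame_le(2)[of "grad \<theta> x"] by (simp add: inner_commute)
      then have "\<bar>cutoff \<delta> x\<bar> * \<bar>e2 \<bullet> grad \<theta> x\<bar> \<le> 1 * norm (grad \<theta> x)"
        using cutoff_bounds[of \<delta> x] by (intro mult_mono) auto
      then show "\<bar>cutoff \<delta> x * (- e2 \<bullet> grad \<theta> x)\<bar> \<le> norm (grad \<theta> x)"
        by (simp add: abs_mult)
    qed
    finally show "dom_integral \<Omega> (\<lambda>x. cutoff' \<delta> x * \<theta> x) \<le> \<bar>dom_integral \<Omega> (\<lambda>x. norm (grad \<theta> x))\<bar> + 1"
      by linarith
  qed
qed

text \<open>
  The inflow at \<open>x\<close> is compared with the one at the boundary point \<open>b\<close> vertically above \<open>x\<close>. Both
  points have the same slope, so only the modulus of continuity of \<open>w\<close> enters. At \<open>b\<close> the inflow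
  vanishes, as the normal exists there.
\<close>

lemma inflow_small_near_boundary:
  assumes w: "continuous_on (closure \<Omega>) w"
    and normal: "\<And>b n. b \<in> frontier \<Omega> \<Longrightarrow> outward_unit_normal \<Omega> b n \<Longrightarrow> w b \<bullet> n = 0"
    and s: "s < r" and \<epsilon>: "\<epsilon> > 0"
  obtains d where "d > 0" "\<And>x. x \<in> \<Omega> \<Longrightarrow> norm (x - x0) \<le> s \<Longrightarrow> depth x < d \<Longrightarrow>
      (g has_real_derivative slope x) (at (x \<bullet> e1)) \<Longrightarrow> \<bar>inflow w x\<bar> \<le> \<epsilon> * (L + 1)"
proof -
  have "uniformly_continuous_on (closure \<Omega>) w"
    using w bounded_domain by (intro compact_uniformly_continuous) auto
  then obtain d where d: "d > 0" "\<And>x y. x \<in> closure \<Omega> \<Longrightarrow> y \<in> closure \<Omega> \<Longrightarrow> dist y x < d \<Longrightarrow> dist (w y) (w x) < \<epsilon>"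
    using \<epsilon> unfolding uniformly_continuous_on_def by metis
  show thesis
  proof
    show "min d (r - s) > 0" using d s by simp
    fix x assume x: "x \<in> \<Omega>" "norm (x - x0) \<le> s" "depth x < min d (r - s)"
      and sl: "(g has_real_derivative slope x) (at (x \<bullet> e1))"
    have pos: "depth x > 0" using mem_domain_iff[of x] x s by (simp add: dist_norm norm_minus_commute)
    define b where "b = x + depth x *\<^sub>R e2"
    have bx: "norm (b - x) = depth x" using pos orthonormal by (simp add: b_def)
    have b: "depth b = 0" "b \<bullet> e1 = x \<bullet> e1"
      by (auto simp: b_def depth_add_normal inner_add_left frame_inner)
    have br: "b \<in> ball x0 r"
      using norm_triangle_ineq[of "b - x" "x - x0"] bx x by (simp add: dist_norm norm_minus_commute)
    have fr: "b \<in> frontier \<Omega>" by (rule frontier_if_depth_0[OF br b(1)])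
    have "w b \<bullet> ((1 / sqrt (1 + (slope x)\<^sup>2)) *\<^sub>R (e2 - slope x *\<^sub>R e1)) = 0"
      by (rule normal[OF fr outward_unit_normal_graph[OF br b(1)]]) (simp add: sl b)
    then have wb: "w b \<bullet> (e2 - slope x *\<^sub>R e1) = 0"
      by (simp add: add_nonneg_eq_0_iff)
    have "dist (w b) (w x) < \<epsilon>"
      using d(2)[of x b] x fr closure_subset[of \<Omega>] bx by (auto simp: dist_norm frontier_def)
    then have wd: "norm (w x - w b) \<le> \<epsilon>" by (simp add: dist_norm norm_minus_commute)
    have "inflow w x = - ((w x - w b) \<bullet> (e2 - slope x *\<^sub>R e1))"
      using wb by (simp add: inflow_def inner_diff_left inner_diff_right algebra_simps)
    also have "\<bar>\<dots>\<bar> \<le> norm (w x - w b) * norm (e2 - slope x *\<^sub>R e1)"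
      unfolding abs_minus_cancel by (rule Cauchy_Schwarz_ineq2)
    also have "\<dots> \<le> \<epsilon> * (L + 1)"
    proof (rule mult_mono[OF wd])
      have "norm (e2 - slope x *\<^sub>R e1) \<le> norm e2 + norm (slope x *\<^sub>R e1)" by (rule norm_triangle_ineq4)
      also have "\<dots> \<le> L + 1"
        using lipschitz_real_derivative_bound[OF lipschitz sl] orthonormal by simp
      finally show "norm (e2 - slope x *\<^sub>R e1) \<le> L + 1" .
    qed (use \<epsilon> in auto)
    finally show "\<bar>inflow w x\<bar> \<le> \<epsilon> * (L + 1)" .
  qed
qed

lemma cutoff_tendsto_1:
  assumes "depth x > 0"
  shows "(\<lambda>n. cutoff (1 / real (Suc n)) x) \<longlonglongrightarrow> 1"
proof (rule tendsto_eventually)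
  obtain k where k: "2 / depth x \<le> real k" using real_arch_simple by blast
  show "\<forall>\<^sub>F n in sequentially. cutoff (1 / real (Suc n)) x = 1"
    using eventually_ge_at_top[of k]
  proof eventually_elim
    case (elim n)
    have "2 / depth x \<le> real (Suc n)" using k elim by linarith
    then have "2 \<le> depth x * real (Suc n)" using assms by (simp add: divide_le_eq mult.commute)
    then show ?case unfolding cutoff_def by (intro smoothstep_ge_1) simp
  qed
qed

text \<open>
  In the integration by parts with cutoff, the left side tends to the desired integral as \<open>\<delta>\<close> tends to 0.
  The right side tends to 0, because the inflow is uniformly small in the layer while
  \<open>cutoff'\<close> has bounded integral.
\<close>

theorem dom_integral_inner_grad_local:
  assumes f: "C1_bar \<Omega> f" and w: "C1_bar \<Omega> w" and div: "\<And>x. x \<in> \<Omega> \<Longrightarrow> dvg w x = 0"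
    and normal: "\<And>b n. b \<in> frontier \<Omega> \<Longrightarrow> outward_unit_normal \<Omega> b n \<Longrightarrow> w b \<bullet> n = 0"
    and s: "0 \<le> s" "s < r" and f0: "\<And>x. x \<in> \<Omega> \<Longrightarrow> s \<le> norm (x - x0) \<Longrightarrow> f x = 0"
  shows "dom_integral \<Omega> (\<lambda>x. w x \<bullet> grad f x) = 0"
proof -
  define \<delta> where "\<delta> n = 1 / real (Suc n)" for n
  have \<delta>: "\<delta> n > 0" for n by (simp add: \<delta>_def)
  define I where "I n = dom_integral \<Omega> (\<lambda>x. cutoff (\<delta> n) x * (w x \<bullet> grad f x))" for n
  have wf: "bounded_continuous \<Omega> (\<lambda>x. w x \<bullet> grad f x)"
    by (intro bounded_continuous_intros C1_bar_bounded_continuous[OF w]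
        C1_bar_grad_bounded_continuous[OF f] bounded_domain)
  have lim1: "I \<longlonglongrightarrow> dom_integral \<Omega> (\<lambda>x. w x \<bullet> grad f x)"
    unfolding I_def
  proof (rule integral_dominated_convergence[where w = "\<lambda>x. \<bar>w x \<bullet> grad f x\<bar>"])
    show "(\<lambda>x. w x \<bullet> grad f x) \<in> borel_measurable (lebesgue_on \<Omega>)"
      by (rule bounded_continuous_measurable[OF open_domain wf])
    show "(\<lambda>x. cutoff (\<delta> n) x * (w x \<bullet> grad f x)) \<in> borel_measurable (lebesgue_on \<Omega>)" for n
      by (intro bounded_continuous_measurable open_domain bounded_continuous_mult bounded_continuous_cutoff wf)
    show "integrable (lebesgue_on \<Omega>) (\<lambda>x. \<bar>w x \<bullet> grad f x\<bar>)"
      by (intro integrable_abs bounded_continuous_integrable open_domain bounded_domain wf)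
    show "AE x in lebesgue_on \<Omega>. (\<lambda>n. cutoff (\<delta> n) x * (w x \<bullet> grad f x)) \<longlonglongrightarrow> w x \<bullet> grad f x"
    proof (rule AE_I2)
      fix x assume "x \<in> space (lebesgue_on \<Omega>)"
      then have x: "x \<in> \<Omega>" by simp
      show "(\<lambda>n. cutoff (\<delta> n) x * (w x \<bullet> grad f x)) \<longlonglongrightarrow> w x \<bullet> grad f x"
      proof (cases "norm (x - x0) < r")
        case True
        then have "depth x > 0" using mem_domain_iff[of x] x by (simp add: dist_norm norm_minus_commute)
        then have "(\<lambda>n. cutoff (\<delta> n) x * (w x \<bullet> grad f x)) \<longlonglongrightarrow> 1 * (w x \<bullet> grad f x)"
          unfolding \<delta>_def by (intro tendsto_mult_right cutoff_tendsto_1)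
        then show ?thesis by simp
      next
        case False
        \<comment> \<open>Outside the chart the sign of the depth says nothing, but there \<open>f\<close> vanishes near \<open>x\<close>.\<close>
        have "open (\<Omega> - cball x0 s)" using open_domain by blast
        then have "(f has_derivative (\<lambda>_. 0)) (at x)"
          by (rule has_derivative_transform_within_open[where f = "\<lambda>_. 0", rotated])
            (use False s x f0 in \<open>auto simp: dist_norm norm_minus_commute\<close>)
        from frechet_derivative_at[OF this, symmetric] have "grad f x = 0" by (simp add: grad_def)
        then show ?thesis by simp
      qed
    qed
    show "AE x in lebesgue_on \<Omega>. norm (cutoff (\<delta> n) x * (w x \<bullet> grad f x)) \<le> \<bar>w x \<bullet> grad f x\<bar>" for n
      using cutoff_bounds by (intro AE_I2) (auto simp: abs_mult intro!: mult_left_le_one_le)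
  qed
  obtain \<theta> C where \<theta>: "\<And>x. norm (x - x0) \<le> s \<Longrightarrow> \<theta> x = 1" "\<And>x. 0 \<le> \<theta> x" and C: "C > 0"
    "\<And>\<delta>. \<delta> > 0 \<Longrightarrow> integrable (lebesgue_on \<Omega>) (\<lambda>x. cutoff' \<delta> x * \<theta> x)"
    "\<And>\<delta>. \<delta> > 0 \<Longrightarrow> dom_integral \<Omega> (\<lambda>x. cutoff' \<delta> x * \<theta> x) \<le> C"
    using integral_cutoff'_bound[OF s] by blast
  obtain F where F: "F > 0" "\<And>x. x \<in> \<Omega> \<Longrightarrow> norm (f x) \<le> F"
    using C1_bar_bounded_continuous[OF f bounded_domain] by (rule bounded_continuousE) blast
  have lim2: "I \<longlonglongrightarrow> 0"
  proof (rule LIMSEQ_I)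
    fix e :: real assume e: "0 < e"
    \<comment> \<open>Chosen such that \<open>F * (\<epsilon> * (L + 1)) * C = e / 2\<close> bounds the boundary term.\<close>
    define \<epsilon> where "\<epsilon> = e / (2 * F * (L + 1) * C)"
    have L1: "L + 1 > 0" using L_nonneg by simp
    have \<epsilon>: "\<epsilon> > 0" using e F L1 C by (simp add: \<epsilon>_def)
    obtain d where d: "d > 0" "\<And>x. x \<in> \<Omega> \<Longrightarrow> norm (x - x0) \<le> s \<Longrightarrow> depth x < d \<Longrightarrow>
        (g has_real_derivative slope x) (at (x \<bullet> e1)) \<Longrightarrow> \<bar>inflow w x\<bar> \<le> \<epsilon> * (L + 1)"
      using inflow_small_near_boundary[OF C1_barD(1)[OF w] normal s(2) \<epsilon>] by blast
    obtain k where k: "2 / d \<le> real k" using real_arch_simple by blast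
    have "norm (I n - 0) < e" if n: "k \<le> n" for n
    proof -
      have "2 / d \<le> real (Suc n)" using k n by linarith
      then have \<delta>d: "2 * \<delta> n \<le> d" using d(1) by (simp add: \<delta>_def field_simps)
      note P = cutoff_integration_by_parts[OF f w div s(2) f0 \<delta>[of n]]
      have "\<bar>I n\<bar> = norm (dom_integral \<Omega> (\<lambda>x. cutoff' (\<delta> n) x * f x * inflow w x))"
        unfolding I_def by (subst P(2)) auto
      also have "\<dots> \<le> dom_integral \<Omega> (\<lambda>x. norm (cutoff' (\<delta> n) x * f x * inflow w x))"
        by (rule integral_norm_bound)
      also have "\<dots> \<le> dom_integral \<Omega> (\<lambda>x. F * \<epsilon> * (L + 1) * (cutoff' (\<delta> n) x * \<theta> x))"
      proof (rule integral_mono_AE)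
        show "integrable (lebesgue_on \<Omega>) (\<lambda>x. norm (cutoff' (\<delta> n) x * f x * inflow w x))"
          by (rule integrable_norm, rule P(1))
        show "integrable (lebesgue_on \<Omega>) (\<lambda>x. F * \<epsilon> * (L + 1) * (cutoff' (\<delta> n) x * \<theta> x))"
          by (rule integrable_mult_right, rule C(2)[OF \<delta>])
        have "AE x in lebesgue. x \<in> \<Omega> \<longrightarrow>
            norm (cutoff' (\<delta> n) x * f x * inflow w x) \<le> F * \<epsilon> * (L + 1) * (cutoff' (\<delta> n) x * \<theta> x)"
          using AE_slope
        proof eventually_elim
          case (elim x)
          show ?case
          proof
            assume x: "x \<in> \<Omega>"
            have nonneg: "0 \<le> F * \<epsilon> * (L + 1) * (cutoff' (\<delta> n) x * \<theta> x)"
              using F \<epsilon> L1 cutoff'_nonneg[OF \<delta>] \<theta>(2) by simp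
            consider "s \<le> norm (x - x0)" | "d \<le> depth x" | "norm (x - x0) \<le> s" "depth x < d" by linarith
            then show "norm (cutoff' (\<delta> n) x * f x * inflow w x) \<le> F * \<epsilon> * (L + 1) * (cutoff' (\<delta> n) x * \<theta> x)"
            proof cases
              case 1 then show ?thesis using nonneg f0[OF x] by simp
            next
              case 2
              then have "1 \<le> depth x / \<delta> n - 1" using \<delta>d \<delta>[of n] by (simp add: pos_le_divide_eq)
              then have "cutoff' (\<delta> n) x = 0" by (simp add: cutoff'_def smoothstep'_eq_0)
              then show ?thesis by simp
            next
              case 3
              have "cutoff' (\<delta> n) x * \<bar>f x\<bar> * \<bar>inflow w x\<bar> \<le> cutoff' (\<delta> n) x * F * (\<epsilon> * (L + 1))"
                using d(2)[OF x 3 elim] F(2)[OF x] F(1) cutoff'_nonneg[OF \<delta>, of n x]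
                by (intro mult_mono) auto
              then show ?thesis
                using \<theta>(1)[OF 3(1)] cutoff'_nonneg[OF \<delta>, of n x] by (simp add: abs_mult mult_ac)
            qed
          qed
        qed
        then show "AE x in lebesgue_on \<Omega>. norm (cutoff' (\<delta> n) x * f x * inflow w x)
            \<le> F * \<epsilon> * (L + 1) * (cutoff' (\<delta> n) x * \<theta> x)"
          using open_domain by (subst AE_restrict_space_iff) auto
      qed
      also have "\<dots> = F * \<epsilon> * (L + 1) * dom_integral \<Omega> (\<lambda>x. cutoff' (\<delta> n) x * \<theta> x)" by simp
      also have "\<dots> \<le> F * \<epsilon> * (L + 1) * C"
        using C(3)[OF \<delta>] F \<epsilon> L1 by (intro mult_left_mono) auto
      also have "\<dots> = e / 2"
      proof -
        have "F * (e / (2 * F * l * C)) * l * C = e / 2" if "l > 0" for l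
          using that F(1) C(1) by (simp add: field_simps)
        then show ?thesis using L1 by (simp add: \<epsilon>_def)
      qed
      also have "\<dots> < e" using e by simp
      finally show ?thesis by simp
    qed
    then show "\<exists>no. \<forall>n\<ge>no. norm (I n - 0) < e" by blast
  qed
  show ?thesis using LIMSEQ_unique[OF lim1 lim2] .
qed

end

section \<open>Tangential solenoidal fields are orthogonal to gradients\<close>

lemma dom_integral_inner_grad_diff:
  assumes \<Omega>: "open \<Omega>" "bounded \<Omega>" and w: "C1_bar \<Omega> w"
    and p: "C1_bar \<Omega> p" and q: "C1_bar \<Omega> q"
  shows "dom_integral \<Omega> (\<lambda>x. w x \<bullet> grad (\<lambda>x. p x - q x) x) =
    dom_integral \<Omega> (\<lambda>x. w x \<bullet> grad p x) - dom_integral \<Omega> (\<lambda>x. w x \<bullet> grad q x)"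
proof -
  have g: "grad (\<lambda>x. p x - q x) x = grad p x - grad q x" if "x \<in> \<Omega>" for x
    unfolding grad_def
    using frechet_derivative_at[OF has_derivative_diff[OF has_derivative_frechet[OF C1_barD(2)[OF p that]]
          has_derivative_frechet[OF C1_barD(2)[OF q that]]], symmetric]
    by (simp add: scaleR_left_diff_distrib sum_subtractf)
  have i: "integrable (lebesgue_on \<Omega>) (\<lambda>x. w x \<bullet> grad f x)" if "C1_bar \<Omega> f" for f
    by (intro bounded_continuous_integrable \<Omega> bounded_continuous_intros
        C1_bar_bounded_continuous[OF w] C1_bar_grad_bounded_continuous[OF that])
  have "dom_integral \<Omega> (\<lambda>x. w x \<bullet> grad (\<lambda>x. p x - q x) x) =
      dom_integral \<Omega> (\<lambda>x. w x \<bullet> grad p x - w x \<bullet> grad q x)"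
    by (rule Bochner_Integration.integral_cong) (auto simp: g inner_diff_right)
  then show ?thesis using Bochner_Integration.integral_diff[OF i[OF p] i[OF q]] by simp
qed

lemma bounded_lipschitz_domainD:
  assumes "bounded_lipschitz_domain \<Omega>"
  shows "open \<Omega>" "bounded \<Omega>" "\<Omega> \<noteq> {}"
    "\<And>x. x \<in> frontier \<Omega> \<Longrightarrow> \<exists>r>0. \<exists>e1 e2 g L. boundary_chart \<Omega> x r e1 e2 g L"
proof -
  show o: "open \<Omega>" "bounded \<Omega>" "\<Omega> \<noteq> {}" using assms by (auto simp: bounded_lipschitz_domain_def)
  fix x assume "x \<in> frontier \<Omega>"
  then obtain r e1 e2 g L where "r > 0" "norm e1 = 1" "norm e2 = 1" "e1 \<bullet> e2 = 0" "L-lipschitz_on UNIV g"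
    "\<Omega> \<inter> ball x r = {y \<in> ball x r. y \<bullet> e2 < (g :: real \<Rightarrow> real) (y \<bullet> e1)}"
    using assms unfolding bounded_lipschitz_domain_def by (elim conjE ballE exE) blast+
  then have "boundary_chart \<Omega> x r e1 e2 g L" using o by unfold_locales
  then show "\<exists>r>0. \<exists>e1 e2 g L. boundary_chart \<Omega> x r e1 e2 g L" using \<open>r > 0\<close> by blast
qed

text \<open>
  Multiplying the test function by \<open>1 - \<theta>\<close>, where \<open>\<theta>\<close> is a bump in a boundary chart, does not change
  the integral, by the local result. After finitely many such steps the test function vanishes
  near the whole boundary.
\<close>

theorem dom_integral_inner_grad_solenoidal:
  assumes lip: "bounded_lipschitz_domain \<Omega>" and w: "C1_bar \<Omega> w" and div: "\<And>x. x \<in> \<Omega> \<Longrightarrow> dvg w x = 0"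
    and normal: "\<And>b n. b \<in> frontier \<Omega> \<Longrightarrow> outward_unit_normal \<Omega> b n \<Longrightarrow> w b \<bullet> n = 0"
    and q: "C1_bar \<Omega> q"
  shows "dom_integral \<Omega> (\<lambda>x. w x \<bullet> grad q x) = 0"
proof -
  note \<Omega> = bounded_lipschitz_domainD[OF lip]
  have "\<forall>x\<in>frontier \<Omega>. \<exists>r. r > 0 \<and> (\<exists>e1 e2 g L. boundary_chart \<Omega> x r e1 e2 g L)" using \<Omega>(4) by blast
  then obtain r where r: "\<And>x. x \<in> frontier \<Omega> \<Longrightarrow> r x > 0"
    "\<And>x. x \<in> frontier \<Omega> \<Longrightarrow> \<exists>e1 e2 g L. boundary_chart \<Omega> x (r x) e1 e2 g L"
    by metis
  define \<theta> where "\<theta> x = bump x (r x / 4) (r x / 2)" for x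
  have local: "dom_integral \<Omega> (\<lambda>y. w y \<bullet> grad (\<lambda>y. \<theta> x y * p y) y) = 0"
    if x: "x \<in> frontier \<Omega>" and p: "C1_bar \<Omega> p" for x p
  proof -
    obtain e1 e2 g L where "boundary_chart \<Omega> x (r x) e1 e2 g L" using r(2)[OF x] by blast
    then interpret boundary_chart \<Omega> x "r x" e1 e2 g L .
    show ?thesis
    proof (rule dom_integral_inner_grad_local[OF _ w div normal, where s = "r x / 2"])
      show "C1_bar \<Omega> (\<lambda>y. \<theta> x y * p y)" unfolding \<theta>_def by (intro C1_bar_mult bump_C1_bar p)
      show "\<theta> x y * p y = 0" if "r x / 2 \<le> norm (y - x)" for y
        using bump_eq_0[OF _ _ that, of "r x / 4"] r(1)[OF x] by (simp add: \<theta>_def)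
    qed (use r(1)[OF x] in auto)
  qed
  have cpt: "compact (frontier \<Omega>)" using \<Omega>(2) by (rule compact_frontier_bounded)
  have cover: "frontier \<Omega> \<subseteq> (\<Union>x\<in>frontier \<Omega>. ball x (r x / 4))" using r(1) by force
  obtain F0 where F0: "F0 \<subseteq> frontier \<Omega>" "finite F0" "frontier \<Omega> \<subseteq> (\<Union>x\<in>F0. ball x (r x / 4))"
  proof (rule compactE_image[OF cpt _ cover])
    show "open (ball x (r x / 4))" for x by simp
  qed (rule that)
  have "\<forall>p. C1_bar \<Omega> p \<longrightarrow> (\<forall>x\<in>F0 - F. \<forall>y\<in>\<Omega> \<inter> ball x (r x / 4). p y = 0) \<longrightarrow>
      dom_integral \<Omega> (\<lambda>y. w y \<bullet> grad p y) = 0" if "F \<subseteq> F0" for F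
    using finite_subset[OF that F0(2)] that
  proof (induction F rule: finite_induct)
    case empty
    show ?case
    proof (intro allI impI)
      fix p :: scalar_field assume p: "C1_bar \<Omega> p" and p0: "\<forall>x\<in>F0 - {}. \<forall>y\<in>\<Omega> \<inter> ball x (r x / 4). p y = 0"
      show "dom_integral \<Omega> (\<lambda>y. w y \<bullet> grad p y) = 0"
      proof (rule dom_integral_grad_compact_support[OF \<Omega>(1,2) p w div])
        show "compact (closure \<Omega> - (\<Union>x\<in>F0. ball x (r x / 4)))"
          using \<Omega>(2) by (intro compact_diff) auto
        show "closure \<Omega> - (\<Union>x\<in>F0. ball x (r x / 4)) \<subseteq> \<Omega>"
          using F0(3) \<Omega>(1) by (auto simp: frontier_def interior_open)
        show "p x = 0" if "x \<in> \<Omega> - (closure \<Omega> - (\<Union>x\<in>F0. ball x (r x / 4)))" for x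
          using that p0 closure_subset[of \<Omega>] by blast
      qed
    qed
  next
    case (insert x F)
    show ?case
    proof (intro allI impI)
      fix p :: scalar_field assume p: "C1_bar \<Omega> p" and p0: "\<forall>a\<in>F0 - insert x F. \<forall>y\<in>\<Omega> \<inter> ball a (r a / 4). p y = 0"
      have x: "x \<in> frontier \<Omega>" using insert.prems F0(1) by blast
      have \<theta>p: "C1_bar \<Omega> (\<lambda>y. \<theta> x y * p y)" unfolding \<theta>_def by (intro C1_bar_mult bump_C1_bar p)
      have "dom_integral \<Omega> (\<lambda>y. w y \<bullet> grad (\<lambda>y. p y - \<theta> x y * p y) y) = 0"
      proof (rule insert.IH[rule_format])
        show "C1_bar \<Omega> (\<lambda>y. p y - \<theta> x y * p y)" by (rule C1_bar_diff[OF p \<theta>p])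
        fix a y assume a: "a \<in> F0 - F" and y: "y \<in> \<Omega> \<inter> ball a (r a / 4)"
        show "p y - \<theta> x y * p y = 0"
        proof (cases "a = x")
          case True
          then have "\<theta> x y = 1" unfolding \<theta>_def using y r(1)[OF x]
            by (intro bump_eq_1) (auto simp: dist_norm norm_minus_commute)
          then show ?thesis by simp
        next
          case False
          then have "a \<in> F0 - insert x F" using a by simp
          then have "p y = 0" using p0 y by blast
          then show ?thesis by simp
        qed
      qed (use insert.prems in auto)
      then show "dom_integral \<Omega> (\<lambda>y. w y \<bullet> grad p y) = 0"
        using dom_integral_inner_grad_diff[OF \<Omega>(1,2) w p \<theta>p] local[OF x p] by simp
    qed
  qed
  from this[of F0] q show ?thesis by simp
qed

section \<open>Dissipativity of the Dirichlet Laplacian\<close>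

text \<open>
  The frechet derivatives of two functions agree on an open set on which the functions agree, although
  they may differ elsewhere; this is what the induction over \<open>k\<close> needs.
\<close>

lemma Ck_on_cong_imp:
  assumes "open S" "\<And>x. x \<in> S \<Longrightarrow> f x = g x" "Ck_on k S f"
  shows "Ck_on k S g"
  using assms(2,3)
proof (induction k arbitrary: f g)
  case 0
  then show ?case by (simp cong: continuous_on_cong)
next
  case (Suc k)
  have fd: "f differentiable (at x)" if "x \<in> S" for x using Suc.prems that by simp
  have "g differentiable (at x)" if "x \<in> S" for x
    using has_derivative_transform_within_open[OF has_derivative_frechet[OF fd[OF that]] assms(1) that, of g]
      Suc.prems(1) by (auto simp: differentiable_def)
  moreover have "Ck_on k S (\<lambda>x. frechet_derivative g (at x) v)" for v
  proof (rule Suc.IH)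
    show "frechet_derivative f (at x) v = frechet_derivative g (at x) v" if "x \<in> S" for x
      using frechet_derivative_transform_within_open[OF fd[OF that] assms(1) that Suc.prems(1)] by simp
    show "Ck_on k S (\<lambda>x. frechet_derivative f (at x) v)" using Suc.prems by simp
  qed
  ultimately show ?case by simp
qed

lemma frechet_derivative_inner_const:
  assumes "f differentiable (at x)"
  shows "frechet_derivative (\<lambda>y. f y \<bullet> b) (at x) v = frechet_derivative f (at x) v \<bullet> b"
  using frechet_derivative_at[OF has_derivative_inner_left[OF has_derivative_frechet[OF assms]], of b, symmetric]
  by simp

lemma differentiable_inner_const:
  "f differentiable (at x) \<Longrightarrow> (\<lambda>y. f y \<bullet> b) differentiable (at x)"
  by (rule differentiableI[OF has_derivative_inner_left[OF has_derivative_frechet]])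

lemma Ck_on_inner_const:
  fixes f :: "plane \<Rightarrow> 'b::real_inner"
  assumes "open S" "Ck_on k S f"
  shows "Ck_on k S (\<lambda>x. f x \<bullet> b)"
  using assms(2)
proof (induction k arbitrary: f)
  case 0
  then show ?case by (auto intro: continuous_intros)
next
  case (Suc k)
  have fd: "f differentiable (at x)" if "x \<in> S" for x using Suc.prems that by simp
  have "Ck_on k S (\<lambda>x. frechet_derivative (\<lambda>y. f y \<bullet> b) (at x) v)" for v
  proof (rule Ck_on_cong_imp[OF assms(1)])
    show "Ck_on k S (\<lambda>x. frechet_derivative f (at x) v \<bullet> b)" using Suc by simp
    show "frechet_derivative f (at x) v \<bullet> b = frechet_derivative (\<lambda>y. f y \<bullet> b) (at x) v" if "x \<in> S" for x
      using frechet_derivative_inner_const[OF fd[OF that]] by simp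
  qed
  then show ?case using fd differentiable_inner_const by simp
qed

lemma C1_bar_inner_const:
  fixes f :: "plane \<Rightarrow> 'b::real_inner"
  assumes f: "C1_bar \<Omega> f"
  shows "C1_bar \<Omega> (\<lambda>x. f x \<bullet> b)"
  unfolding C1_bar_def
proof (intro conjI ballI allI)
  show "continuous_on (closure \<Omega>) (\<lambda>x. f x \<bullet> b)" by (intro continuous_intros C1_barD f)
  show "(\<lambda>x. f x \<bullet> b) differentiable (at x)" if "x \<in> \<Omega>" for x
    using C1_barD(2)[OF f that] by (rule differentiable_inner_const)
  fix v
  obtain f' where f': "continuous_on (closure \<Omega>) f'" "\<And>x. x \<in> \<Omega> \<Longrightarrow> f' x = frechet_derivative f (at x) v"
    using f unfolding C1_bar_def by metis
  show "\<exists>g. continuous_on (closure \<Omega>) g \<and> (\<forall>x\<in>\<Omega>. g x = frechet_derivative (\<lambda>x. f x \<bullet> b) (at x) v)"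
  proof (intro exI conjI ballI)
    show "continuous_on (closure \<Omega>) (\<lambda>x. f' x \<bullet> b)" by (intro continuous_intros f')
    show "f' x \<bullet> b = frechet_derivative (\<lambda>x. f x \<bullet> b) (at x) v" if "x \<in> \<Omega>" for x
      using frechet_derivative_inner_const[OF C1_barD(2)[OF f that]] f'(2)[OF that] by simp
  qed
qed

lemma grad_has_derivative:
  assumes f: "Ck_on 2 \<Omega> f" and x: "x \<in> \<Omega>"
  shows "(grad f has_derivative
    (\<lambda>h. \<Sum>b\<in>Basis. frechet_derivative (\<lambda>y. frechet_derivative f (at y) b) (at x) h *\<^sub>R b)) (at x)"
  unfolding grad_def[abs_def]
  by (intro has_derivative_sum has_derivative_scaleR_left has_derivative_frechet)
    (use f x in \<open>simp add: numeral_2_eq_2\<close>)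

lemma grad_differentiable: "Ck_on 2 \<Omega> f \<Longrightarrow> x \<in> \<Omega> \<Longrightarrow> grad f differentiable (at x)"
  using grad_has_derivative by (auto simp: differentiable_def)

lemma continuous_on_frechet_derivative_grad:
  assumes f: "Ck_on 2 \<Omega> f"
  shows "continuous_on \<Omega> (\<lambda>x. frechet_derivative (grad f) (at x) v)"
proof -
  have "continuous_on \<Omega> (\<lambda>x. frechet_derivative (\<lambda>y. frechet_derivative f (at y) b) (at x) v)" for b
    using f by (simp add: numeral_2_eq_2)
  then have "continuous_on \<Omega> (\<lambda>x. \<Sum>b\<in>Basis. frechet_derivative (\<lambda>y. frechet_derivative f (at y) b) (at x) v *\<^sub>R b)"
    by (intro continuous_intros)
  then show ?thesis
    using frechet_derivative_at[OF grad_has_derivative[OF f], symmetric] by (simp cong: continuous_on_cong)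
qed

text \<open>
  A monotone C1 truncation that vanishes on \<open>[-\<delta>, \<delta>]\<close> and is the identity for \<open>\<bar>s\<bar> \<ge> sqrt 2 \<delta>\<close>.
\<close>

definition soft_threshold :: "real \<Rightarrow> real \<Rightarrow> real" where
  "soft_threshold \<delta> s = s * smoothstep ((s / \<delta>)\<^sup>2 - 1)"

definition soft_threshold' :: "real \<Rightarrow> real \<Rightarrow> real" where
  "soft_threshold' \<delta> s = smoothstep ((s / \<delta>)\<^sup>2 - 1) + 2 * (s / \<delta>)\<^sup>2 * smoothstep' ((s / \<delta>)\<^sup>2 - 1)"

lemma soft_threshold_deriv:
  assumes "\<delta> > 0"
  shows "(soft_threshold \<delta> has_real_derivative soft_threshold' \<delta> s) (at s)"
proof -
  have "((\<lambda>s. (s / \<delta>)\<^sup>2 - 1) has_real_derivative 2 * (s / \<delta>) * (1 / \<delta>)) (at s)"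
    using assms by (auto intro!: derivative_eq_intros simp: power2_eq_square)
  from DERIV_mult[OF DERIV_ident DERIV_chain2[OF smoothstep_deriv this]]
  show ?thesis
    unfolding soft_threshold_def[abs_def] soft_threshold'_def
    by (simp add: power2_eq_square mult_ac add.commute)
qed

lemma soft_threshold'_nonneg: "0 \<le> soft_threshold' \<delta> s"
  by (simp add: soft_threshold'_def smoothstep_bounds smoothstep'_nonneg)

lemma soft_threshold_eq_0:
  assumes "\<bar>s\<bar> \<le> \<delta>"
  shows "soft_threshold \<delta> s = 0"
proof -
  have "(s / \<delta>)\<^sup>2 \<le> 1" using assms by (cases "\<delta> = 0") (auto simp: abs_square_le_1 abs_divide divide_le_eq_1)
  then show ?thesis by (simp add: soft_threshold_def smoothstep_le_0)
qed

lemma abs_soft_threshold_le: "\<bar>soft_threshold \<delta> s\<bar> \<le> \<bar>s\<bar>"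
  using smoothstep_bounds by (auto simp: soft_threshold_def abs_mult intro!: mult_right_le_one_le)

lemma soft_threshold_tendsto: "(\<lambda>n. soft_threshold (1 / real (Suc n)) s) \<longlonglongrightarrow> s"
proof (cases "s = 0")
  case True then show ?thesis by (simp add: soft_threshold_def)
next
  case False
  obtain k where k: "2 / \<bar>s\<bar> \<le> real k" using real_arch_simple by blast
  show ?thesis
  proof (rule tendsto_eventually)
    show "\<forall>\<^sub>F n in sequentially. soft_threshold (1 / real (Suc n)) s = s"
      using eventually_ge_at_top[of k]
    proof eventually_elim
      case (elim n)
      have "2 / \<bar>s\<bar> \<le> real (Suc n)" using k elim by linarith
      then have "2 \<le> \<bar>s * real (Suc n)\<bar>" using False by (simp add: divide_le_eq abs_mult mult.commute)
      then have "2\<^sup>2 \<le> (s * real (Suc n))\<^sup>2" by (metis abs_le_square_iff abs_numeral)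
      then show ?case unfolding soft_threshold_def by (subst smoothstep_ge_1) auto
    qed
  qed
qed

lemma continuous_on_soft_threshold: "continuous_on S f \<Longrightarrow> continuous_on S (\<lambda>x. soft_threshold \<delta> (f x))"
  unfolding soft_threshold_def divide_inverse by (intro continuous_intros)

lemma continuous_on_soft_threshold': "continuous_on S f \<Longrightarrow> continuous_on S (\<lambda>x. soft_threshold' \<delta> (f x))"
  unfolding soft_threshold'_def divide_inverse by (intro continuous_intros)

text \<open>
  The field \<open>T(v) \<nabla>v\<close>, where \<open>T\<close> is the truncation, has compact support because \<open>v\<close> vanishes on the boundary, and its
  divergence is \<open>T(v) \<Delta>v + T'(v) |\<nabla>v|\<^sup>2\<close> with a nonnegative second term.
\<close>

lemma dom_integral_soft_threshold_lap_nonpos: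
  assumes \<Omega>: "open \<Omega>" "bounded \<Omega>" and v2: "Ck_on 2 \<Omega> v" and v1: "C1_bar \<Omega> v"
    and v0: "\<And>x. x \<in> frontier \<Omega> \<Longrightarrow> v x = 0" and lap: "bounded_continuous \<Omega> (lap v)" and \<delta>: "\<delta> > 0"
  shows "integrable (lebesgue_on \<Omega>) (\<lambda>x. soft_threshold \<delta> (v x) * lap v x)"
    and "dom_integral \<Omega> (\<lambda>x. soft_threshold \<delta> (v x) * lap v x) \<le> 0"
proof -
  define V where "V x = (if x \<in> \<Omega> then soft_threshold \<delta> (v x) *\<^sub>R grad v x else 0)" for x
  define K where "K = closure \<Omega> \<inter> (\<lambda>x. \<bar>v x\<bar>) -` {\<delta>..}"
  have "closed K"
    unfolding K_def by (intro continuous_closed_preimage continuous_intros C1_barD v1) auto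
  moreover have "bounded K" unfolding K_def using bounded_closure[OF \<Omega>(2)] bounded_Int by blast
  ultimately have K: "compact K" by (simp add: compact_eq_bounded_closed)
  have K\<Omega>: "K \<subseteq> \<Omega>"
  proof
    fix x assume "x \<in> K"
    then have "x \<in> closure \<Omega>" "v x \<noteq> 0" using \<delta> by (auto simp: K_def)
    then show "x \<in> \<Omega>" using v0[of x] \<Omega>(1) by (auto simp: frontier_def interior_open)
  qed
  have V0: "V x = 0" if "x \<notin> K" for x
    using that closure_subset[of \<Omega>] soft_threshold_eq_0[of "v x" \<delta>] by (auto simp: V_def K_def)
  have Tv: "((\<lambda>y. soft_threshold \<delta> (v y)) has_derivative (\<lambda>h. soft_threshold' \<delta> (v x) * frechet_derivative v (at x) h)) (at x)"
    if "x \<in> \<Omega>" for x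
    by (rule has_derivative_compose[where g = "soft_threshold \<delta>", OF has_derivative_frechet[OF C1_barD(2)[OF v1 that]]
          soft_threshold_deriv[OF \<delta>, unfolded has_field_derivative_def]])
  have Tv': "(\<lambda>y. soft_threshold \<delta> (v y)) differentiable (at x)" if "x \<in> \<Omega>" for x
    using Tv[OF that] by (auto simp: differentiable_def)
  have d: "(\<lambda>y. soft_threshold \<delta> (v y) *\<^sub>R grad v y) differentiable (at x)" if "x \<in> \<Omega>" for x
    using Tv'[OF that] grad_differentiable[OF v2 that] by simp
  have D: "V differentiable (at x)" if "x \<in> \<Omega>" for x
    using has_derivative_transform_within_open[OF has_derivative_frechet[OF d[OF that]] \<Omega>(1) that, of V]
    by (auto simp: V_def differentiable_def)
  have fd: "frechet_derivative V (at x) h = soft_threshold \<delta> (v x) *\<^sub>R frechet_derivative (grad v) (at x) h +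
      (soft_threshold' \<delta> (v x) * frechet_derivative v (at x) h) *\<^sub>R grad v x" if "x \<in> \<Omega>" for x h
  proof -
    have "frechet_derivative V (at x) = frechet_derivative (\<lambda>y. soft_threshold \<delta> (v y) *\<^sub>R grad v y) (at x)"
      by (rule frechet_derivative_transform_within_open[OF D[OF that] \<Omega>(1) that]) (auto simp: V_def)
    then show ?thesis
      using frechet_derivative_scaleR_field[OF Tv'[OF that] grad_differentiable[OF v2 that]]
        frechet_derivative_at[OF Tv[OF that], symmetric] by simp
  qed
  have vc: "continuous_on \<Omega> v" "continuous_on \<Omega> (grad v)" "continuous_on \<Omega> (\<lambda>x. frechet_derivative v (at x) h)" for h
    using C1_bar_bounded_continuous[OF v1 \<Omega>(2)] C1_bar_grad_bounded_continuous[OF v1 \<Omega>(2)]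
      C1_bar_derivative_bounded_continuous[OF v1 \<Omega>(2)] by (auto simp: bounded_continuous_def)
  have "continuous_on \<Omega> (\<lambda>x. frechet_derivative V (at x) b)" for b
  proof -
    have "continuous_on \<Omega> (\<lambda>x. soft_threshold \<delta> (v x) *\<^sub>R frechet_derivative (grad v) (at x) b +
      (soft_threshold' \<delta> (v x) * frechet_derivative v (at x) b) *\<^sub>R grad v x)"
      by (intro continuous_intros continuous_on_soft_threshold continuous_on_soft_threshold' vc
          continuous_on_frechet_derivative_grad v2)
    then show ?thesis using fd by (simp cong: continuous_on_cong)
  qed
  then have G: "integrable lebesgue (dvg V)" "(\<integral>x. dvg V x \<partial>lebesgue) = 0"
    using integral_dvg_C1_eq_0[of K \<Omega> V] K K\<Omega> \<Omega>(1) V0 D by blast+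
  have ext: "AE x in lebesgue. dvg V x = (if x \<in> \<Omega> then
      soft_threshold \<delta> (v x) * lap v x + soft_threshold' \<delta> (v x) * (norm (grad v x))\<^sup>2 else 0)"
  proof (rule AE_I2)
    fix x
    show "dvg V x = (if x \<in> \<Omega> then
      soft_threshold \<delta> (v x) * lap v x + soft_threshold' \<delta> (v x) * (norm (grad v x))\<^sup>2 else 0)"
    proof (cases "x \<in> \<Omega>")
      case True
      have "dvg V x = dvg (\<lambda>y. soft_threshold \<delta> (v y) *\<^sub>R grad v y) x"
        by (intro dvg_eq_on_open[OF d[OF True] \<Omega>(1) True]) (simp add: V_def)
      also have "\<dots> = soft_threshold \<delta> (v x) * dvg (grad v) x + grad (\<lambda>y. soft_threshold \<delta> (v y)) x \<bullet> grad v x"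
        by (rule dvg_scaleR_field[OF Tv'[OF True] grad_differentiable[OF v2 True]])
      also have "grad (\<lambda>y. soft_threshold \<delta> (v y)) x \<bullet> grad v x = soft_threshold' \<delta> (v x) * (norm (grad v x))\<^sup>2"
        unfolding grad_inner[OF Tv'[OF True]] frechet_derivative_at[OF Tv[OF True], symmetric]
        by (simp add: grad_inner[OF C1_barD(2)[OF v1 True], symmetric] power2_norm_eq_inner)
      finally show ?thesis using True by (simp add: lap_def)
    next
      case False
      have "open (- K)" using K compact_imp_closed by blast
      then have "dvg V x = dvg (\<lambda>y. 0) x"
        using False K\<Omega> by (intro dvg_eq_on_open[where S = "- K"]) (auto simp: V0)
      then show ?thesis using False by (simp add: dvg_const)
    qed
  qed
  note E = dom_integral_eq_integral_of_extension[OF \<Omega>(1) ext G(1)]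
  have Tb: "bounded_continuous \<Omega> (\<lambda>x. soft_threshold \<delta> (v x))"
  proof -
    obtain B where "\<And>x. x \<in> \<Omega> \<Longrightarrow> norm (v x) \<le> B"
      using C1_bar_bounded_continuous[OF v1 \<Omega>(2)] by (rule bounded_continuousE) blast
    then show ?thesis using abs_soft_threshold_le order_trans
      by (intro bounded_continuousI[of _ _ B] continuous_on_soft_threshold vc) (fastforce simp: real_norm_def)
  qed
  show I: "integrable (lebesgue_on \<Omega>) (\<lambda>x. soft_threshold \<delta> (v x) * lap v x)"
    by (intro bounded_continuous_integrable \<Omega> bounded_continuous_mult Tb lap)
  have I2: "integrable (lebesgue_on \<Omega>) (\<lambda>x. soft_threshold' \<delta> (v x) * (norm (grad v x))\<^sup>2)"
    using Bochner_Integration.integrable_diff[OF E(2) I] by simp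
  have "dom_integral \<Omega> (\<lambda>x. soft_threshold' \<delta> (v x) * (norm (grad v x))\<^sup>2) \<ge> 0"
    by (rule Bochner_Integration.integral_nonneg) (simp add: soft_threshold'_nonneg)
  then show "dom_integral \<Omega> (\<lambda>x. soft_threshold \<delta> (v x) * lap v x) \<le> 0"
    using E(1) G(2) Bochner_Integration.integral_add[OF I I2] by simp
qed

text \<open>
  The truncations of \<open>v\<close> converge pointwise to \<open>v\<close> and are dominated by \<open>\<bar>v\<bar>\<close>.
\<close>

lemma dom_integral_mult_lap_nonpos:
  assumes \<Omega>: "open \<Omega>" "bounded \<Omega>" and v2: "Ck_on 2 \<Omega> v" and v1: "C1_bar \<Omega> v"
    and v0: "\<And>x. x \<in> frontier \<Omega> \<Longrightarrow> v x = 0" and lap: "bounded_continuous \<Omega> (lap v)"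
  shows "dom_integral \<Omega> (\<lambda>x. v x * lap v x) \<le> 0"
proof (rule LIMSEQ_le_const2)
  note T = dom_integral_soft_threshold_lap_nonpos[OF \<Omega> v2 v1 v0 lap]
  have vl: "integrable (lebesgue_on \<Omega>) (\<lambda>x. v x * lap v x)"
    by (intro bounded_continuous_integrable \<Omega> bounded_continuous_mult C1_bar_bounded_continuous v1 lap)
  show "(\<lambda>n. dom_integral \<Omega> (\<lambda>x. soft_threshold (1 / real (Suc n)) (v x) * lap v x)) \<longlonglongrightarrow>
      dom_integral \<Omega> (\<lambda>x. v x * lap v x)"
  proof (rule integral_dominated_convergence[where w = "\<lambda>x. \<bar>v x * lap v x\<bar>"])
    show "(\<lambda>x. v x * lap v x) \<in> borel_measurable (lebesgue_on \<Omega>)" using vl by (rule borel_measurable_integrable)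
    show "(\<lambda>x. soft_threshold (1 / real (Suc n)) (v x) * lap v x) \<in> borel_measurable (lebesgue_on \<Omega>)" for n
      by (rule borel_measurable_integrable[OF T(1)]) auto
    show "integrable (lebesgue_on \<Omega>) (\<lambda>x. \<bar>v x * lap v x\<bar>)" using vl by (rule integrable_abs)
    show "AE x in lebesgue_on \<Omega>. (\<lambda>n. soft_threshold (1 / real (Suc n)) (v x) * lap v x) \<longlonglongrightarrow> v x * lap v x"
      by (intro AE_I2 tendsto_mult_right soft_threshold_tendsto)
    show "AE x in lebesgue_on \<Omega>. norm (soft_threshold (1 / real (Suc n)) (v x) * lap v x) \<le> \<bar>v x * lap v x\<bar>" for n
      by (intro AE_I2) (simp add: abs_mult mult_right_mono abs_soft_threshold_le)
  qed
  show "\<exists>N. \<forall>n\<ge>N. dom_integral \<Omega> (\<lambda>x. soft_threshold (1 / real (Suc n)) (v x) * lap v x) \<le> 0"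
    using T(2) by auto
qed

section \<open>One step of the scheme\<close>

text \<open>
  An integral equal to zero would force \<open>f = 0\<close> almost everywhere, but a nonempty open set is not null.
\<close>

lemma bounded_continuous_integral_pos:
  fixes f :: scalar_field
  assumes \<Omega>: "open \<Omega>" "bounded \<Omega>" "\<Omega> \<noteq> {}" and f: "bounded_continuous \<Omega> f"
    and pos: "\<And>x. x \<in> \<Omega> \<Longrightarrow> 0 < f x"
  shows "0 < dom_integral \<Omega> f"
proof -
  have I: "integrable (lebesgue_on \<Omega>) f" by (rule bounded_continuous_integrable[OF \<Omega>(1,2) f])
  have nn: "AE x in lebesgue_on \<Omega>. 0 \<le> f x" using pos by (intro AE_I2) (auto intro: less_imp_le)
  have "dom_integral \<Omega> f \<noteq> 0"
  proof
    assume "dom_integral \<Omega> f = 0"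
    then have "AE x in lebesgue_on \<Omega>. f x = 0"
      using integral_nonneg_eq_0_iff_AE[OF I nn] by simp
    then have "AE x in lebesgue. x \<in> \<Omega> \<longrightarrow> f x = 0"
      using \<Omega>(1) by (simp add: AE_restrict_space_iff)
    then have "AE x in lebesgue. x \<notin> \<Omega>"
      by eventually_elim (use pos in fastforce)
    then have "negligible \<Omega>"
      using \<Omega>(1) by (simp add: negligible_iff_null_sets AE_iff_null_sets)
    then show False using open_not_negligible[OF \<Omega>(1,3)] by simp
  qed
  moreover have "0 \<le> dom_integral \<Omega> f" by (rule integral_nonneg_AE[OF nn])
  ultimately show ?thesis by simp
qed

lemma l2_norm_power2:
  fixes f :: "plane \<Rightarrow> 'b::euclidean_space"
  shows "(l2_norm \<Omega> f)\<^sup>2 = dom_integral \<Omega> (\<lambda>x. (norm (f x))\<^sup>2)"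
  unfolding l2_norm_def by (intro real_sqrt_pow2 Bochner_Integration.integral_nonneg) simp

text \<open>
  The boundary condition provides some normal with vanishing normal derivative; by uniqueness it is
  the given one.
\<close>

lemma zero_neumann_normal_limit:
  assumes "zero_neumann \<Omega> f" "b \<in> frontier \<Omega>" "outward_unit_normal \<Omega> b n"
  shows "((\<lambda>y. grad f y \<bullet> n) \<longlongrightarrow> 0) (at b within \<Omega>)"
proof -
  obtain n' where "outward_unit_normal \<Omega> b n'" "((\<lambda>y. grad f y \<bullet> n') \<longlongrightarrow> 0) (at b within \<Omega>)"
    using assms unfolding zero_neumann_def has_normal_derivative_def by blast
  then show ?thesis using outward_unit_normal_unique[OF assms(3)] by simp
qed

text \<open>
  In the interior the normal component is that of \<open>ut\<close> minus \<open>dt\<close> times the normal derivative of \<open>\<psi>\<close>,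
  and both tend to zero at the boundary point.
\<close>

lemma normal_trace_of_projected_velocity:
  assumes \<Omega>: "open \<Omega>" and u': "C1_bar \<Omega> u'" and ut: "C1_bar \<Omega> ut" and dir: "zero_dirichlet \<Omega> ut"
    and neu: "zero_neumann \<Omega> \<psi>" and eq: "\<And>x. x \<in> \<Omega> \<Longrightarrow> u' x = ut x - dt *\<^sub>R grad \<psi> x"
    and b: "b \<in> frontier \<Omega>" and n: "outward_unit_normal \<Omega> b n"
  shows "u' b \<bullet> n = 0"
proof -
  have bc: "b \<in> closure \<Omega>" "b \<notin> \<Omega>" using b \<Omega> by (auto simp: frontier_def interior_open)
  then have nt: "at b within \<Omega> \<noteq> bot" by (auto simp: trivial_limit_within islimpt_in_closure)
  have lim: "(f \<longlongrightarrow> f b) (at b within \<Omega>)" if "C1_bar \<Omega> f" for f :: vector_field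
    using C1_barD(1)[OF that] bc(1) closure_subset[of \<Omega>]
    by (auto simp: continuous_on_def intro: tendsto_within_subset)
  have "((\<lambda>y. u' y \<bullet> n) \<longlongrightarrow> u' b \<bullet> n) (at b within \<Omega>)" by (intro tendsto_intros lim u')
  moreover have "((\<lambda>y. u' y \<bullet> n) \<longlongrightarrow> 0) (at b within \<Omega>)"
  proof -
    have "((\<lambda>y. ut y \<bullet> n - dt * (grad \<psi> y \<bullet> n)) \<longlongrightarrow> ut b \<bullet> n - dt * 0) (at b within \<Omega>)"
      by (intro tendsto_intros lim ut zero_neumann_normal_limit[OF neu b n])
    then have "((\<lambda>y. ut y \<bullet> n - dt * (grad \<psi> y \<bullet> n)) \<longlongrightarrow> 0) (at b within \<Omega>)"
      using dir b by (simp add: zero_dirichlet_def)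
    then show ?thesis
      by (rule Lim_transform_eventually)
        (auto simp: eventually_at_filter eq inner_diff_left intro!: always_eventually)
  qed
  ultimately show ?thesis by (rule tendsto_unique[OF nt])
qed

lemma dvg_diff_scaleR:
  assumes "F differentiable (at x)" "G differentiable (at x)"
  shows "dvg (\<lambda>y. F y - c *\<^sub>R G y) x = dvg F x - c * dvg G x"
proof -
  have "((\<lambda>y. F y - c *\<^sub>R G y) has_derivative
      (\<lambda>h. frechet_derivative F (at x) h - c *\<^sub>R frechet_derivative G (at x) h)) (at x)"
    by (intro derivative_intros has_derivative_frechet assms)
  from frechet_derivative_at[OF this, symmetric]
  show ?thesis by (simp add: dvg_def inner_diff_left sum_subtractf sum_distrib_left)
qed

lemma classicalD:
  assumes "classical \<Omega> f"
  shows "Ck_on 2 \<Omega> f" "C1_bar \<Omega> f" "\<And>x. x \<in> \<Omega> \<Longrightarrow> f differentiable (at x)"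
  using assms C1_barD(2) unfolding classical_def by blast+

locale scheme_step =
  fixes \<Omega> :: "plane set" and m :: nat and z D :: "nat \<Rightarrow> real"
    and \<epsilon> \<nu> C0 dt :: real and S :: level and W :: stage and S' :: level
  assumes lip: "bounded_lipschitz_domain \<Omega>"
    and D_pos: "\<And>i. i \<in> {1..m} \<Longrightarrow> 0 < D i"
    and \<nu>_pos: "0 < \<nu>" and dt_pos: "0 < dt"
    and shift: "energy_shift \<Omega> m z \<epsilon> C0"
    and reg: "regular_level \<Omega> m S" and pos: "positive_level \<Omega> m S"
    and step: "scheme1 \<Omega> m z D \<epsilon> \<nu> C0 dt S W S'"
begin

abbreviation "\<rho> \<equiv> charge m z (conc S')"
abbreviation "R \<equiv> sqrt (E_npp \<Omega> m z (conc S') (potbar W) + C0)"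
abbreviation "\<mu> \<equiv> \<lambda>i x. ln (conc S' i x) + z i * potbar W x"

lemma domain: "open \<Omega>" "bounded \<Omega>" "\<Omega> \<noteq> {}"
  using bounded_lipschitz_domainD[OF lip] by blast+

lemma step_unfolded:
  shows reg_stage: "regular_stage \<Omega> m W" and reg': "regular_level \<Omega> m S'"
    and xi_eq: "xi S' = sav S' / R"
    and cbar_eq: "\<And>i x. i \<in> {1..m} \<Longrightarrow> x \<in> closure \<Omega> \<Longrightarrow> cbar W i x = exp (sigma W i x)"
    and lam_eq: "\<And>i. i \<in> {1..m} \<Longrightarrow> lam W i * dom_integral \<Omega> (cbar W i) - dom_integral \<Omega> (conc S i) = 0"
    and conc_eq: "\<And>i x. i \<in> {1..m} \<Longrightarrow> x \<in> closure \<Omega> \<Longrightarrow> conc S' i x = lam W i * cbar W i x"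
    and poisson: "neumann_poisson \<Omega> \<epsilon> \<rho> (potbar W)"
    and momentum: "\<And>x. x \<in> \<Omega> \<Longrightarrow> (1 / dt) *\<^sub>R (velt W x - vel S x)
             + xi S' *\<^sub>R (convect (vel S) (vel S) x + \<rho> x *\<^sub>R grad (potbar W) x)
             - \<nu> *\<^sub>R vec_lap (velt W) x + grad (pres S) x = 0"
    and dirichlet: "zero_dirichlet \<Omega> (velt W)"
    and psi_eq: "\<And>x. x \<in> \<Omega> \<Longrightarrow> lap (psi W) x = 1 / dt * dvg (velt W) x"
    and psi_neumann: "zero_neumann \<Omega> (psi W)"
    and vel_eq: "\<And>x. x \<in> \<Omega> \<Longrightarrow> vel S' x = velt W x - dt *\<^sub>R grad (psi W) x"
    and pres_eq: "\<And>x. x \<in> closure \<Omega> \<Longrightarrow> pres S' x = psi W x + pres S x"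
    and sav_eq: "(sav S' - sav S) / dt =
         - 1 / (2 * R) *
           (xi S' * dom_integral \<Omega> (\<lambda>x. \<Sum>i=1..m. D i * conc S' i x * (norm (grad (\<mu> i) x))\<^sup>2)
            - dom_integral \<Omega> (\<lambda>x. \<rho> x *\<^sub>R grad (potbar W) x \<bullet> velt W x)
            - dom_integral \<Omega> (\<lambda>x. convect (vel S) (vel S) x \<bullet> velt W x))"
  using step unfolding scheme1_def Let_def by blast+

lemma field_regularity:
  shows "\<And>i. i \<in> {1..m} \<Longrightarrow> C1_bar \<Omega> (conc S i)" "\<And>i. i \<in> {1..m} \<Longrightarrow> C1_bar \<Omega> (conc S' i)"
    "\<And>i. i \<in> {1..m} \<Longrightarrow> C1_bar \<Omega> (sigma W i)"
    "C1_bar \<Omega> (vel S)" "C1_bar \<Omega> (vel S')" "C1_bar \<Omega> (pres S)" "C1_bar \<Omega> (pres S')"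
    "classical \<Omega> (potbar W)" "classical \<Omega> (velt W)" "classical \<Omega> (psi W)"
  using reg reg' reg_stage unfolding regular_level_def regular_stage_def classical_def by blast+

lemma lam_pos:
  assumes i: "i \<in> {1..m}"
  shows "0 < lam W i"
proof -
  have "0 < dom_integral \<Omega> (conc S i)"
    using pos i closure_subset[of \<Omega>]
    by (intro bounded_continuous_integral_pos domain C1_bar_bounded_continuous field_regularity)
      (auto simp: positive_level_def)
  moreover have "0 < dom_integral \<Omega> (cbar W i)"
  proof (rule bounded_continuous_integral_pos[OF domain])
    have "continuous_on (closure \<Omega>) (cbar W i)"
      using cbar_eq[OF i] C1_barD(1)[OF field_regularity(3)[OF i]] by (simp add: continuous_on_exp cong: continuous_on_cong)
    then show "bounded_continuous \<Omega> (cbar W i)"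
      by (rule bounded_continuous_if_continuous_on_closure[OF _ domain(2)])
    show "0 < cbar W i x" if "x \<in> \<Omega>" for x using cbar_eq[OF i, of x] that closure_subset[of \<Omega>] by auto
  qed
  ultimately show ?thesis
    using lam_eq[OF i] zero_less_mult_pos2[of "lam W i" "dom_integral \<Omega> (cbar W i)"] by simp
qed

lemma conc_pos: "i \<in> {1..m} \<Longrightarrow> x \<in> closure \<Omega> \<Longrightarrow> 0 < conc S' i x"
  using lam_pos conc_eq cbar_eq by simp

lemma mass_eq:
  assumes i: "i \<in> {1..m}"
  shows "dom_integral \<Omega> (conc S' i) = dom_integral \<Omega> (conc S i)"
proof -
  have "dom_integral \<Omega> (conc S' i) = dom_integral \<Omega> (\<lambda>x. lam W i * cbar W i x)"
    using conc_eq[OF i] closure_subset[of \<Omega>] by (intro Bochner_Integration.integral_cong) auto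
  also have "\<dots> = lam W i * dom_integral \<Omega> (cbar W i)" by simp
  finally show ?thesis using lam_eq[OF i] by simp
qed

lemma R_ge_1: "1 \<le> R"
proof -
  have "1 \<le> E_npp \<Omega> m z (conc S') (potbar W) + C0"
    using shift conc_pos poisson reg' unfolding energy_shift_def regular_level_def by blast
  then show ?thesis by simp
qed

lemma vel_solenoidal:
  assumes x: "x \<in> \<Omega>"
  shows "dvg (vel S') x = 0"
proof -
  have d: "(velt W) differentiable (at x)" "(grad (psi W)) differentiable (at x)"
    using classicalD(3)[OF field_regularity(9)] grad_differentiable[OF classicalD(1)[OF field_regularity(10)]] x by auto
  then have "(\<lambda>y. velt W y - dt *\<^sub>R grad (psi W) y) differentiable (at x)" by simp
  then have "dvg (vel S') x = dvg (\<lambda>y. velt W y - dt *\<^sub>R grad (psi W) y) x"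
    by (rule dvg_eq_on_open[OF _ domain(1) x]) (simp add: vel_eq)
  also have "\<dots> = dvg (velt W) x - dt * lap (psi W) x"
    unfolding lap_def by (rule dvg_diff_scaleR[OF d])
  finally show ?thesis using psi_eq[OF x] dt_pos by simp
qed

lemma vel_grad_orthogonal:
  assumes "C1_bar \<Omega> q"
  shows "dom_integral \<Omega> (\<lambda>x. vel S' x \<bullet> grad q x) = 0"
proof (rule dom_integral_inner_grad_solenoidal[OF lip field_regularity(5) _ _ assms])
  show "dvg (vel S') x = 0" if "x \<in> \<Omega>" for x using that by (rule vel_solenoidal)
  show "vel S' b \<bullet> n = 0" if "b \<in> frontier \<Omega>" "outward_unit_normal \<Omega> b n" for b n
    by (rule normal_trace_of_projected_velocity[OF domain(1) field_regularity(5) classicalD(2)[OF field_regularity(9)]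
          dirichlet psi_neumann vel_eq that])
qed

lemma grad_pres:
  assumes x: "x \<in> \<Omega>"
  shows "grad (pres S') x = grad (psi W) x + grad (pres S) x"
proof -
  have "((\<lambda>y. psi W y + pres S y) has_derivative
      (\<lambda>h. frechet_derivative (psi W) (at x) h + frechet_derivative (pres S) (at x) h)) (at x)"
    using classicalD(3)[OF field_regularity(10) x] C1_barD(2)[OF field_regularity(6) x]
    by (intro derivative_intros has_derivative_frechet)
  then have "(pres S' has_derivative
      (\<lambda>h. frechet_derivative (psi W) (at x) h + frechet_derivative (pres S) (at x) h)) (at x)"
    by (rule has_derivative_transform_within_open[OF _ domain(1) x]) (use pres_eq closure_subset[of \<Omega>] in auto)
  from frechet_derivative_at[OF this, symmetric]
  show ?thesis by (simp add: grad_def scaleR_left_distrib sum.distrib)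
qed

lemmas field_bounds =
  C1_bar_bounded_continuous[OF field_regularity(4) domain(2)] C1_bar_bounded_continuous[OF field_regularity(5) domain(2)]
  C1_bar_bounded_continuous[OF classicalD(2)[OF field_regularity(9)] domain(2)]
  C1_bar_grad_bounded_continuous[OF field_regularity(6) domain(2)] C1_bar_grad_bounded_continuous[OF field_regularity(7) domain(2)]
  C1_bar_grad_bounded_continuous[OF classicalD(2)[OF field_regularity(8)] domain(2)]
  C1_bar_grad_bounded_continuous[OF classicalD(2)[OF field_regularity(10)] domain(2)]
  C1_bar_convect_bounded_continuous[OF field_regularity(4) domain(2) C1_bar_bounded_continuous[OF field_regularity(4) domain(2)]]

lemma charge_bounded_continuous: "bounded_continuous \<Omega> \<rho>"
  unfolding charge_def[abs_def]
  by (intro bounded_continuous_intros C1_bar_bounded_continuous field_regularity domain)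

text \<open>
  The momentum equation expresses the viscous term by first order quantities, which are
  bounded. Interior regularity of \<open>utilde\<close> alone would not give this.
\<close>

lemma vec_lap_bounded_continuous: "bounded_continuous \<Omega> (vec_lap (velt W))"
proof (rule bounded_continuous_cong)
  show "bounded_continuous \<Omega> (\<lambda>x. (1 / \<nu>) *\<^sub>R ((1 / dt) *\<^sub>R (velt W x - vel S x)
             + xi S' *\<^sub>R (convect (vel S) (vel S) x + \<rho> x *\<^sub>R grad (potbar W) x) + grad (pres S) x))"
    by (intro bounded_continuous_intros field_bounds charge_bounded_continuous)
  fix x assume "x \<in> \<Omega>"
  from momentum[OF this] have "(1 / dt) *\<^sub>R (velt W x - vel S x)
             + xi S' *\<^sub>R (convect (vel S) (vel S) x + \<rho> x *\<^sub>R grad (potbar W) x) + grad (pres S) x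
             = \<nu> *\<^sub>R vec_lap (velt W) x" by (simp add: algebra_simps)
  then show "(1 / \<nu>) *\<^sub>R ((1 / dt) *\<^sub>R (velt W x - vel S x)
             + xi S' *\<^sub>R (convect (vel S) (vel S) x + \<rho> x *\<^sub>R grad (potbar W) x) + grad (pres S) x)
        = vec_lap (velt W) x" using \<nu>_pos by simp
qed

text \<open>
  The vector Laplacian acts on each component separately, and each component vanishes on the
  boundary.
\<close>

lemma viscous_dissipation: "dom_integral \<Omega> (\<lambda>x. vec_lap (velt W) x \<bullet> velt W x) \<le> 0"
proof -
  let ?v = "\<lambda>b y. velt W y \<bullet> b"
  have comp: "vec_lap (velt W) x \<bullet> b = lap (?v b) x" if "b \<in> Basis" for b x
    using that by (simp add: vec_lap_def)
  have lb: "bounded_continuous \<Omega> (lap (?v b))" if "b \<in> Basis" for b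
    by (rule bounded_continuous_cong[OF bounded_continuous_inner[OF vec_lap_bounded_continuous
          bounded_continuous_const[of \<Omega> b]]]) (simp add: comp that)
  have vb: "C1_bar \<Omega> (?v b)" for b by (rule C1_bar_inner_const[OF classicalD(2)[OF field_regularity(9)]])
  have "dom_integral \<Omega> (\<lambda>x. vec_lap (velt W) x \<bullet> velt W x) =
      dom_integral \<Omega> (\<lambda>x. \<Sum>b\<in>Basis. ?v b x * lap (?v b) x)"
  proof (rule Bochner_Integration.integral_cong[OF refl])
    fix x
    have "vec_lap (velt W) x \<bullet> velt W x = (\<Sum>b\<in>Basis. (vec_lap (velt W) x \<bullet> b) * (velt W x \<bullet> b))"
      by (rule euclidean_inner)
    also have "\<dots> = (\<Sum>b\<in>Basis. ?v b x * lap (?v b) x)"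
      by (intro sum.cong refl) (simp add: comp mult.commute)
    finally show "vec_lap (velt W) x \<bullet> velt W x = (\<Sum>b\<in>Basis. ?v b x * lap (?v b) x)" .
  qed
  also have "\<dots> = (\<Sum>b\<in>Basis. dom_integral \<Omega> (\<lambda>x. ?v b x * lap (?v b) x))"
    by (intro Bochner_Integration.integral_sum bounded_continuous_integrable domain bounded_continuous_mult
        lb C1_bar_bounded_continuous vb)
  also have "\<dots> \<le> 0"
    by (intro sum_nonpos dom_integral_mult_lap_nonpos domain vb lb
        Ck_on_inner_const[OF domain(1) classicalD(1)[OF field_regularity(9)]])
      (use dirichlet in \<open>simp_all add: zero_dirichlet_def\<close>)
  finally show ?thesis .
qed

text \<open>
  Here \<open>u' + dt \<nabla>p' = utilde + dt \<nabla>p\<close> is squared, and \<open>utilde\<close> is expressed through the momentum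
  equation tested with \<open>2 dt utilde\<close>.
\<close>

lemma energy_identity_pointwise:
  assumes x: "x \<in> \<Omega>"
  shows "(norm (vel S' x))\<^sup>2 + dt\<^sup>2 * (norm (grad (pres S') x))\<^sup>2 =
    (norm (vel S x))\<^sup>2 + dt\<^sup>2 * (norm (grad (pres S) x))\<^sup>2 - (norm (velt W x - vel S x))\<^sup>2
    - 2 * dt * xi S' * (convect (vel S) (vel S) x \<bullet> velt W x)
    - 2 * dt * xi S' * (\<rho> x *\<^sub>R grad (potbar W) x \<bullet> velt W x)
    + 2 * dt * \<nu> * (vec_lap (velt W) x \<bullet> velt W x)
    - 2 * dt * (vel S' x \<bullet> grad (pres S') x)"
proof -
  let ?c = "convect (vel S) (vel S) x" and ?f = "\<rho> x *\<^sub>R grad (potbar W) x" and ?l = "vec_lap (velt W) x"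
  let ?ut = "velt W x" and ?u = "vel S x" and ?p = "grad (pres S) x"
  have "vel S' x + dt *\<^sub>R grad (pres S') x = ?ut + dt *\<^sub>R ?p"
    using vel_eq[OF x] grad_pres[OF x] by (simp add: algebra_simps)
  then have 1: "(norm (vel S' x + dt *\<^sub>R grad (pres S') x))\<^sup>2 = (norm (?ut + dt *\<^sub>R ?p))\<^sup>2" by simp
  have 2: "(norm (a + dt *\<^sub>R b))\<^sup>2 = (norm a)\<^sup>2 + dt\<^sup>2 * (norm b)\<^sup>2 + 2 * dt * (a \<bullet> b)" for a b :: plane
    unfolding power2_norm_eq_inner
    by (simp add: inner_add_left inner_add_right inner_commute[of b a] power2_eq_square algebra_simps)
  have "((1 / dt) *\<^sub>R (?ut - ?u) + xi S' *\<^sub>R (?c + ?f) - \<nu> *\<^sub>R ?l + ?p) \<bullet> ?ut = 0"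
    using momentum[OF x] by simp
  then have "(1 / dt) * ((?ut - ?u) \<bullet> ?ut) + xi S' * (?c \<bullet> ?ut + ?f \<bullet> ?ut) - \<nu> * (?l \<bullet> ?ut) + ?p \<bullet> ?ut = 0"
    by (simp only: inner_add_left inner_diff_left inner_scaleR_left)
  then have "2 * dt * ((1 / dt) * ((?ut - ?u) \<bullet> ?ut) + xi S' * (?c \<bullet> ?ut + ?f \<bullet> ?ut) - \<nu> * (?l \<bullet> ?ut) + ?p \<bullet> ?ut) = 0"
    by simp
  then have 3: "2 * ((?ut - ?u) \<bullet> ?ut) + 2 * dt * xi S' * (?c \<bullet> ?ut) + 2 * dt * xi S' * (?f \<bullet> ?ut)
      - 2 * dt * \<nu> * (?l \<bullet> ?ut) + 2 * dt * (?p \<bullet> ?ut) = 0"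
    using dt_pos by (simp add: distrib_left right_diff_distrib mult.assoc)
  have 4: "2 * ((?ut - ?u) \<bullet> ?ut) = (norm ?ut)\<^sup>2 - (norm ?u)\<^sup>2 + (norm (?ut - ?u))\<^sup>2"
    by (simp add: power2_norm_eq_inner inner_diff_left inner_diff_right inner_commute)
  from 1 3 4 show ?thesis unfolding 2 by (simp only: inner_commute[of ?ut ?p])
qed

lemma kinetic_balance:
  "(l2_norm \<Omega> (vel S'))\<^sup>2 + dt\<^sup>2 * (l2_norm \<Omega> (grad (pres S')))\<^sup>2 \<le>
   (l2_norm \<Omega> (vel S))\<^sup>2 + dt\<^sup>2 * (l2_norm \<Omega> (grad (pres S)))\<^sup>2
    - 2 * dt * xi S' * dom_integral \<Omega> (\<lambda>x. convect (vel S) (vel S) x \<bullet> velt W x)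
    - 2 * dt * xi S' * dom_integral \<Omega> (\<lambda>x. \<rho> x *\<^sub>R grad (potbar W) x \<bullet> velt W x)"
proof -
  note bc = bounded_continuous_intros field_bounds charge_bounded_continuous vec_lap_bounded_continuous
  note bi = bounded_continuous_integrable[OF domain(1,2)]
  let ?F1 = "\<lambda>x. (norm (vel S' x))\<^sup>2" and ?F2 = "\<lambda>x. (norm (grad (pres S') x))\<^sup>2"
  let ?G1 = "\<lambda>x. (norm (vel S x))\<^sup>2" and ?G2 = "\<lambda>x. (norm (grad (pres S) x))\<^sup>2"
  let ?Q = "\<lambda>x. (norm (velt W x - vel S x))\<^sup>2"
  let ?B = "\<lambda>x. convect (vel S) (vel S) x \<bullet> velt W x"
  let ?A = "\<lambda>x. \<rho> x *\<^sub>R grad (potbar W) x \<bullet> velt W x"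
  let ?Z = "\<lambda>x. vec_lap (velt W) x \<bullet> velt W x"
  let ?P = "\<lambda>x. vel S' x \<bullet> grad (pres S') x"
  have I: "integrable (lebesgue_on \<Omega>) ?F1" "integrable (lebesgue_on \<Omega>) ?F2"
    "integrable (lebesgue_on \<Omega>) ?G1" "integrable (lebesgue_on \<Omega>) ?G2" "integrable (lebesgue_on \<Omega>) ?Q"
    "integrable (lebesgue_on \<Omega>) ?B" "integrable (lebesgue_on \<Omega>) ?A" "integrable (lebesgue_on \<Omega>) ?Z"
    "integrable (lebesgue_on \<Omega>) ?P"
    by (rule bi, intro bc)+
  have "dom_integral \<Omega> (\<lambda>x. ?F1 x + dt\<^sup>2 * ?F2 x) = dom_integral \<Omega> (\<lambda>x. ?G1 x + dt\<^sup>2 * ?G2 x - ?Q x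
      - 2 * dt * xi S' * ?B x - 2 * dt * xi S' * ?A x + 2 * dt * \<nu> * ?Z x - 2 * dt * ?P x)"
    by (rule Bochner_Integration.integral_cong[OF refl]) (use energy_identity_pointwise in simp)
  then have "dom_integral \<Omega> ?F1 + dt\<^sup>2 * dom_integral \<Omega> ?F2 =
      dom_integral \<Omega> ?G1 + dt\<^sup>2 * dom_integral \<Omega> ?G2 - dom_integral \<Omega> ?Q
      - 2 * dt * xi S' * dom_integral \<Omega> ?B - 2 * dt * xi S' * dom_integral \<Omega> ?A
      + 2 * dt * \<nu> * dom_integral \<Omega> ?Z - 2 * dt * dom_integral \<Omega> ?P"
    using I by (simp del: inner_scaleR_left)
  moreover have "2 * dt * dom_integral \<Omega> ?P = 0" by (simp only: vel_grad_orthogonal[OF field_regularity(7)])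
  moreover have "0 \<le> dom_integral \<Omega> ?Q" by (rule Bochner_Integration.integral_nonneg) simp
  moreover have "2 * dt * \<nu> * dom_integral \<Omega> ?Z \<le> 0"
    using viscous_dissipation dt_pos \<nu>_pos by (simp add: mult_le_0_iff)
  ultimately show ?thesis unfolding l2_norm_power2 by linarith
qed

text \<open>
  The equation for \<open>r\<close> is multiplied by \<open>2 dt r'\<close>. Since \<open>r' = \<xi> R\<close>, the factor \<open>1 / (2 R)\<close> turns into
  \<open>\<xi> / 2\<close>, so the coupling terms have half the weight that they have in the kinetic balance.
\<close>

lemma sav_balance:
  "(sav S')\<^sup>2 \<le> (sav S)\<^sup>2
    + dt * xi S' * dom_integral \<Omega> (\<lambda>x. convect (vel S) (vel S) x \<bullet> velt W x)
    + dt * xi S' * dom_integral \<Omega> (\<lambda>x. \<rho> x *\<^sub>R grad (potbar W) x \<bullet> velt W x)"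
proof -
  define d where "d = dom_integral \<Omega> (\<lambda>x. \<Sum>i=1..m. D i * conc S' i x * (norm (grad (\<mu> i) x))\<^sup>2)"
  define A where "A = dom_integral \<Omega> (\<lambda>x. \<rho> x *\<^sub>R grad (potbar W) x \<bullet> velt W x)"
  define B where "B = dom_integral \<Omega> (\<lambda>x. convect (vel S) (vel S) x \<bullet> velt W x)"
  define R0 where "R0 = R"
  define \<xi> where "\<xi> = xi S'"
  have R0: "R0 \<ge> 1" using R_ge_1 by (simp add: R0_def)
  have r': "sav S' = \<xi> * R0" using xi_eq R0 by (simp add: \<xi>_def R0_def[symmetric])
  have "d \<ge> 0"
    unfolding d_def
  proof (rule integral_nonneg_AE, rule AE_I2)
    fix x assume "x \<in> space (lebesgue_on \<Omega>)"
    then have "x \<in> closure \<Omega>" using closure_subset[of \<Omega>] by auto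
    then show "0 \<le> (\<Sum>i=1..m. D i * conc S' i x * (norm (grad (\<mu> i) x))\<^sup>2)"
      using D_pos conc_pos by (intro sum_nonneg mult_nonneg_nonneg) (auto intro: less_imp_le)
  qed
  have "(sav S' - sav S) / dt = - 1 / (2 * R0) * (\<xi> * d - A - B)"
    using sav_eq by (simp only: d_def A_def B_def R0_def \<xi>_def)
  then have eq: "sav S' - sav S = - dt / (2 * R0) * (\<xi> * d - A - B)"
    using dt_pos by (simp add: field_simps)
  have "2 * (\<xi> * R0) * (- dt / (2 * R0) * X) = - dt * \<xi> * X" for X
    using R0 by simp
  then have "2 * sav S' * (sav S' - sav S) = - dt * \<xi> * (\<xi> * d - A - B)"
    unfolding eq unfolding r' .
  moreover have "(sav S')\<^sup>2 - (sav S)\<^sup>2 = 2 * sav S' * (sav S' - sav S) - (sav S' - sav S)\<^sup>2"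
    by (simp add: power2_eq_square algebra_simps)
  moreover have "0 \<le> dt * (\<xi> * \<xi>) * d" using dt_pos \<open>d \<ge> 0\<close> by simp
  moreover have "0 \<le> (sav S' - sav S)\<^sup>2" by simp
  ultimately have "(sav S')\<^sup>2 \<le> (sav S)\<^sup>2 + dt * \<xi> * B + dt * \<xi> * A"
    by (simp only: algebra_simps)
  then show ?thesis by (simp only: A_def B_def \<xi>_def)
qed

theorem energy_dissipation: "discrete_energy \<Omega> dt S' \<le> discrete_energy \<Omega> dt S"
  using kinetic_balance sav_balance unfolding discrete_energy_def power2_abs by (simp only: algebra_simps)

end

section \<open>Properties of the scheme\<close>

theorem theorem3p2p1:
  fixes \<Omega> :: "plane set" and m :: nat and z D :: "nat \<Rightarrow> real"
    and \<epsilon> \<nu> C0 dt :: real and S0 :: level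
  assumes "bounded_lipschitz_domain \<Omega>"
    and "m \<ge> 1"
    and "\<forall>i\<in>{1..m}. D i > 0"
    and "\<epsilon> > 0" and "\<nu> > 0" and "dt > 0"
    and "C0 > 0" and "energy_shift \<Omega> m z \<epsilon> C0"
    and "initial_level \<Omega> m z \<epsilon> C0 S0"
  shows
    "(\<forall>S W S'.
        regular_level \<Omega> m S \<and> positive_level \<Omega> m S \<and>
        (\<forall>i\<in>{1..m}. dom_integral \<Omega> (conc S i) = dom_integral \<Omega> (conc S0 i)) \<and>
        scheme1 \<Omega> m z D \<epsilon> \<nu> C0 dt S W S' \<longrightarrow>
          (\<forall>i\<in>{1..m}. \<forall>x\<in>closure \<Omega>. conc S' i x > 0) \<and>
          (\<forall>i\<in>{1..m}. dom_integral \<Omega> (conc S' i) = dom_integral \<Omega> (conc S i)) \<and>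
          discrete_energy \<Omega> dt S' - discrete_energy \<Omega> dt S \<le> 0) \<and>
     (\<forall>S W.
        S 0 = S0 \<and> (\<forall>n. scheme1 \<Omega> m z D \<epsilon> \<nu> C0 dt (S n) (W n) (S (Suc n))) \<longrightarrow>
          (\<exists>M. \<forall>n. l2_norm \<Omega> (vel (S n)) \<le> M \<and> \<bar>sav (S n)\<bar> \<le> M \<and> \<bar>xi (S n)\<bar> \<le> M))"
proof (intro conjI allI impI)
  have step: "scheme_step \<Omega> m z D \<epsilon> \<nu> C0 dt S W S'"
    if "regular_level \<Omega> m S" "positive_level \<Omega> m S" "scheme1 \<Omega> m z D \<epsilon> \<nu> C0 dt S W S'" for S W S'
    using that assms by unfold_locales auto
  {
    fix S W S'
    assume "regular_level \<Omega> m S \<and> positive_level \<Omega> m S \<and>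
        (\<forall>i\<in>{1..m}. dom_integral \<Omega> (conc S i) = dom_integral \<Omega> (conc S0 i)) \<and>
        scheme1 \<Omega> m z D \<epsilon> \<nu> C0 dt S W S'"
    then interpret scheme_step \<Omega> m z D \<epsilon> \<nu> C0 dt S W S' by (intro step) simp_all
    show "\<forall>i\<in>{1..m}. \<forall>x\<in>closure \<Omega>. conc S' i x > 0" using conc_pos by blast
    show "\<forall>i\<in>{1..m}. dom_integral \<Omega> (conc S' i) = dom_integral \<Omega> (conc S i)" using mass_eq by blast
    show "discrete_energy \<Omega> dt S' - discrete_energy \<Omega> dt S \<le> 0" using energy_dissipation by simp
  }
  fix S :: "nat \<Rightarrow> level" and W
  assume run: "S 0 = S0 \<and> (\<forall>n. scheme1 \<Omega> m z D \<epsilon> \<nu> C0 dt (S n) (W n) (S (Suc n)))"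
  have inv: "regular_level \<Omega> m (S n) \<and> positive_level \<Omega> m (S n) \<and>
      discrete_energy \<Omega> dt (S n) \<le> discrete_energy \<Omega> dt S0" for n
  proof (induction n)
    case 0
    then show ?case using run assms(9) by (simp add: initial_level_def)
  next
    case (Suc n)
    then interpret scheme_step \<Omega> m z D \<epsilon> \<nu> C0 dt "S n" "W n" "S (Suc n)"
      using run by (intro step) simp_all
    show ?case using reg' conc_pos energy_dissipation Suc by (auto simp: positive_level_def)
  qed
  define M where "M = 1 + 2 * discrete_energy \<Omega> dt S0"
  \<comment> \<open>Rougher than a square root, but one constant then serves all three quantities, including \<open>\<xi>\<^sup>0 = 1\<close>.\<close>
  have abs_le: "\<bar>a\<bar> \<le> 1 + b" if "a\<^sup>2 \<le> b" for a b :: real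
  proof -
    have "0 \<le> (\<bar>a\<bar> - 1)\<^sup>2" by simp
    then have "2 * \<bar>a\<bar> \<le> a\<^sup>2 + 1" by (simp add: power2_diff)
    moreover have "0 \<le> a\<^sup>2" by simp
    ultimately show ?thesis using that by linarith
  qed
  have parts_le: "v \<le> 2 * e" "s \<le> 2 * e"
    if "0 \<le> v" "0 \<le> p" "0 \<le> s" "1/2 * (v + p) + s \<le> e" for v p s e :: real
  proof -
    have "v + p + 2 * s \<le> 2 * e" using that(4) by (simp add: field_simps)
    then show "v \<le> 2 * e" "s \<le> 2 * e" using that(1-3) by simp_all
  qed
  have bounds: "l2_norm \<Omega> (vel (S n)) \<le> M \<and> \<bar>sav (S n)\<bar> \<le> M" for n
  proof -
    have "1/2 * ((l2_norm \<Omega> (vel (S n)))\<^sup>2 + dt\<^sup>2 * (l2_norm \<Omega> (grad (pres (S n))))\<^sup>2) + (sav (S n))\<^sup>2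
        \<le> discrete_energy \<Omega> dt S0"
      using inv[of n] by (simp add: discrete_energy_def)
    then have "(l2_norm \<Omega> (vel (S n)))\<^sup>2 \<le> 2 * discrete_energy \<Omega> dt S0"
      "(sav (S n))\<^sup>2 \<le> 2 * discrete_energy \<Omega> dt S0"
      by (rule parts_le[rotated 3]; simp)+
    then show ?thesis using abs_le abs_le_D1 unfolding M_def by blast
  qed
  have "\<bar>xi (S n)\<bar> \<le> M" for n
  proof (cases n)
    case 0
    have "0 \<le> discrete_energy \<Omega> dt S0" by (simp add: discrete_energy_def)
    then show ?thesis using 0 run assms(9) by (simp add: initial_level_def M_def)
  next
    case (Suc k)
    interpret scheme_step \<Omega> m z D \<epsilon> \<nu> C0 dt "S k" "W k" "S (Suc k)"
      using run inv by (intro step) simp_all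
    have "\<bar>xi (S n)\<bar> = \<bar>sav (S n)\<bar> / \<bar>R\<bar>" using xi_eq Suc by (simp add: abs_divide)
    also have "\<dots> \<le> \<bar>sav (S n)\<bar> / 1" using R_ge_1 by (intro divide_left_mono) auto
    also have "\<dots> \<le> M" using bounds by simp
    finally show ?thesis .
  qed
  then show "\<exists>M. \<forall>n. l2_norm \<Omega> (vel (S n)) \<le> M \<and> \<bar>sav (S n)\<bar> \<le> M \<and> \<bar>xi (S n)\<bar> \<le> M"
    using bounds by blast
qed

end
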